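(* Let $\mu=\mathcal N(0,\mathcal C)$ be a centered Gaussian on $\mathbb R^{n_u}\times\mathbb R^{n_v}$ with strictly positive-definite covariance $\mathcal C=\begin{bmatrix}\mathcal C_{uu}&\mathcal C_{uv}\\ \mathcal C_{vu}&\mathcal C_{vv}\end{bmatrix}$ and marginals $\mu_u=\mathcal N(0,\mathcal C_{uu})$, $\mu_v=\mathcal N(0,\mathcal C_{vv})$. Let $$\mathsf L_{\mathsf{cond}}(A,B;2,0)=\mathbb E_{(u,v)\sim\mu}\Bigl[\tfrac12\langle u,Bu\rangle-\langle u,Av\rangle\Bigr]+\mathbb E_{v\sim\mu_v}\Bigl[\log\mathbb E_{u\sim\mu_u}\exp\bigl(-\tfrac12\langle u,Bu\rangle+\langle u,Av\rangle\bigr)\Bigr].$$ The minimizer of $\mathsf L_{\mathsf{cond}}(A,B;2,0)$ over all matrices $A$ of size $n_u\times n_v$ and matrices $B$ of size $n_u\times n_u$ is $$A^\ast=\mathcal C_{u|v}^{-1}\mathcal C_{uv}\mathcal C_{vv}^{-1},\qquad B^\ast=\mathcal C_{uu}^{-1}\mathcal C_{uv}\mathcal C_{v|u}^{-1}\mathcal C_{vu}\mathcal C_{uu}^{-1}.$$ The minimizer of $\mathsf L_{\mathsf{cond}}(A,B;2,0)$ over the rank-constrained sets of matrices $\mathcal A_r=\{A\in\mathbb R^{n_u\times n_v}:\operatorname{rank}(A)\le r\}$ and $\mathcal B_r=\{B\in\mathbb R^{n_u\times n_u}:\operatorname{rank}(B)\le r\}$, for $0<r\le\min(n_u,n_v)$,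 is given by $$A^\ast(r)=(B^\ast(r)+\mathcal C_{uu}^{-1})^{1/2}\Bigl((B^\ast(r)+\mathcal C_{uu}^{-1})^{1/2}\mathcal C_{uv}\mathcal C_{vv}^{-1/2}\Bigr)_r\mathcal C_{vv}^{-1/2},$$ $$B^\ast(r)=\operatorname*{arg\,min}_{B\in\mathcal B_r}\ \operatorname{Tr}\bigl((B+\mathcal C_{uu}^{-1})\mathcal C_{u|v}\bigr)+\log\bigl|(B+\mathcal C_{uu}^{-1})\mathcal C_{u|v}\bigr|+\Bigl\|\bigl((B+\mathcal C_{uu}^{-1})^{1/2}\mathcal C_{uv}\mathcal C_{vv}^{-1/2}\bigr)_r-(B+\mathcal C_{uu}^{-1})^{1/2}\mathcal C_{uv}\mathcal C_{vv}^{-1/2}\Bigr\|_F^2.$$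
   Context: $\mathcal C_{u|v}=\mathcal C_{uu}-\mathcal C_{uv}\mathcal C_{vv}^{-1}\mathcal C_{vu}$ and $\mathcal C_{v|u}=\mathcal C_{vv}-\mathcal C_{vu}\mathcal C_{uu}^{-1}\mathcal C_{uv}$. $|M|$ denotes the determinant of a matrix $M$, $\|\cdot\|_F$ the Frobenius norm, and for any matrix $M$, $M_r$ denotes the rank-$r$ truncation of its singular value decomposition. The loss arises from fitting, in Kullback–Leibler divergence averaged over $v\sim\mu_v$, the $u|v$ conditional of the model $\nu(du,dv)=\frac1Z\exp(-\frac12|Gu-Hv|^2)\mu_u(du)\mu_v(dv)$ with linear encoders $G,H$; the loss depends on $(G,H)$ only through the products $A=G^\top H$ and $B=G^\top G$, and is then optimized over $(A,B)$.
   Formalization: log|(B+C_uu^-1)C_{u|v}| has a minus sign (with plus no argmin exists); the argmin is over symmetric B with B+C_uu^-1 positive definite; minimality is over all B, but uniqueness/characterization only for symmetric B (skew parts leave the loss unchanged); B*(r) and the truncation may be non-unique. *)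

theory Defs
  imports "HOL-Probability.Probability"
begin

section \<open>Matrix notions\<close>

definition pos_def :: "real^'n^'n \<Rightarrow> bool" where
  "pos_def M \<longleftrightarrow> transpose M = M \<and> (\<forall>x. x \<noteq> 0 \<longrightarrow> 0 < x \<bullet> (M *v x))"

definition pos_semidef :: "real^'n^'n \<Rightarrow> bool" where
  "pos_semidef M \<longleftrightarrow> transpose M = M \<and> (\<forall>x. 0 \<le> x \<bullet> (M *v x))"

text \<open>The square root of a symmetric positive semidefinite matrix; it is unspecified for any
  other matrix and is only used on positive definite ones.\<close>

definition mat_sqrt :: "real^'n^'n \<Rightarrow> real^'n^'n" where
  "mat_sqrt M = (THE S. pos_semidef S \<and> S ** S = M)"

definition outer :: "real^'m \<Rightarrow> real^'n \<Rightarrow> real^'n^'m" where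
  "outer x y = (\<chi> i j. x $ i * y $ j)"

definition orthonormal_upto :: "nat \<Rightarrow> (nat \<Rightarrow> 'a::real_inner) \<Rightarrow> bool" where
  "orthonormal_upto p x \<longleftrightarrow> (\<forall>i<p. \<forall>j<p. x i \<bullet> x j = (if i = j then 1 else 0))"

text \<open>Thin singular value decomposition \<open>M = (\<Sum>i<p. s i * x i * (y i)^T)\<close>, where \<open>p\<close> is the smaller
  dimension of \<open>M\<close>, with the singular values in decreasing order, zeros included.\<close>

definition is_svd :: "(nat \<Rightarrow> real) \<Rightarrow> (nat \<Rightarrow> real^'m) \<Rightarrow> (nat \<Rightarrow> real^'n) \<Rightarrow> real^'n^'m \<Rightarrow> bool" where
  "is_svd s x y M \<longleftrightarrow>
     (let p = min CARD('m) CARD('n) in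
        orthonormal_upto p x \<and> orthonormal_upto p y \<and>
        (\<forall>i<p. 0 \<le> s i) \<and> (\<forall>i j. i \<le> j \<and> j < p \<longrightarrow> s j \<le> s i) \<and>
        M = (\<Sum>i<p. s i *\<^sub>R outer (x i) (y i)))"

text \<open>The truncation depends on the chosen decomposition when the singular values number \<open>r\<close> and
  \<open>r + 1\<close> are equal and nonzero, so it is a relation; \<open>svd_trunc\<close> picks one truncation. The
  distance of a truncation to \<open>M\<close> does not depend on the choice.\<close>

definition is_svd_trunc :: "nat \<Rightarrow> real^'n^'m \<Rightarrow> real^'n^'m \<Rightarrow> bool" where
  "is_svd_trunc r M N \<longleftrightarrow>
     (\<exists>s x y. is_svd s x y M \<and>
        N = (\<Sum>i<min r (min CARD('m) CARD('n)). s i *\<^sub>R outer (x i) (y i)))"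

definition svd_trunc :: "nat \<Rightarrow> real^'n^'m \<Rightarrow> real^'n^'m" where
  "svd_trunc r M = (SOME N. is_svd_trunc r M N)"

section \<open>Blocks of the covariance and conditional covariances\<close>

text \<open>A point of \<open>real^('u + 'v)\<close> is a pair \<open>(u, v)\<close>: the \<open>Inl\<close> coordinates form \<open>u\<close>, the
  \<open>Inr\<close> coordinates form \<open>v\<close>.\<close>

definition u_part :: "real^('u::finite + 'v::finite) \<Rightarrow> real^'u" where
  "u_part w = (\<chi> i. w $ Inl i)"

definition v_part :: "real^('u::finite + 'v::finite) \<Rightarrow> real^'v" where
  "v_part w = (\<chi> j. w $ Inr j)"

definition C_uu :: "real^('u::finite + 'v::finite)^('u + 'v) \<Rightarrow> real^'u^'u" where
  "C_uu C = (\<chi> i j. C $ Inl i $ Inl j)"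

definition C_uv :: "real^('u::finite + 'v::finite)^('u + 'v) \<Rightarrow> real^'v^'u" where
  "C_uv C = (\<chi> i j. C $ Inl i $ Inr j)"

definition C_vu :: "real^('u::finite + 'v::finite)^('u + 'v) \<Rightarrow> real^'u^'v" where
  "C_vu C = (\<chi> i j. C $ Inr i $ Inl j)"

definition C_vv :: "real^('u::finite + 'v::finite)^('u + 'v) \<Rightarrow> real^'v^'v" where
  "C_vv C = (\<chi> i j. C $ Inr i $ Inr j)"

definition C_u_given_v :: "real^('u::finite + 'v::finite)^('u + 'v) \<Rightarrow> real^'u^'u" where
  "C_u_given_v C = C_uu C - C_uv C ** matrix_inv (C_vv C) ** C_vu C"

definition C_v_given_u :: "real^('u::finite + 'v::finite)^('u + 'v) \<Rightarrow> real^'v^'v" where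
  "C_v_given_u C = C_vv C - C_vu C ** matrix_inv (C_uu C) ** C_uv C"

section \<open>The conditional loss\<close>

definition gaussian :: "real^'n^'n \<Rightarrow> (real^'n) measure" where
  "gaussian S = density lborel
     (\<lambda>x. ennreal (exp (- (x \<bullet> (matrix_inv S *v x)) / 2) / sqrt ((2 * pi) ^ CARD('n) * det S)))"

definition ext_ln :: "ennreal \<Rightarrow> ereal" where
  "ext_ln x = (if x = 0 then -\<infinity> else if x = \<infinity> then \<infinity> else ereal (ln (enn2real x)))"

definition ext_expectation :: "'a measure \<Rightarrow> ('a \<Rightarrow> ereal) \<Rightarrow> ereal" where
  "ext_expectation M f =
     enn2ereal (\<integral>\<^sup>+ x. e2ennreal (f x) \<partial>M) - enn2ereal (\<integral>\<^sup>+ x. e2ennreal (- f x) \<partial>M)"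

text \<open>The loss is extended-real valued: the inner Gaussian integral is infinite, and the loss
  is \<open>\<infinity>\<close>, as soon as the symmetric part of \<open>B + C_uu\<^sup>-\<^sup>1\<close> is not positive definite. Note that
  \<open>e2ennreal\<close> maps negative numbers to 0, so \<open>ext_expectation\<close> is the difference of the
  integrals of the positive and the negative part.\<close>

definition cond_loss ::
  "real^('u::finite + 'v::finite)^('u + 'v) \<Rightarrow> real^'v^'u \<Rightarrow> real^'u^'u \<Rightarrow> ereal" where
  "cond_loss C A B =
     ereal (\<integral>w. (1/2) * (u_part w \<bullet> (B *v u_part w)) - u_part w \<bullet> (A *v v_part w) \<partial>gaussian C)
     + ext_expectation (gaussian (C_vv C))
         (\<lambda>v. ext_ln (\<integral>\<^sup>+ u. ennreal (exp (- (1/2) * (u \<bullet> (B *v u)) + u \<bullet> (A *v v)))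
                        \<partial>gaussian (C_uu C)))"

section \<open>The reduced objective of the rank-constrained problem\<close>

definition shifted :: "real^('u::finite + 'v::finite)^('u + 'v) \<Rightarrow> real^'u^'u \<Rightarrow> real^'u^'u" where
  "shifted C B = B + matrix_inv (C_uu C)"

definition whitened ::
  "real^('u::finite + 'v::finite)^('u + 'v) \<Rightarrow> real^'u^'u \<Rightarrow> real^'v^'u" where
  "whitened C B = mat_sqrt (shifted C B) ** C_uv C ** matrix_inv (mat_sqrt (C_vv C))"

text \<open>The expression makes sense only if \<open>shifted C B\<close> is symmetric positive definite (square
  root and logarithm); elsewhere the value is \<open>\<infinity>\<close>. The log-determinant carries a minus sign:
  with a plus sign the objective is unbounded below as \<open>shifted C B\<close> degenerates and has no
  minimizer. On \<open>real^'v^'u\<close> the function \<open>norm\<close> is the Frobenius norm.\<close>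

definition reduced_objective ::
  "nat \<Rightarrow> real^('u::finite + 'v::finite)^('u + 'v) \<Rightarrow> real^'u^'u \<Rightarrow> ereal" where
  "reduced_objective r C B =
     (if pos_def (shifted C B)
      then ereal (trace (shifted C B ** C_u_given_v C)
                  - ln (det (shifted C B ** C_u_given_v C))
                  + (norm (svd_trunc r (whitened C B) - whitened C B))\<^sup>2)
      else \<infinity>)"

end

theory Submission
  imports Defs
begin

text \<open>For \<open>M = B + C_uu\<^sup>-\<^sup>1\<close> positive definite the loss is, up to constants, half of
  \<open>Tr (M C_uu) - ln |M| + Tr (A\<^sup>T M\<^sup>-\<^sup>1 A C_vv) - 2 Tr (A\<^sup>T C_uv)\<close>, which after completing the square in
  \<open>A\<close> equals \<open>Tr (M C_u|v) - ln |M| + |X - W|\<^sup>2\<close> with \<open>X = M\<^bsup>-1/2\<^esup> A C_vv\<^bsup>1/2\<^esup>\<close> and \<open>W\<close> the whitened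
  cross covariance. Without constraints \<open>Tr G - ln |G| \<ge> n\<close>, with equality only at \<open>G = 1\<close>, finishes the proof.
  With \<open>rank A \<le> r\<close>, minimising over \<open>X\<close> is the Eckart-Young problem, and its equality case identifies
  the minimisers with the truncations of \<open>W\<close>.

  A matrix \<open>B\<close> of rank at most \<open>r\<close> may be asymmetric with a symmetric part of larger rank, so the reduced
  problem must not gain from dropping the rank constraint on \<open>B\<close>. If \<open>E\<close> is an orthogonal projection
  with \<open>E C_uu\<^bsup>1/2\<^esup> A = C_uu\<^bsup>1/2\<^esup> A\<close>, then \<open>C_uv\<close> may be replaced by \<open>S_E = C_uu\<^bsup>1/2\<^esup> E C_uu\<^bsup>-1/2\<^esup> C_uv\<close> before
  completing the square, which bounds the loss by \<open>n + ln |D_E|\<close> with \<open>D_E = C_uu - S_E C_vv\<^sup>-\<^sup>1 S_E\<^sup>T\<close>. A projection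
  of rank at most \<open>r\<close> minimising \<open>|D_E|\<close> exists by compactness, and \<open>M = D_E\<^sup>-\<^sup>1\<close> attains the bound with
  \<open>rank A \<le> r\<close> and \<open>rank B \<le> r\<close>.\<close>

section \<open>Frobenius inner product and matrix inverses\<close>

text \<open>The pairs (A, M) do not form a compact set, and a rank bound on \<open>B\<close> does
  not bound the rank of its symmetric part, which is all that the loss sees. The lower bound
  therefore has to hold for every positive definite M. It can, because \<open>C_uv\<close> enters
  the objective only through its inner product with A: any S with the same inner product may take
  its place, and the projection onto the range of C_uu^1/2 A yields such an S of rank at most r that
  depends on A alone. For this S the best M is D_E^-1, so M is eliminated exactly, and a continuous
  function on the compact set of projections of trace at most r remains. At its minimiser the rank
  bound on \<open>B\<close> holds automatically: D_E and C_uu differ by a matrix of rank at most r,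
  hence so do their inverses. The bound on \<open>B\<close> thus does not raise the minimum. This
  ties the loss to the reduced objective, which is the minimum over A at fixed M up to
  normalisation.\<close>

lemma inner_matrix: "A \<bullet> B = (\<Sum>i\<in>UNIV. \<Sum>j\<in>UNIV. A $ i $ j * B $ i $ j)"
  for A B :: "real^'n^'m"
  by (simp add: inner_vec_def)

lemma inner_eq_trace: "A \<bullet> B = trace (transpose A ** B)" for A B :: "real^'n^'m"
  unfolding inner_matrix trace_def matrix_matrix_mult_def transpose_def
  by (subst sum.swap) simp

lemma inner_transpose: "transpose A \<bullet> transpose B = A \<bullet> B" for A B :: "real^'n^'m"
  unfolding inner_matrix transpose_def by (subst sum.swap) simp

lemma inner_matrix_mult_left: "(A ** X) \<bullet> Y = X \<bullet> (transpose A ** Y)"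
  for A :: "real^'n^'m" and X :: "real^'p^'n"
  unfolding inner_eq_trace[of "A ** X"] inner_eq_trace[of X] matrix_transpose_mul
  by (simp only: matrix_mul_assoc)

lemma inner_matrix_mult_right: "(X ** A) \<bullet> Y = X \<bullet> (Y ** transpose A)"
  for A :: "real^'n^'m" and X :: "real^'m^'p"
proof -
  have "(X ** A) \<bullet> Y = (transpose A ** transpose X) \<bullet> transpose Y"
    by (subst inner_transpose[symmetric]) (simp only: matrix_transpose_mul)
  also have "\<dots> = transpose X \<bullet> transpose (Y ** transpose A)"
    by (simp only: inner_matrix_mult_left matrix_transpose_mul)
  finally show ?thesis by (simp only: inner_transpose)
qed

lemma inner_matrix_vector: "x \<bullet> (A *v y) = (transpose A *v x) \<bullet> y" for A :: "real^'n^'m"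
  by (metis dot_lmul_matrix transpose_matrix_vector)

lemma matrix_inv:
  fixes A :: "real^'n^'n"
  assumes "invertible A"
  shows "A ** matrix_inv A = mat 1" "matrix_inv A ** A = mat 1"
  using someI_ex[OF assms[unfolded invertible_def]] by (simp_all add: matrix_inv_def)

lemma matrix_inv_unique:
  fixes A B :: "real^'n^'n"
  assumes "A ** B = mat 1"
  shows "matrix_inv A = B"
proof -
  have "invertible A"
    using assms matrix_left_right_inverse unfolding invertible_def by blast
  then show ?thesis
    by (metis assms matrix_inv(2) matrix_mul_assoc matrix_mul_lid matrix_mul_rid)
qed

lemma matrix_add_rdistrib: "(A + B) ** C = A ** C + B ** C"
  for A B :: "real^'n^'m" and C :: "real^'p^'n"
  by (simp add: matrix_matrix_mult_def vec_eq_iff algebra_simps sum.distrib)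

lemma matrix_diff_ldistrib: "A ** (B - C) = A ** B - A ** C"
  for A :: "real^'n^'m" and B C :: "real^'p^'n"
  by (simp add: matrix_matrix_mult_def vec_eq_iff algebra_simps sum_subtractf)

lemma matrix_diff_rdistrib: "(A - B) ** C = A ** C - B ** C"
  for A B :: "real^'n^'m" and C :: "real^'p^'n"
  by (simp add: matrix_matrix_mult_def vec_eq_iff algebra_simps sum_subtractf)

lemma matrix_sum_rdistrib: "(\<Sum>i\<in>I. F i) ** C = (\<Sum>i\<in>I. F i ** C)"
  for F :: "'i \<Rightarrow> real^'n^'m" and C :: "real^'p^'n"
  by (induction I rule: infinite_finite_induct) (simp_all add: matrix_add_rdistrib)

lemma matrix_sum_ldistrib: "C ** (\<Sum>i\<in>I. F i) = (\<Sum>i\<in>I. C ** F i)"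
  for F :: "'i \<Rightarrow> real^'n^'m" and C :: "real^'m^'p"
  by (induction I rule: infinite_finite_induct) (simp_all add: matrix_add_ldistrib)

lemma matrix_vector_sum_rdistrib: "(\<Sum>i\<in>I. F i) *v x = (\<Sum>i\<in>I. F i *v x)"
  for F :: "'i \<Rightarrow> real^'n^'m"
  by (induction I rule: infinite_finite_induct) (simp_all add: matrix_vector_mult_add_rdistrib)

lemma transpose_add: "transpose (A + B) = transpose A + transpose B" for A B :: "real^'n^'m"
  by (simp add: transpose_def vec_eq_iff)

lemma transpose_diff: "transpose (A - B) = transpose A - transpose B" for A B :: "real^'n^'m"
  by (simp add: transpose_def vec_eq_iff)

lemma transpose_sum: "transpose (\<Sum>i\<in>I. F i) = (\<Sum>i\<in>I. transpose (F i))"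
  for F :: "'i \<Rightarrow> real^'n^'m"
  by (induction I rule: infinite_finite_induct)
    (simp_all add: transpose_add, simp_all add: transpose_def vec_eq_iff)

lemma matrix_inv_transpose:
  fixes A :: "real^'n^'n"
  assumes "invertible A"
  shows "matrix_inv (transpose A) = transpose (matrix_inv A)"
  by (rule matrix_inv_unique) (simp flip: matrix_transpose_mul add: matrix_inv assms)

section \<open>Outer products\<close>

lemma outer_mult_vector: "outer x y *v z = (y \<bullet> z) *\<^sub>R x"
  by (simp add: outer_def matrix_vector_mult_def inner_vec_def vec_eq_iff sum_distrib_left
      sum_distrib_right mult_ac)

lemma mult_outer: "A ** outer x y = outer (A *v x) y"
  by (simp add: outer_def matrix_vector_mult_def matrix_matrix_mult_def vec_eq_iff
      sum_distrib_left mult_ac)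

lemma transpose_outer: "transpose (outer x y) = outer y x"
  by (simp add: outer_def transpose_def vec_eq_iff mult_ac)

lemma inner_outer: "A \<bullet> outer x y = x \<bullet> (A *v y)"
  by (simp add: inner_matrix outer_def matrix_vector_mult_def inner_vec_def
      sum_distrib_left mult_ac)

lemma trace_outer: "trace (outer x y) = x \<bullet> y"
  by (simp add: trace_def outer_def inner_vec_def)

lemma outer_scaleR_left: "outer (c *\<^sub>R x) y = c *\<^sub>R outer x y"
  by (simp add: outer_def vec_eq_iff)

lemma outer_zero_left [simp]: "outer 0 y = 0"
  by (simp add: outer_def vec_eq_iff)

lemma inner_outer_outer: "outer x y \<bullet> outer x' y' = (x \<bullet> x') * (y \<bullet> y')"
  by (simp add: inner_outer outer_mult_vector inner_commute)

section \<open>Orthonormal bases and the spectral theorem\<close>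

text \<open>Bases are sets with a prescribed span: eigenbases of complementary invariant subspaces
  can then be united, and a truncation is a sum over a subset.\<close>

definition onb :: "'a::euclidean_space set \<Rightarrow> 'a set \<Rightarrow> bool" where
  "onb V B \<longleftrightarrow> finite B \<and> (\<forall>x\<in>B. \<forall>y\<in>B. x \<bullet> y = (if x = y then 1 else 0)) \<and> span B = V"

lemma onb_finite: "onb V B \<Longrightarrow> finite B"
  and onb_inner: "onb V B \<Longrightarrow> x \<in> B \<Longrightarrow> y \<in> B \<Longrightarrow> x \<bullet> y = (if x = y then 1 else 0)"
  and onb_span: "onb V B \<Longrightarrow> span B = V"
  by (auto simp: onb_def)

lemma onb_subset: "onb V B \<Longrightarrow> B \<subseteq> V"
  by (metis onb_def span_superset)

lemma onb_expand: "onb V B \<Longrightarrow> x \<in> V \<Longrightarrow> (\<Sum>b\<in>B. (x \<bullet> b) *\<^sub>R b) = x"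
  by (rule orthonormal_basis_expand)
    (auto simp: onb_def pairwise_def orthogonal_def norm_eq_1)

lemma onb_nonzero: "onb V B \<Longrightarrow> b \<in> B \<Longrightarrow> b \<noteq> 0"
  by (metis inner_zero_left onb_inner zero_neq_one)

lemma onb_independent: "onb V B \<Longrightarrow> independent B"
proof (rule pairwise_orthogonal_independent)
  assume B: "onb V B"
  then show "pairwise orthogonal B" by (auto simp: onb_def pairwise_def orthogonal_def)
  show "0 \<notin> B" using onb_nonzero[OF B] by blast
qed

lemma onb_card: "onb V B \<Longrightarrow> card B = dim V"
  by (metis dim_span_eq_card_independent onb_independent onb_span)

lemma onb_exists:
  assumes "subspace V"
  obtains B where "onb V B"
proof -
  obtain B where "B \<subseteq> V" "pairwise orthogonal B" "\<And>x. x \<in> B \<Longrightarrow> norm x = 1"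
    "independent B" "card B = dim V" "span B = V"
    using orthonormal_basis_subspace[OF assms] by metis
  then have "onb V B"
    by (auto simp: onb_def pairwise_def orthogonal_def norm_eq_1 independent_imp_finite)
  then show ?thesis by (rule that)
qed

lemma onb_outer_id:
  fixes B :: "(real^'n) set"
  assumes "onb UNIV B"
  shows "(\<Sum>b\<in>B. outer b b) = mat 1"
proof -
  have "(\<Sum>b\<in>B. outer b b) *v x = mat 1 *v x" for x
    using onb_expand[OF assms, of x]
    by (simp add: matrix_vector_sum_rdistrib outer_mult_vector inner_commute)
  then show ?thesis by (simp add: matrix_eq)
qed

lemma onb_outer_expand:
  fixes M :: "real^'n^'m"
  assumes "onb UNIV B"
  shows "M = (\<Sum>b\<in>B. outer (M *v b) b)"
proof -
  have "M = M ** (\<Sum>b\<in>B. outer b b)"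
    by (simp add: onb_outer_id[OF assms])
  then show ?thesis by (simp add: matrix_sum_ldistrib mult_outer)
qed

text \<open>First-order condition: a parabola through the origin that never becomes negative has
  slope zero there. That \<open>c\<close> is nonnegative follows from the arguments 1 and
  -1.\<close>

lemma linear_term_zero:
  fixes a c :: real
  assumes "\<And>t. 0 \<le> 2 * t * a + t\<^sup>2 * c"
  shows "a = 0"
proof -
  have c: "c \<ge> 0" using assms[of 1] assms[of "-1"] by simp
  \<comment> \<open>The minimiser of the parabola, with the denominator raised by 1 so that
    \<open>c = 0\<close> is covered; the value there is - t^2 (c + 2).\<close>
  define t where "t = - a / (c + 1)"
  have ta: "a = - t * (c + 1)" using c by (simp add: t_def)
  have "2 * t * a + t\<^sup>2 * c = - (t\<^sup>2 * (c + 2))"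
    unfolding ta by (simp add: power2_eq_square algebra_simps)
  with assms[of t] have "t\<^sup>2 * (c + 2) \<le> 0" by simp
  then have "t = 0"
    using c by (smt (verit) mult_pos_pos zero_less_power2)
  then show ?thesis using ta by simp
qed

text \<open>A maximiser of the Rayleigh quotient on the compact unit sphere of \<open>V\<close> is
  an eigenvector, with the maximum as its eigenvalue.\<close>

lemma selfadjoint_eigenvector:
  fixes f :: "'a::euclidean_space \<Rightarrow> 'a"
  assumes f: "linear f" and sa: "\<And>x y. f x \<bullet> y = x \<bullet> f y"
    and V: "subspace V" "f ` V \<subseteq> V" "V \<noteq> {0}"
  obtains v l where "v \<in> V" "norm v = 1" "f v = l *\<^sub>R v"
proof -
  obtain z where z: "z \<in> V" "z \<noteq> 0"
    using V subspace_0 by blast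
  let ?S = "sphere 0 1 \<inter> V"
  have "compact ?S"
    by (intro compact_Int_closed compact_sphere closed_subspace V)
  moreover have "z /\<^sub>R norm z \<in> ?S"
    using z V by (simp add: subspace_scale)
  then have "?S \<noteq> {}" by blast
  moreover have "continuous_on ?S (\<lambda>x. x \<bullet> f x)"
    using f by (intro continuous_intros linear_continuous_on linear_conv_bounded_linear[THEN iffD1])
  ultimately obtain v where v: "v \<in> ?S" and max: "\<And>x. x \<in> ?S \<Longrightarrow> x \<bullet> f x \<le> v \<bullet> f v"
    using continuous_attains_sup by metis
  define l where "l = v \<bullet> f v"
  have le: "x \<bullet> f x \<le> l * (x \<bullet> x)" if "x \<in> V" for x
  proof (cases "x = 0")
    case True then show ?thesis using f by (simp add: linear_0)
  next
    case False
    then have "x /\<^sub>R norm x \<in> ?S" using that V by (simp add: subspace_scale)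
    from max[OF this] have "(x \<bullet> f x) / (norm x)\<^sup>2 \<le> l"
      by (simp add: l_def linear_cmul[OF f] power2_eq_square divide_simps)
    then show ?thesis using False
      by (simp add: dot_square_norm divide_simps)
  qed
  have "v \<in> V" "norm v = 1" "v \<bullet> v = 1" using v by (auto simp: norm_eq_1)
  have fV: "f x \<in> V" if "x \<in> V" for x using V that by auto
  let ?w = "l *\<^sub>R v - f v"
  have w: "?w \<in> V"
    by (intro subspace_diff subspace_scale V fV \<open>v \<in> V\<close>)
  \<comment> \<open>The residual is its own test direction: maximality along
    \<open>v + t *\<^sub>R ?w\<close> is a quadratic inequality in t whose linear coefficient is
    twice the squared norm of \<open>?w\<close>.\<close>
  have "?w \<bullet> ?w = 0"
  proof (rule linear_term_zero)
    fix t :: real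
    have "v + t *\<^sub>R ?w \<in> V"
      by (intro subspace_add subspace_scale V w \<open>v \<in> V\<close>)
    from le[OF this]
    have "(v + t *\<^sub>R ?w) \<bullet> (f v + t *\<^sub>R f ?w) \<le> l * ((v + t *\<^sub>R ?w) \<bullet> (v + t *\<^sub>R ?w))"
      by (simp add: linear_add[OF f] linear_cmul[OF f])
    moreover have "v \<bullet> f ?w = f v \<bullet> ?w" by (simp add: sa)
    moreover have "?w \<bullet> ?w = l * (v \<bullet> ?w) - f v \<bullet> ?w" by (simp only: inner_diff_left inner_scaleR_left)
    moreover have "v \<bullet> ?w = 0" using \<open>v \<bullet> v = 1\<close> l_def by (simp add: inner_diff_right)
    ultimately show "0 \<le> 2 * t * (?w \<bullet> ?w) + t\<^sup>2 * (l * (?w \<bullet> ?w) - ?w \<bullet> f ?w)"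
      using \<open>v \<bullet> v = 1\<close> l_def[symmetric] unfolding inner_add_left inner_add_right inner_scaleR_left inner_scaleR_right
      by (simp add: distrib_left right_diff_distrib power2_eq_square inner_commute mult_ac
)
  qed
  then have "f v = l *\<^sub>R v" by simp
  with \<open>v \<in> V\<close> \<open>norm v = 1\<close> show ?thesis by (rule that)
qed

text \<open>Induction on the dimension: the part of \<open>V\<close> orthogonal to one eigenvector
  is again invariant because \<open>f\<close> is self-adjoint. The version for invariant subspaces
  gives separate eigenbases on the range and the kernel of a projection that commutes with
  \<open>f\<close>.\<close>

lemma spectral_theorem:
  fixes f :: "'a::euclidean_space \<Rightarrow> 'a"
  assumes f: "linear f" and sa: "\<And>x y. f x \<bullet> y = x \<bullet> f y"
    and "subspace V" "f ` V \<subseteq> V"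
  shows "\<exists>B. onb V B \<and> (\<forall>b\<in>B. \<exists>l. f b = l *\<^sub>R b)"
  using assms(3,4)
proof (induction "dim V" arbitrary: V rule: less_induct)
  case less
  show ?case
  proof (cases "V = {0}")
    case True
    then have "onb V {}" by (simp add: onb_def)
    then show ?thesis by blast
  next
    case False
    obtain v l where v: "v \<in> V" "norm v = 1" and l: "f v = l *\<^sub>R v"
      using selfadjoint_eigenvector[OF f sa less.prems False] by metis
    have vv: "v \<bullet> v = 1" using v by (simp add: norm_eq_1)
    let ?W = "V \<inter> {y. v \<bullet> y = 0}"
    have W: "subspace ?W"
      by (intro subspace_inter less.prems subspace_hyperplane)
    have "dim ?W < dim V"
    proof -
      have "v \<notin> ?W" using vv by simp
      then have "?W \<subset> V" using v by blast
      then show ?thesis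
        by (intro dim_psubset) (metis W less.prems(1) span_eq_iff)
    qed
    moreover have "f ` ?W \<subseteq> ?W"
      using less.prems(2) sa[of v, symmetric] l by auto
    ultimately obtain B where B: "onb ?W B" and ev: "\<forall>b\<in>B. \<exists>l. f b = l *\<^sub>R b"
      using less.hyps W by blast
    have vB: "v \<bullet> b = 0" if "b \<in> B" for b
      using onb_subset[OF B] that by auto
    have "span (insert v B) = V"
    proof
      show "span (insert v B) \<subseteq> V"
        using v onb_subset[OF B] less.prems(1) by (intro span_minimal) auto
      show "V \<subseteq> span (insert v B)"
      proof
        fix x assume x: "x \<in> V"
        have "x - (v \<bullet> x) *\<^sub>R v \<in> ?W"
          using x v vv less.prems(1) by (auto simp: subspace_diff subspace_scale inner_diff_right)
        then show "x \<in> span (insert v B)"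
          unfolding span_insert using onb_span[OF B] by blast
      qed
    qed
    moreover have "v \<notin> B" using vv vB by fastforce
    ultimately have "onb V (insert v B)"
      using B vv vB unfolding onb_def by (auto simp: inner_commute)
    then show ?thesis using ev l by blast
  qed
qed

lemma symmetric_matrix_inner: "transpose M = M \<Longrightarrow> (M *v x) \<bullet> y = x \<bullet> (M *v y)" for M :: "real^'n^'n"
  by (metis inner_matrix_vector)

lemma symmetric_eigenbasis:
  fixes M :: "real^'n^'n"
  assumes "transpose M = M"
  obtains B l where "onb UNIV B" "\<And>b. b \<in> B \<Longrightarrow> M *v b = l b *\<^sub>R b"
proof -
  have "\<exists>B. onb UNIV B \<and> (\<forall>b\<in>B. \<exists>l. M *v b = l *\<^sub>R b)"
    by (rule spectral_theorem) (simp_all add: symmetric_matrix_inner[OF assms])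
  then obtain B where B: "onb UNIV B" "\<forall>b\<in>B. \<exists>l. M *v b = l *\<^sub>R b" by blast
  then obtain l where "\<forall>b\<in>B. M *v b = l b *\<^sub>R b" by metis
  with B show ?thesis using that by blast
qed

lemma eigenbasis_decomp:
  fixes M :: "real^'n^'n"
  assumes "onb UNIV B" "\<And>b. b \<in> B \<Longrightarrow> M *v b = l b *\<^sub>R b"
  shows "M = (\<Sum>b\<in>B. l b *\<^sub>R outer b b)"
proof -
  have "M = (\<Sum>b\<in>B. outer (M *v b) b)" by (rule onb_outer_expand[OF assms(1)])
  then show ?thesis by (simp add: assms(2) outer_scaleR_left)
qed

lemma eigenbasis_decomp_mult:
  fixes B :: "(real^'n) set"
  assumes B: "onb UNIV B" and "b \<in> B"
  shows "(\<Sum>b\<in>B. l b *\<^sub>R outer b b) *v b = l b *\<^sub>R b"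
proof -
  have "(\<Sum>c\<in>B. l c *\<^sub>R outer c c) *v b = (\<Sum>c\<in>B. if c = b then l b *\<^sub>R b else 0)"
    unfolding matrix_vector_sum_rdistrib
    using assms(2) onb_inner[OF B _ assms(2)]
    by (intro sum.cong) (auto simp: outer_mult_vector simp flip: scaleR_matrix_vector_assoc)
  then show ?thesis using assms(2) onb_finite[OF B] by simp
qed

lemma trace_eigenbasis:
  fixes M :: "real^'n^'n"
  assumes B: "onb UNIV B" and l: "\<And>b. b \<in> B \<Longrightarrow> M *v b = l b *\<^sub>R b"
  shows "trace M = (\<Sum>b\<in>B. l b)"
proof -
  have "trace M = M \<bullet> mat 1"
    by (simp add: inner_eq_trace trace_def transpose_def)
  also have "\<dots> = (\<Sum>b\<in>B. M \<bullet> outer b b)"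
    by (simp add: inner_sum_right flip: onb_outer_id[OF B])
  also have "\<dots> = (\<Sum>b\<in>B. l b)"
    using onb_inner[OF B] l by (intro sum.cong) (auto simp: inner_outer)
  finally show ?thesis .
qed

definition diag_mat :: "('n \<Rightarrow> real) \<Rightarrow> real^'n^'n" where
  "diag_mat d = (\<chi> i j. if i = j then d i else 0)"

lemma det_diag_mat: "det (diag_mat d) = (\<Prod>i\<in>UNIV. d i)"
  by (subst det_diagonal) (simp_all add: diag_mat_def)

text \<open>The basis has as many elements as the index type, so its vectors can be numbered and
  become the columns of an orthogonal matrix. Determinants and substitutions in integrals rely on
  this matrix form.\<close>

lemma eigenbasis_diagonalize:
  fixes M :: "real^'n^'n"
  assumes B: "onb UNIV B" and l: "\<And>b. b \<in> B \<Longrightarrow> M *v b = l b *\<^sub>R b"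
  obtains Q h where "orthogonal_matrix Q" "bij_betw h (UNIV :: 'n set) B"
    "M = Q ** diag_mat (\<lambda>i. l (h i)) ** transpose Q"
proof -
  have "card (UNIV :: 'n set) = card B"
    using onb_card[OF B] by simp
  then obtain h :: "'n \<Rightarrow> real^'n" where h: "bij_betw h UNIV B"
    using onb_finite[OF B] finite_same_card_bij[of "UNIV :: 'n set" B] by auto
  then have hB: "h i \<in> B" for i by (auto simp: bij_betw_def)
  define Q :: "real^'n^'n" where "Q = (\<chi> i j. h j $ i)"
  have Qc: "column j Q = h j" for j by (simp add: Q_def column_def)
  have "inj h" using h by (simp add: bij_betw_def)
  then have Q: "orthogonal_matrix Q"
    using onb_inner[OF B hB hB]
    by (simp add: orthogonal_matrix_orthonormal_columns Qc norm_eq_1 orthogonal_def inj_eq)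
  have "(M ** Q) $ i $ j = (Q ** diag_mat (\<lambda>i. l (h i))) $ i $ j" for i j
  proof -
    have "(M ** Q) $ i $ j = (M *v h j) $ i"
      by (simp add: matrix_matrix_mult_def matrix_vector_mult_def Q_def)
    also have "\<dots> = l (h j) * h j $ i" using l[OF hB] by simp
    also have "\<dots> = (Q ** diag_mat (\<lambda>i. l (h i))) $ i $ j"
      by (simp add: matrix_matrix_mult_def Q_def diag_mat_def if_distrib cong: if_cong)
    finally show ?thesis .
  qed
  then have "M ** Q = Q ** diag_mat (\<lambda>i. l (h i))" by (simp add: vec_eq_iff)
  then have "M ** (Q ** transpose Q) = Q ** diag_mat (\<lambda>i. l (h i)) ** transpose Q"
    by (simp only: matrix_mul_assoc)
  then show ?thesis using Q h that by (simp add: orthogonal_matrix_def)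
qed

lemma det_eigenbasis:
  fixes M :: "real^'n^'n"
  assumes B: "onb UNIV B" and l: "\<And>b. b \<in> B \<Longrightarrow> M *v b = l b *\<^sub>R b"
  shows "det M = (\<Prod>b\<in>B. l b)"
proof -
  obtain Q h where Q: "orthogonal_matrix Q" and h: "bij_betw h (UNIV :: 'n set) B"
    and M: "M = Q ** diag_mat (\<lambda>i. l (h i)) ** transpose Q"
    using eigenbasis_diagonalize[OF B l] by metis
  have "det M = (\<Prod>i\<in>UNIV. l (h i))"
    using det_orthogonal_matrix[OF Q] by (auto simp: M det_mul det_diag_mat)
  also have "\<dots> = (\<Prod>b\<in>B. l b)"
    by (rule prod.reindex_bij_betw[OF h])
  finally show ?thesis .
qed

section \<open>Positive definite matrices\<close>

lemma pos_defD: "pos_def M \<Longrightarrow> x \<noteq> 0 \<Longrightarrow> 0 < x \<bullet> (M *v x)"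
  and pos_def_sym: "pos_def M \<Longrightarrow> transpose M = M"
  by (auto simp: pos_def_def)

lemma pos_def_eigenbasis:
  fixes M :: "real^'n^'n"
  assumes M: "pos_def M"
  obtains B l where "onb UNIV B" "\<And>b. b \<in> B \<Longrightarrow> M *v b = l b *\<^sub>R b" "\<And>b. b \<in> B \<Longrightarrow> l b > 0"
proof -
  obtain B l where B: "onb UNIV B" and l: "\<And>b. b \<in> B \<Longrightarrow> M *v b = l b *\<^sub>R b"
    using symmetric_eigenbasis[OF pos_def_sym[OF M]] by metis
  have "l b > 0" if "b \<in> B" for b
    using pos_defD[OF M onb_nonzero[OF B that]] l[OF that] onb_inner[OF B that that] by simp
  with B l show ?thesis using that by metis
qed

lemma pos_def_det:
  assumes "pos_def M"
  shows "0 < det M"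
proof -
  obtain B l where B: "onb UNIV B" and l: "\<And>b. b \<in> B \<Longrightarrow> M *v b = l b *\<^sub>R b"
    and pos: "\<And>b. b \<in> B \<Longrightarrow> l b > 0"
    using pos_def_eigenbasis[OF assms] by metis
  show ?thesis
    using det_eigenbasis[OF B l] pos by (simp add: prod_pos)
qed

lemma pos_def_invertible: "pos_def M \<Longrightarrow> invertible M"
  by (simp add: invertible_det_nz pos_def_det less_imp_neq[symmetric])

lemma pos_def_inv: 
  assumes M: "pos_def M"
  shows "pos_def (matrix_inv M)"
proof -
  note inv = pos_def_invertible[OF M]
  have "0 < x \<bullet> (matrix_inv M *v x)" if "x \<noteq> 0" for x
  proof -
    let ?y = "matrix_inv M *v x"
    have x: "M *v ?y = x" by (simp add: matrix_vector_mul_assoc matrix_inv inv)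
    then have "?y \<noteq> 0" using that by (metis matrix_vector_mult_0_right)
    from pos_defD[OF M this] show ?thesis by (simp add: x inner_commute)
  qed
  moreover have "transpose (matrix_inv M) = matrix_inv M"
    by (metis inv matrix_inv_transpose M pos_def_sym)
  ultimately show ?thesis by (simp add: pos_def_def)
qed

section \<open>Square roots of positive definite matrices\<close>

lemma mat_sqrt_exists:
  fixes M :: "real^'n^'n"
  assumes M: "pos_def M"
  obtains S where "pos_def S" "S ** S = M"
proof -
  obtain B l where B: "onb UNIV B" and l: "\<And>b. b \<in> B \<Longrightarrow> M *v b = l b *\<^sub>R b"
    and pos: "\<And>b. b \<in> B \<Longrightarrow> l b > 0"
    using pos_def_eigenbasis[OF M] by metis
  define S where "S = (\<Sum>b\<in>B. sqrt (l b) *\<^sub>R outer b b)"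
  have S: "S *v b = sqrt (l b) *\<^sub>R b" if "b \<in> B" for b
    unfolding S_def by (rule eigenbasis_decomp_mult[OF B that])
  have "S ** S = (\<Sum>b\<in>B. outer ((S ** S) *v b) b)" by (rule onb_outer_expand[OF B])
  also have "\<dots> = (\<Sum>b\<in>B. outer (M *v b) b)"
    by (intro sum.cong refl arg_cong2[where f=outer])
      (simp flip: matrix_vector_mul_assoc
        add: S matrix_vector_mult_scaleR l less_imp_le[OF pos])
  also have "\<dots> = M" by (rule onb_outer_expand[OF B, symmetric])
  finally have SS: "S ** S = M" .
  have sym: "transpose S = S"
    by (simp add: S_def transpose_sum transpose_scalar transpose_outer
        flip: scalar_mult_eq_scaleR)
  have "0 < x \<bullet> (S *v x)" if "x \<noteq> 0" for x
  proof -
    have eq: "x \<bullet> (S *v x) = (\<Sum>b\<in>B. sqrt (l b) * (b \<bullet> x)\<^sup>2)"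
      by (simp add: S_def matrix_vector_sum_rdistrib inner_sum_right outer_mult_vector
          inner_commute power2_eq_square mult_ac flip: scaleR_matrix_vector_assoc)
    have "\<exists>b\<in>B. b \<bullet> x \<noteq> 0"
    proof (rule ccontr)
      assume "\<not> ?thesis"
      then have "(\<Sum>b\<in>B. (x \<bullet> b) *\<^sub>R b) = 0" by (simp add: inner_commute)
      then show False using onb_expand[OF B, of x] that by simp
    qed
    then obtain b where b: "b \<in> B" "b \<bullet> x \<noteq> 0" by blast
    show ?thesis unfolding eq
      using b pos by (intro sum_pos2[OF onb_finite[OF B] b(1)]) (auto simp: less_imp_le)
  qed
  with sym have "pos_def S" by (simp add: pos_def_def)
  then show ?thesis using SS that by blast
qed

text \<open>Compare on an eigenbasis of \<open>S\<close>. If S b = l b, then (T + l) (T - l) b = 0,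
  so (T - l) b is an eigenvector of \<open>T\<close> for -l or zero; for l > 0 semidefiniteness
  leaves only zero. For l = 0 the squared norm of T b is b . T^2 b = 0.\<close>

lemma pos_semidef_sqrt_unique:
  fixes S T :: "real^'n^'n"
  assumes S: "pos_semidef S" and T: "pos_semidef T" and eq: "S ** S = T ** T"
  shows "S = T"
proof -
  obtain B l where B: "onb UNIV B" and l: "\<And>b. b \<in> B \<Longrightarrow> S *v b = l b *\<^sub>R b"
    using symmetric_eigenbasis S unfolding pos_semidef_def by metis
  have "T *v b = S *v b" if b: "b \<in> B" for b
  proof -
    have bb: "b \<bullet> b = 1" using onb_inner[OF B b b] by simp
    have "0 \<le> b \<bullet> (S *v b)" using S by (simp add: pos_semidef_def)
    then have l0: "l b \<ge> 0" using l[OF b] bb by simp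
    have TT: "T *v (T *v b) = (l b * l b) *\<^sub>R b"
      by (metis b eq l matrix_vector_mul_assoc matrix_vector_mult_scaleR scaleR_scaleR)
    let ?w = "T *v b - l b *\<^sub>R b"
    have tw: "T *v ?w = - l b *\<^sub>R ?w"
      by (simp add: matrix_vector_mult_diff_distrib TT matrix_vector_mult_scaleR algebra_simps)
    show ?thesis
    proof (cases "l b = 0")
      case True
      have "(T *v b) \<bullet> (T *v b) = b \<bullet> (T *v (T *v b))"
        using T symmetric_matrix_inner unfolding pos_semidef_def by metis
      then show ?thesis using True TT l[OF b] by simp
    next
      case False
      have "0 \<le> ?w \<bullet> (T *v ?w)" using T by (simp add: pos_semidef_def)
      then have "l b * (?w \<bullet> ?w) \<le> 0" unfolding tw by simp
      then have "?w \<bullet> ?w \<le> 0" using False l0 by (simp add: mult_le_0_iff)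
      then have "?w = 0" by (metis inner_ge_zero inner_eq_zero_iff order_antisym)
      then show ?thesis using l[OF b] by simp
    qed
  qed
  then have "(\<Sum>b\<in>B. outer (S *v b) b) = (\<Sum>b\<in>B. outer (T *v b) b)" by simp
  then show ?thesis by (simp only: onb_outer_expand[OF B, symmetric])
qed

lemma pos_def_imp_semidef: "pos_def M \<Longrightarrow> pos_semidef M"
  unfolding pos_def_def pos_semidef_def
  by (metis inner_zero_left less_eq_real_def)

lemma mat_sqrt:
  fixes M :: "real^'n^'n"
  assumes M: "pos_def M"
  shows pos_def_mat_sqrt: "pos_def (mat_sqrt M)" and mat_sqrt_square: "mat_sqrt M ** mat_sqrt M = M"
proof -
  obtain S where S: "pos_def S" "S ** S = M" using mat_sqrt_exists[OF M] by metis
  have "mat_sqrt M = S"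
    unfolding mat_sqrt_def
    by (rule the_equality) (auto simp: S pos_def_imp_semidef intro: pos_semidef_sqrt_unique)
  with S show "pos_def (mat_sqrt M)" "mat_sqrt M ** mat_sqrt M = M" by auto
qed

text \<open>Sum ln t \<le> t - 1 over the eigenvalues; equality forces every eigenvalue to be
  1.\<close>

lemma trace_minus_ln_det:
  fixes G :: "real^'n^'n"
  assumes G: "pos_def G"
  shows "real CARD('n) \<le> trace G - ln (det G)"
    and "trace G - ln (det G) = real CARD('n) \<Longrightarrow> G = mat 1"
proof -
  obtain B l where B: "onb UNIV B" and l: "\<And>b. b \<in> B \<Longrightarrow> G *v b = l b *\<^sub>R b"
    and pos: "\<And>b. b \<in> B \<Longrightarrow> l b > 0"
    using pos_def_eigenbasis[OF G] by metis
  have fin: "finite B" by (rule onb_finite[OF B])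
  have eq: "trace G - ln (det G) - real CARD('n) = (\<Sum>b\<in>B. l b - 1 - ln (l b))"
    using onb_card[OF B] pos fin
    by (simp add: trace_eigenbasis[OF B l] det_eigenbasis[OF B l] sum_subtractf ln_prod order_less_imp_not_eq2)
  have nn: "0 \<le> l b - 1 - ln (l b)" if "b \<in> B" for b
    using ln_le_minus_one[OF pos[OF that]] by simp
  show "real CARD('n) \<le> trace G - ln (det G)"
    using eq sum_nonneg[of B "\<lambda>b. l b - 1 - ln (l b)"] nn by simp
  assume "trace G - ln (det G) = real CARD('n)"
  then have "\<forall>b\<in>B. l b - 1 - ln (l b) = 0"
    using eq sum_nonneg_eq_0_iff[OF fin nn] by simp
  then have "l b = 1" if "b \<in> B" for b
    using that pos ln_eq_minus_one[of "l b"] by auto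
  then show "G = mat 1"
    using eigenbasis_decomp[OF B l] onb_outer_id[OF B] by simp
qed

lemma pos_def_congruence:
  fixes R D :: "real^'n^'n"
  assumes D: "pos_def D" and R: "pos_def R"
  shows "pos_def (R ** D ** R)"
proof -
  have "0 < x \<bullet> ((R ** D ** R) *v x)" if "x \<noteq> 0" for x
  proof -
    have "R *v x \<noteq> 0"
      using pos_defD[OF R that] by auto
    from pos_defD[OF D this] show ?thesis
      by (simp add: matrix_vector_mul_assoc[symmetric] inner_matrix_vector pos_def_sym[OF R])
  qed
  then show ?thesis
    by (simp add: pos_def_def matrix_transpose_mul pos_def_sym[OF D] pos_def_sym[OF R] matrix_mul_assoc)
qed

text \<open>Nonnegativity of the log-det divergence between M and D^-1. The congruence of
  \<open>D\<close> by the square root of \<open>M\<close> is symmetric with the trace and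
  determinant of M D, so the eigenvalue inequality applies to it.\<close>

lemma inner_minus_ln_det:
  fixes M D :: "real^'n^'n"
  assumes M: "pos_def M" and D: "pos_def D"
  shows "real CARD('n) + ln (det D) \<le> M \<bullet> D - ln (det M)"
    and "M \<bullet> D - ln (det M) = real CARD('n) + ln (det D) \<Longrightarrow> M ** D = mat 1"
proof -
  let ?R = "mat_sqrt M" 
  let ?G = "?R ** D ** ?R"
  have G: "pos_def ?G" by (rule pos_def_congruence[OF D pos_def_mat_sqrt[OF M]])
  have tr: "trace ?G = M \<bullet> D"
    by (simp add: inner_eq_trace pos_def_sym[OF M] trace_mul_sym[of "?R ** D"] matrix_mul_assoc
        mat_sqrt_square[OF M])
  have "det ?G = det M * det D"
    unfolding det_mul by (subst (3) mat_sqrt_square[OF M, symmetric]) (simp add: det_mul)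
  then have ln: "ln (det ?G) = ln (det M) + ln (det D)"
    using pos_def_det[OF M] pos_def_det[OF D] by (simp add: ln_mult)
  show "real CARD('n) + ln (det D) \<le> M \<bullet> D - ln (det M)"
    using trace_minus_ln_det(1)[OF G] tr ln by simp
  assume "M \<bullet> D - ln (det M) = real CARD('n) + ln (det D)"
  then have "?R ** (D ** ?R) = mat 1"
    using trace_minus_ln_det(2)[OF G] tr ln by (simp add: matrix_mul_assoc)
  then have "D ** ?R ** ?R = mat 1"
    by (simp add: matrix_left_right_inverse)
  then have "D ** M = mat 1"
    by (metis M mat_sqrt_square matrix_mul_assoc)
  then show "M ** D = mat 1" by (simp add: matrix_left_right_inverse)
qed

section \<open>Orthogonal projections\<close>

definition orth_proj :: "real^'n^'n \<Rightarrow> bool" where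
  "orth_proj E \<longleftrightarrow> transpose E = E \<and> E ** E = E"

lemma onb_outer_proj:
  fixes B :: "(real^'n) set"
  assumes B: "onb V B"
  shows "orth_proj (\<Sum>b\<in>B. outer b b)" "trace (\<Sum>b\<in>B. outer b b) = real (dim V)"
    "\<And>x. x \<in> V \<Longrightarrow> (\<Sum>b\<in>B. outer b b) *v x = x" "\<And>x. (\<Sum>b\<in>B. outer b b) *v x \<in> V"
proof -
  let ?E = "\<Sum>b\<in>B. outer b b"
  have sym: "transpose ?E = ?E" by (simp add: transpose_sum transpose_outer)
  have mult: "?E *v x = (\<Sum>b\<in>B. (x \<bullet> b) *\<^sub>R b)" for x
    by (simp add: matrix_vector_sum_rdistrib outer_mult_vector inner_commute)
  show id: "?E *v x = x" if "x \<in> V" for x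
    using onb_expand[OF B that] by (simp add: mult)
  show inV: "?E *v x \<in> V" for x
    unfolding mult onb_span[OF B, symmetric] by (intro span_sum span_scale span_base)
  have "(?E ** ?E) *v x = ?E *v x" for x
    by (simp add: id inV flip: matrix_vector_mul_assoc)
  then have "?E ** ?E = ?E" by (simp add: matrix_eq)
  with sym show "orth_proj ?E" by (simp add: orth_proj_def)
  have "trace ?E = (\<Sum>b\<in>B. b \<bullet> b)"
    by (induction B rule: infinite_finite_induct)
      (simp_all add: trace_add trace_outer, simp_all add: trace_def)
  also have "\<dots> = real (card B)" using onb_inner[OF B] by simp
  finally show "trace ?E = real (dim V)" by (simp add: onb_card[OF B])
qed

lemma orth_proj_exists:
  fixes V :: "(real^'n) set"
  assumes "subspace V"
  obtains E where "orth_proj E" "trace E = real (dim V)"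
    "\<And>x. x \<in> V \<Longrightarrow> E *v x = x" "\<And>x. E *v x \<in> V"
proof -
  obtain B where "onb V B" using onb_exists[OF assms] .
  from onb_outer_proj[OF this] show ?thesis by (rule that)
qed

lemma subspace_range_matrix: "subspace (range ((*v) A))" for A :: "real^'n^'m"
  by (rule linear_subspace_image) auto

text \<open>A projection is the sum of \<open>outer b b\<close> over an orthonormal basis of its
  range, so its trace counts that basis. A rank bound thereby becomes a linear inequality, which is
  closed under limits.\<close>

lemma orth_proj_rank:
  fixes E :: "real^'n^'n"
  assumes E: "orth_proj E"
  shows "real (rank E) = trace E"
proof -
  obtain B where B: "onb (range ((*v) E)) B" using onb_exists subspace_range_matrix by blast
  have EE: "E *v (E *v x) = E *v x" for x
    using E by (simp add: orth_proj_def matrix_vector_mul_assoc)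
  have EB: "E *v b = b" if "b \<in> B" for b
    using onb_subset[OF B] that EE by auto
  have "(\<Sum>b\<in>B. outer b b) *v x = E *v x" for x
  proof -
    have "(\<Sum>b\<in>B. outer b b) *v x = (\<Sum>b\<in>B. ((E *v b) \<bullet> x) *\<^sub>R b)"
      by (simp add: matrix_vector_sum_rdistrib outer_mult_vector EB)
    also have "\<dots> = (\<Sum>b\<in>B. ((E *v x) \<bullet> b) *\<^sub>R b)"
      using E symmetric_matrix_inner[of E] by (simp add: orth_proj_def inner_commute)
    also have "\<dots> = E *v x" by (rule onb_expand[OF B]) simp
    finally show ?thesis .
  qed
  then have "(\<Sum>b\<in>B. outer b b) = E" by (simp add: matrix_eq)
  then show ?thesis using onb_outer_proj(2)[OF B] by (simp add: rank_dim_range)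
qed

lemma orth_proj_range_exists:
  fixes A :: "real^'n^'m"
  obtains E where "orth_proj E" "E ** A = A" "rank E = rank A" "\<And>x. E *v x \<in> range ((*v) A)"
proof -
  obtain E where E: "orth_proj E" "trace E = real (dim (range ((*v) A)))"
    "\<And>x. x \<in> range ((*v) A) \<Longrightarrow> E *v x = x" "\<And>x. E *v x \<in> range ((*v) A)"
    using orth_proj_exists[OF subspace_range_matrix] by metis
  have "(E ** A) *v x = A *v x" for x
    using E(3) by (simp flip: matrix_vector_mul_assoc)
  then have "E ** A = A" by (simp add: matrix_eq)
  moreover have "rank E = rank A"
    using orth_proj_rank[OF E(1)] E(2) by (simp add: rank_dim_range)
  ultimately show ?thesis using E that by blast
qed

text \<open>Pythagoras: \<open>X - E ** M\<close> has its columns in the range of \<open>E\<close>,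
  \<open>E ** M - M\<close> in the orthogonal complement. Hence \<open>E ** M\<close> is the best
  approximation of \<open>M\<close> with columns in that range, and \<open>X = 0\<close> splits the
  norm of \<open>M\<close> itself.\<close>

lemma norm_proj_split:
  fixes M X :: "real^'n^'m"
  assumes E: "orth_proj E" and X: "E ** X = X"
  shows "(norm (X - M))\<^sup>2 = (norm (X - E ** M))\<^sup>2 + (norm (E ** M - M))\<^sup>2"
proof -
  have "(X - E ** M) \<bullet> (E ** M - M) = (E ** (X - E ** M)) \<bullet> (E ** M - M)"
    using E X by (simp add: orth_proj_def matrix_diff_ldistrib matrix_mul_assoc)
  also have "\<dots> = (X - E ** M) \<bullet> (E ** (E ** M - M))"
    using E by (simp add: orth_proj_def inner_matrix_mult_left)
  also have "E ** (E ** M - M) = 0"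
    using E by (simp add: orth_proj_def matrix_diff_ldistrib matrix_mul_assoc)
  finally have orth: "(X - E ** M) \<bullet> (E ** M - M) = 0" by simp
  have "X - M = (X - E ** M) + (E ** M - M)" by simp
  then show ?thesis
    using orth by (metis norm_add_Pythagorean orthogonal_def)
qed

section \<open>Singular value decompositions and best low-rank approximation\<close>

lemma rank_sum_outer:
  fixes a :: "'i \<Rightarrow> real^'m" and b :: "'i \<Rightarrow> real^'n"
  assumes "finite I"
  shows "rank (\<Sum>i\<in>I. outer (a i) (b i)) \<le> card I"
proof -
  have "range ((*v) (\<Sum>i\<in>I. outer (a i) (b i))) \<subseteq> span (a ` I)"
    by (auto simp: matrix_vector_sum_rdistrib outer_mult_vector intro!: span_sum span_scale intro: span_base)
  then have "rank (\<Sum>i\<in>I. outer (a i) (b i)) \<le> dim (span (a ` I))"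
    unfolding rank_dim_range by (rule dim_subset)
  also have "\<dots> \<le> card (a ` I)" using assms by (simp add: dim_le_card')
  also have "\<dots> \<le> card I" by (rule card_image_le[OF assms])
  finally show ?thesis .
qed

lemma norm_sum_outer:
  fixes a :: "'i \<Rightarrow> real^'m" and b :: "'i \<Rightarrow> real^'n"
  assumes "finite I" "\<And>i j. i \<in> I \<Longrightarrow> j \<in> I \<Longrightarrow> b i \<bullet> b j = (if i = j then 1 else 0)"
  shows "(norm (\<Sum>i\<in>I. outer (a i) (b i)))\<^sup>2 = (\<Sum>i\<in>I. (norm (a i))\<^sup>2)"
proof -
  have "(norm (\<Sum>i\<in>I. outer (a i) (b i)))\<^sup>2 = (\<Sum>i\<in>I. \<Sum>j\<in>I. outer (a i) (b i) \<bullet> outer (a j) (b j))"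
    unfolding power2_norm_eq_inner inner_sum_left inner_sum_right by (rule sum.swap)
  also have "\<dots> = (\<Sum>i\<in>I. \<Sum>j\<in>I. if i = j then a i \<bullet> a i else 0)"
    by (intro sum.cong) (auto simp: inner_outer_outer assms(2))
  also have "\<dots> = (\<Sum>i\<in>I. (norm (a i))\<^sup>2)" using assms(1) by (simp add: power2_norm_eq_inner)
  finally show ?thesis .
qed

text \<open>With P the projection onto the span of the \<open>x i\<close>, the sum is the inner
  product of \<open>E\<close> and P, which equals the squared norm of P E; a projection cannot
  increase the norm of \<open>E\<close>.\<close>

lemma sum_norm_proj_le_trace:
  fixes x :: "'i \<Rightarrow> real^'m"
  assumes "orth_proj E" "finite I"
    "\<And>i j. i \<in> I \<Longrightarrow> j \<in> I \<Longrightarrow> x i \<bullet> x j = (if i = j then 1 else 0)"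
  shows "(\<Sum>i\<in>I. (norm (E *v x i))\<^sup>2) \<le> trace E"
proof -
  let ?P = "\<Sum>i\<in>I. outer (x i) (x i)"
  have PP: "?P ** ?P = ?P"
  proof -
    have "?P ** ?P = (\<Sum>i\<in>I. \<Sum>j\<in>I. outer (x i) (x i) ** outer (x j) (x j))"
      unfolding matrix_sum_rdistrib matrix_sum_ldistrib by (rule sum.swap)
    also have "\<dots> = (\<Sum>i\<in>I. \<Sum>j\<in>I. if i = j then outer (x i) (x i) else 0)"
      by (intro sum.cong) (auto simp: mult_outer outer_mult_vector outer_scaleR_left assms(3))
    finally show ?thesis using assms(2) by simp
  qed
  have "transpose ?P = ?P" by (simp add: transpose_sum transpose_outer)
  with PP have P: "orth_proj ?P" by (simp add: orth_proj_def)
  have "(\<Sum>i\<in>I. (norm (E *v x i))\<^sup>2) = E \<bullet> ?P"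
  proof -
    have "(norm (E *v x i))\<^sup>2 = E \<bullet> outer (x i) (x i)" for i
    proof -
      have "(norm (E *v x i))\<^sup>2 = x i \<bullet> (E *v (E *v x i))"
        using assms(1) symmetric_matrix_inner[of E] by (simp add: power2_norm_eq_inner orth_proj_def)
      then show ?thesis
        using assms(1) by (simp add: inner_outer matrix_vector_mul_assoc orth_proj_def)
    qed
    then show ?thesis by (simp add: inner_sum_right)
  qed
  also have "\<dots> = (norm (?P ** E))\<^sup>2"
  proof -
    have "(norm (?P ** E))\<^sup>2 = E \<bullet> (?P ** (?P ** E))"
      using \<open>transpose ?P = ?P\<close> inner_matrix_mult_left[of ?P E "?P ** E"] by (simp add: power2_norm_eq_inner)
    also have "?P ** (?P ** E) = ?P ** E" by (simp only: matrix_mul_assoc PP)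
    also have "E \<bullet> (?P ** E) = ?P \<bullet> E"
      using assms(1) inner_matrix_mult_right[of ?P E E] by (simp add: orth_proj_def inner_commute)
    finally show ?thesis by (simp add: inner_commute)
  qed
  also have "\<dots> \<le> (norm E)\<^sup>2"
    using norm_proj_split[OF P, of 0 E] norm_proj_split[OF P, of "?P ** E" E] PP
    by (simp add: matrix_mul_assoc norm_minus_commute)
  also have "\<dots> = trace E"
    using assms(1) by (simp add: power2_norm_eq_inner inner_eq_trace orth_proj_def)
  finally show ?thesis .
qed

text \<open>Fractional knapsack: a total weight of at most r, spread with at most 1 per item, does
  best on the r largest values.\<close>

lemma weighted_sum_le_top:
  fixes t w :: "nat \<Rightarrow> real"
  assumes w: "\<And>i. i < p \<Longrightarrow> 0 \<le> w i \<and> w i \<le> 1" and sum_w: "(\<Sum>i<p. w i) \<le> real r"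
    and t: "\<And>i. i < p \<Longrightarrow> 0 \<le> t i" "\<And>i j. i \<le> j \<Longrightarrow> j < p \<Longrightarrow> t j \<le> t i" and r: "r \<le> p"
  shows "(\<Sum>i<p. t i * w i) \<le> (\<Sum>i<r. t i)"
proof (cases "r = 0")
  case True
  then have "(\<Sum>i<p. w i) = 0" using sum_w w by (intro order_antisym sum_nonneg) auto
  then have "w i = 0" if "i < p" for i
    using w that by (subst (asm) sum_nonneg_eq_0_iff) auto
  then show ?thesis using True by simp
next
  case False
  \<comment> \<open>The r-th largest value, as indices start at 0. Subtracting it leaves nonnegative
    terms below \<open>r\<close> and nonpositive ones from \<open>r\<close> on, so the weights 1 and
    0 are optimal term by term.\<close>
  let ?c = "t (r - 1)"
  have c: "0 \<le> ?c" using t(1) r False by simp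
  have "(\<Sum>i<p. (t i - ?c) * w i) \<le> (\<Sum>i<p. if i < r then t i - ?c else 0)"
  proof (rule sum_mono)
    fix i assume "i \<in> {..<p}"
    then have i: "i < p" by simp
    show "(t i - ?c) * w i \<le> (if i < r then t i - ?c else 0)"
    proof (cases "i < r")
      case True
      then have "?c \<le> t i" using t(2)[of i "r - 1"] r by simp
      then show ?thesis using True w[OF i] by (simp add: mult_left_le)
    next
      case False
      then have "t i \<le> ?c" using t(2)[of "r - 1" i] i by simp
      then show ?thesis using False w[OF i] by (simp add: mult_nonpos_nonneg)
    qed
  qed
  also have "\<dots> = (\<Sum>i<r. t i - ?c)"
    using r by (simp add: sum.If_cases Int_absorb1 lessThan_def Collect_conj_eq[symmetric] cong: conj_cong)
      (intro sum.cong, auto)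
  finally have "(\<Sum>i<p. t i * w i) - ?c * (\<Sum>i<p. w i) \<le> (\<Sum>i<r. t i) - real r * ?c"
    by (simp add: left_diff_distrib sum_subtractf sum_distrib_left)
  moreover have "?c * (\<Sum>i<p. w i) \<le> ?c * real r" by (rule mult_left_mono[OF sum_w c])
  ultimately show ?thesis by (simp add: mult.commute)
qed

lemma is_svdD:
  fixes M :: "real^'n^'m"
  assumes "is_svd s x y M"
  defines "p \<equiv> min CARD('m) CARD('n)"
  shows "\<And>i j. i < p \<Longrightarrow> j < p \<Longrightarrow> x i \<bullet> x j = (if i = j then 1 else 0)"
    "\<And>i j. i < p \<Longrightarrow> j < p \<Longrightarrow> y i \<bullet> y j = (if i = j then 1 else 0)"
    "\<And>i. i < p \<Longrightarrow> 0 \<le> s i" "\<And>i j. i \<le> j \<Longrightarrow> j < p \<Longrightarrow> s j \<le> s i"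
    "M = (\<Sum>i<p. outer (s i *\<^sub>R x i) (y i))"
  using assms unfolding is_svd_def Let_def orthonormal_upto_def outer_scaleR_left p_def by auto

text \<open>The lower bound of Eckart and Young. Only the column space of \<open>X\<close> matters:
  with E its projection, \<open>E ** M\<close> is at least as close to \<open>M\<close>. The
  retained squared norm of \<open>E ** M\<close> weighs each squared singular value by the squared
  norm of \<open>E *v x i\<close>; these weights lie in [0,1] and sum to at most r.\<close>

lemma svd_approx_lower:
  fixes M X :: "real^'n^'m"
  assumes svd: "is_svd s x y M" and r: "r \<le> min CARD('m) CARD('n)" and X: "rank X \<le> r"
  shows "(\<Sum>i\<in>{r..<min CARD('m) CARD('n)}. (s i)\<^sup>2) \<le> (norm (X - M))\<^sup>2"
proof -
  define p where "p = min CARD('m) CARD('n)"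
  note D = is_svdD[OF svd, folded p_def]
  have nx: "norm (x i) = 1" if "i < p" for i using D(1)[OF that that] by (simp add: norm_eq_1)
  obtain E where E: "orth_proj E" "E ** X = X" "rank E = rank X"
    using orth_proj_range_exists by metis
  have le1: "(norm (E *v v))\<^sup>2 \<le> v \<bullet> v" for v :: "real^'m"
  proof -
    have "(norm (E *v v))\<^sup>2 = v \<bullet> (E *v v)"
      using E(1) symmetric_matrix_inner[of E v "E *v v"]
      by (simp add: power2_norm_eq_inner orth_proj_def matrix_vector_mul_assoc)
    also have "\<dots> \<le> norm v * norm (E *v v)" by (rule norm_cauchy_schwarz)
    finally have "norm (E *v v) \<le> norm v"
      by (cases "norm (E *v v) = 0") (auto simp: power2_eq_square)
    then show ?thesis by (simp add: dot_square_norm power_mono)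
  qed
  have "(norm (E ** M))\<^sup>2 = (\<Sum>i<p. (norm (s i *\<^sub>R (E *v x i)))\<^sup>2)"
    unfolding D(5) matrix_sum_ldistrib mult_outer matrix_vector_mult_scaleR
    by (rule norm_sum_outer) (use D in auto)
  also have "\<dots> = (\<Sum>i<p. (s i)\<^sup>2 * (norm (E *v x i))\<^sup>2)" by (simp add: power_mult_distrib)
  also have "\<dots> \<le> (\<Sum>i<r. (s i)\<^sup>2)"
  proof (rule weighted_sum_le_top)
    have "(\<Sum>i<p. (norm (E *v x i))\<^sup>2) \<le> trace E"
      by (rule sum_norm_proj_le_trace[OF E(1)]) (use D in auto)
    also have "\<dots> \<le> real r" using X E(3) orth_proj_rank[OF E(1)] by simp
    finally show "(\<Sum>i<p. (norm (E *v x i))\<^sup>2) \<le> real r" .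
    show "0 \<le> (norm (E *v x i))\<^sup>2 \<and> (norm (E *v x i))\<^sup>2 \<le> 1" if "i < p" for i
      using le1[of "x i"] D(1)[OF that that] by simp
    show "(s j)\<^sup>2 \<le> (s i)\<^sup>2" if "i \<le> j" "j < p" for i j
      using D(3,4) that by (intro power_mono) auto
  qed (use r p_def in auto)
  finally have EM: "(norm (E ** M))\<^sup>2 \<le> (\<Sum>i<r. (s i)\<^sup>2)" .
  have "(norm M)\<^sup>2 = (\<Sum>i<p. (norm (s i *\<^sub>R x i))\<^sup>2)"
    unfolding D(5) by (rule norm_sum_outer) (use D in auto)
  also have "\<dots> = (\<Sum>i<p. (s i)\<^sup>2)"
    by (intro sum.cong) (auto simp: nx power_mult_distrib)
  also have "\<dots> = (\<Sum>i<r. (s i)\<^sup>2) + (\<Sum>i\<in>{r..<p}. (s i)\<^sup>2)"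
    using r by (simp add: p_def lessThan_atLeast0 sum.atLeastLessThan_concat)
  finally have "(norm M)\<^sup>2 = (\<Sum>i<r. (s i)\<^sup>2) + (\<Sum>i\<in>{r..<p}. (s i)\<^sup>2)" .
  moreover have "(norm M)\<^sup>2 = (norm (E ** M))\<^sup>2 + (norm (E ** M - M))\<^sup>2"
    using norm_proj_split[OF E(1), of 0 M] by simp
  moreover have "(norm (E ** M - M))\<^sup>2 \<le> (norm (X - M))\<^sup>2"
    using norm_proj_split[OF E(1,2), of M] by simp
  ultimately show ?thesis using EM unfolding p_def by linarith
qed

lemma norm_minus_sum: "M = a + b \<Longrightarrow> norm (a - M) = norm b" for M a b :: "'a::real_normed_vector"
  by simp

lemma svd_trunc_dist:
  fixes M :: "real^'n^'m"
  assumes svd: "is_svd s x y M" and r: "r \<le> min CARD('m) CARD('n)"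
  shows "(norm ((\<Sum>i<r. s i *\<^sub>R outer (x i) (y i)) - M))\<^sup>2 = (\<Sum>i\<in>{r..<min CARD('m) CARD('n)}. (s i)\<^sup>2)"
proof -
  define p where "p = min CARD('m) CARD('n)"
  note D = is_svdD[OF svd, folded p_def]
  have nx: "norm (x i) = 1" if "i < p" for i using D(1)[OF that that] by (simp add: norm_eq_1)
  have "M = (\<Sum>i<r. outer (s i *\<^sub>R x i) (y i)) + (\<Sum>i\<in>{r..<p}. outer (s i *\<^sub>R x i) (y i))"
    using r by (subst D(5)) (simp add: p_def lessThan_atLeast0 sum.atLeastLessThan_concat)
  then have "norm ((\<Sum>i<r. outer (s i *\<^sub>R x i) (y i)) - M) = norm (\<Sum>i\<in>{r..<p}. outer (s i *\<^sub>R x i) (y i))"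
    by (rule norm_minus_sum)
  then have "(norm ((\<Sum>i<r. outer (s i *\<^sub>R x i) (y i)) - M))\<^sup>2 = (\<Sum>i\<in>{r..<p}. (norm (s i *\<^sub>R x i))\<^sup>2)"
    by (simp only:) (rule norm_sum_outer, use D in auto)
  also have "\<dots> = (\<Sum>i\<in>{r..<p}. (s i)\<^sup>2)"
    by (intro sum.cong) (auto simp: nx power_mult_distrib)
  finally show ?thesis by (simp add: p_def outer_scaleR_left)
qed

text \<open>Lower bound and attained distance are the same tail sum of squared singular values, so
  every truncation is optimal, whichever decomposition it comes from.\<close>

lemma is_svd_trunc_optimal:
  fixes M N :: "real^'n^'m"
  assumes N: "is_svd_trunc r M N" and r: "r \<le> min CARD('m) CARD('n)"
  shows "rank N \<le> r" and "\<And>X. rank X \<le> r \<Longrightarrow> norm (N - M) \<le> norm (X - M)"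
proof -
  obtain s x y where svd: "is_svd s x y M" and Neq: "N = (\<Sum>i<r. s i *\<^sub>R outer (x i) (y i))"
    using N r unfolding is_svd_trunc_def by (auto simp: min_absorb1)
  show "rank N \<le> r"
    using rank_sum_outer[of "{..<r}" "\<lambda>i. s i *\<^sub>R x i" y] by (simp add: Neq outer_scaleR_left)
  show "norm (N - M) \<le> norm (X - M)" if "rank X \<le> r" for X
  proof (rule power2_le_imp_le)
    show "(norm (N - M))\<^sup>2 \<le> (norm (X - M))\<^sup>2"
      unfolding Neq svd_trunc_dist[OF svd r] by (rule svd_approx_lower[OF svd r that])
  qed simp
qed

section \<open>Construction of singular value decompositions\<close>

lemma orthonormal_upto_card:
  fixes x :: "nat \<Rightarrow> 'a::euclidean_space"
  assumes "orthonormal_upto k x"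
  shows "k \<le> DIM('a)" "dim (x ` {..<k}) = k"
proof -
  have o: "x i \<bullet> x j = (if i = j then 1 else 0)" if "i < k" "j < k" for i j
    using assms that by (simp add: orthonormal_upto_def)
  have "inj_on x {..<k}" by (rule inj_onI) (metis lessThan_iff o zero_neq_one)
  then have "card (x ` {..<k}) = k" by (simp add: card_image)
  moreover have "independent (x ` {..<k})"
    using o by (intro pairwise_orthogonal_independent) (force simp: pairwise_def orthogonal_def)+
  ultimately show "dim (x ` {..<k}) = k" by (simp add: dim_eq_card_independent)
  then show "k \<le> DIM('a)" by (metis dim_subset_UNIV)
qed

text \<open>\<open>is_svd\<close> asks for full orthonormal families on both sides, zero singular
  values included, while normalised images under the matrix supply only as many vectors as there are
  nonzero singular values.\<close>

lemma orthonormal_upto_extend: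
  fixes x :: "nat \<Rightarrow> 'a::euclidean_space"
  assumes "orthonormal_upto k x" "k \<le> p" "p \<le> DIM('a)"
  obtains x' where "orthonormal_upto p x'" "\<And>i. i < k \<Longrightarrow> x' i = x i"
proof -
  have "\<exists>x'. orthonormal_upto p x' \<and> (\<forall>i<k. x' i = x i)"
    using assms(2,3)
  proof (induction p rule: dec_induct)
    case base
    then show ?case using assms(1) by blast
  next
    case (step n)
    then obtain x' where x': "orthonormal_upto n x'" "\<forall>i<k. x' i = x i" by auto
    have "dim (x' ` {..<n}) < DIM('a)" using orthonormal_upto_card(2)[OF x'(1)] step by simp
    then obtain z where z: "z \<noteq> 0" "\<And>y. y \<in> span (x' ` {..<n}) \<Longrightarrow> orthogonal z y"
      using orthogonal_to_subspace_exists by metis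
    have zx: "z \<bullet> x' i = 0" if "i < n" for i
      using z(2)[of "x' i"] that by (simp add: orthogonal_def span_base)
    have zz: "(z /\<^sub>R norm z) \<bullet> (z /\<^sub>R norm z) = 1"
      unfolding norm_eq_1[symmetric] using z(1) by simp
    let ?x = "x'(n := z /\<^sub>R norm z)"
    have "orthonormal_upto (Suc n) ?x"
      using x'(1) zx zz unfolding orthonormal_upto_def by (auto simp: less_Suc_eq inner_commute)
    moreover have "\<forall>i<k. ?x i = x i" using x'(2) step by auto
    ultimately show ?case by blast
  qed
  then show ?thesis using that by blast
qed

lemma sum_nth_distinct: "distinct l \<Longrightarrow> (\<Sum>i<length l. f (l ! i)) = sum f (set l)"
  by (rule sum.reindex_bij_betw) (simp add: bij_betw_nth)

text \<open>An orthonormal basis with orthogonal images is a system of right singular vectors, and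
  the norms of the images are the singular values. \<open>J\<close> prescribes which vectors survive
  the cut, so that every choice among equal singular values can be realised.\<close>

lemma is_svd_trunc_of_basis:
  fixes M :: "real^'n^'m"
  assumes B: "onb UNIV B" and orth: "\<And>b c. b \<in> B \<Longrightarrow> c \<in> B \<Longrightarrow> b \<noteq> c \<Longrightarrow> (M *v b) \<bullet> (M *v c) = 0"
    and J: "J \<subseteq> B" "card J \<le> r" and r: "r \<le> min CARD('m) CARD('n)"
    and exhaust: "card J = r \<or> (\<forall>b\<in>B - J. M *v b = 0)"
    and top: "\<And>b c. b \<in> J \<Longrightarrow> c \<in> B - J \<Longrightarrow> norm (M *v c) \<le> norm (M *v b)"
  shows "is_svd_trunc r M (\<Sum>b\<in>J. outer (M *v b) b)"
proof -
  define p where "p = min CARD('m) CARD('n)"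
  have finB: "finite B" by (rule onb_finite[OF B])
  \<comment> \<open>Null vectors are left out: they have no normalised image, and the basis may have
    more than \<open>p\<close> elements.\<close>
  define I where "I = {b \<in> B. M *v b \<noteq> 0}"
  have I: "finite I" "I \<subseteq> B" using finB by (auto simp: I_def)
  \<comment> \<open>Negated, so that ascending sorting puts the largest singular values
    first.\<close>
  define key where "key b = - norm (M *v b)" for b
  obtain l1' where l1': "set l1' = J \<inter> I" "distinct l1'"
    using finite_distinct_list I(1) by (metis finite_Int)
  obtain l2' where l2': "set l2' = I - J" "distinct l2'"
    using finite_distinct_list I(1) by (metis finite_Diff)
  \<comment> \<open>The members of \<open>J\<close> are listed before the others, which settles ties
    at the cut in favour of \<open>J\<close>; \<open>top\<close> makes the concatenation
    sorted.\<close>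
  define l1 where "l1 = sort_key key l1'"
  define l2 where "l2 = sort_key key l2'"
  define l where "l = l1 @ l2"
  define k where "k = length l"
  have l1: "set l1 = J \<inter> I" "distinct l1" "length l1 \<le> r"
  proof -
    show "set l1 = J \<inter> I" "distinct l1" using l1' by (auto simp: l1_def)
    then have "length l1 = card (J \<inter> I)" by (metis distinct_card)
    also have "\<dots> \<le> r" using J finB by (metis Int_lower1 card_mono le_trans finite_subset)
    finally show "length l1 \<le> r" .
  qed
  have l2: "set l2 = I - J" "distinct l2" using l2' by (auto simp: l2_def)
  have l: "set l = I" "distinct l" using l1 l2 by (auto simp: l_def)
  have lI: "l ! i \<in> I" "l ! i \<in> B" "M *v (l ! i) \<noteq> 0" if "i < k" for i
    using that l(1) nth_mem[of i l] unfolding k_def I_def by auto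
  have sorted: "sorted (map key l)"
    using top I by (auto simp: l_def sorted_append l1 l2 key_def I_def)
      (auto simp: l1_def l2_def key_def)
  \<comment> \<open>Either the part from \<open>J\<close> fills the first \<open>r\<close> places
    exactly or nothing follows it. A null vector in \<open>J\<close> forces, by \<open>top\<close>,
    every vector outside \<open>J\<close> to be null as well.\<close>
  have tail: "length l1 = r \<or> l2 = []"
  proof (cases "card (J \<inter> I) = r")
    case True then show ?thesis using l1 by (metis distinct_card)
  next
    case False
    have "I - J = {}"
    proof (cases "\<forall>b\<in>B - J. M *v b = 0")
      case True then show ?thesis by (auto simp: I_def)
    next
      case notzero: False
      then have "card J = r" using exhaust by blast
      with False have "J \<inter> I \<noteq> J" by metis
      then obtain b where "b \<in> J" "M *v b = 0" using J by (auto simp: I_def)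
      with top[of b] show ?thesis by (auto simp: I_def)
    qed
    then have "set l2 = {}" using l2 by simp
    then show ?thesis by simp
  qed
  define y0 where "y0 i = l ! i" for i
  define x0 where "x0 i = (M *v (l ! i)) /\<^sub>R norm (M *v (l ! i))" for i
  have oy: "orthonormal_upto k y0"
    using onb_inner[OF B lI(2) lI(2)] l(2) by (auto simp: orthonormal_upto_def y0_def nth_eq_iff_index_eq k_def)
  have ox: "orthonormal_upto k x0"
    unfolding orthonormal_upto_def
  proof (intro allI impI)
    fix i j assume ij: "i < k" "j < k"
    show "x0 i \<bullet> x0 j = (if i = j then 1 else 0)"
    proof (cases "i = j")
      case True
      have "norm (x0 i) = 1" using lI(3)[OF ij(1)] by (simp add: x0_def)
      then show ?thesis using True by (simp add: norm_eq_1)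
    next
      case False
      then have "l ! i \<noteq> l ! j" using ij l(2) by (simp add: nth_eq_iff_index_eq k_def)
      then show ?thesis using orth[OF lI(2) lI(2)] ij False by (simp add: x0_def)
    qed
  qed
  have kp: "k \<le> p"
    using orthonormal_upto_card(1)[OF ox] orthonormal_upto_card(1)[OF oy] by (simp add: p_def)
  obtain x y where x: "orthonormal_upto p x" "\<And>i. i < k \<Longrightarrow> x i = x0 i"
    and y: "orthonormal_upto p y" "\<And>i. i < k \<Longrightarrow> y i = y0 i"
  proof -
    have "p \<le> DIM(real^'m)" "p \<le> DIM(real^'n)" by (simp_all add: p_def)
    then show ?thesis
      using orthonormal_upto_extend[OF ox kp] orthonormal_upto_extend[OF oy kp] that by metis
  qed
  \<comment> \<open>Zero from \<open>k\<close> on, so the vectors added to reach length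
    \<open>p\<close> do not contribute.\<close>
  define s where "s i = (if i < k then norm (M *v (l ! i)) else 0)" for i
  have summand: "s i *\<^sub>R outer (x i) (y i) = outer (M *v (l ! i)) (l ! i)" if "i < k" for i
    using that lI(3)[OF that] by (simp add: s_def x y x0_def y0_def flip: outer_scaleR_left)
  have upto: "(\<Sum>i<q. s i *\<^sub>R outer (x i) (y i)) = (\<Sum>b\<in>I. outer (M *v b) b)" if "k \<le> q" for q
  proof -
    have "(\<Sum>i<q. s i *\<^sub>R outer (x i) (y i)) = (\<Sum>i<k. s i *\<^sub>R outer (x i) (y i))"
      using that by (intro sum.mono_neutral_right) (auto simp: s_def)
    also have "\<dots> = (\<Sum>i<k. outer (M *v (l ! i)) (l ! i))" using summand by simp
    also have "\<dots> = (\<Sum>b\<in>I. outer (M *v b) b)"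
      unfolding k_def using sum_nth_distinct[OF l(2), of "\<lambda>b. outer (M *v b) b"] l(1) by simp
    finally show ?thesis .
  qed
  have "M = (\<Sum>b\<in>B. outer (M *v b) b)" by (rule onb_outer_expand[OF B])
  also have "\<dots> = (\<Sum>b\<in>I. outer (M *v b) b)"
    using finB by (intro sum.mono_neutral_right) (auto simp: I_def)
  finally have M: "M = (\<Sum>i<p. s i *\<^sub>R outer (x i) (y i))" using upto[OF kp] by simp
  have "s j \<le> s i" if "i \<le> j" "j < p" for i j
    using sorted_nth_mono[OF sorted that(1)] that by (auto simp: s_def k_def key_def)
  then have svd: "is_svd s x y M"
    using x(1) y(1) M unfolding is_svd_def Let_def p_def[symmetric] by (auto simp: s_def)
  have "(\<Sum>b\<in>J. outer (M *v b) b) = (\<Sum>b\<in>J \<inter> I. outer (M *v b) b)"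
    using J finB by (intro sum.mono_neutral_right) (auto simp: I_def intro: finite_subset)
  also have "\<dots> = (\<Sum>i<r. s i *\<^sub>R outer (x i) (y i))"
    using tail
  proof
    assume len: "length l1 = r"
    have "(\<Sum>i<r. s i *\<^sub>R outer (x i) (y i)) = (\<Sum>i<length l1. outer (M *v (l1 ! i)) (l1 ! i))"
      using len by (intro sum.cong) (auto simp: summand k_def l_def nth_append)
    then show ?thesis
      using sum_nth_distinct[OF l1(2), of "\<lambda>b. outer (M *v b) b"] l1(1) by simp
  next
    assume "l2 = []"
    then have "k \<le> r" "J \<inter> I = I" using l1 l2 by (auto simp: k_def l_def)
    then show ?thesis using upto by simp
  qed
  finally show ?thesis
    using svd r unfolding is_svd_trunc_def by (auto simp: min_absorb1)
qed

lemma is_svd_trunc_exists: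
  fixes M :: "real^'n^'m"
  shows "\<exists>N. is_svd_trunc r M N"
proof -
  have sym: "transpose (transpose M ** M) = transpose M ** M"
    by (simp add: matrix_transpose_mul)
  obtain B l where B: "onb UNIV B" and l: "\<And>b. b \<in> B \<Longrightarrow> (transpose M ** M) *v b = l b *\<^sub>R b"
    using symmetric_eigenbasis[OF sym] by metis
  have "(M *v b) \<bullet> (M *v c) = 0" if "b \<in> B" "c \<in> B" "b \<noteq> c" for b c
  proof -
    have "(M *v b) \<bullet> (M *v c) = ((transpose M ** M) *v b) \<bullet> c"
      by (simp add: inner_matrix_vector[of "M *v b"] matrix_vector_mul_assoc)
    then show ?thesis using l[OF that(1)] onb_inner[OF B that(1,2)] that(3) by simp
  qed
  \<comment> \<open>At rank 0 with empty \<open>J\<close> the side conditions are trivial. The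
    decomposition inside \<open>is_svd_trunc\<close> does not depend on the rank and serves every
    \<open>r\<close>.\<close>
  then have "is_svd_trunc 0 M (\<Sum>b\<in>{}. outer (M *v b) b)"
    by (intro is_svd_trunc_of_basis[OF B]) auto
  then show ?thesis unfolding is_svd_trunc_def by blast
qed

text \<open>Optimality forces \<open>X = E M = M F\<close> for the projections \<open>E\<close>, \<open>F\<close> onto the column and row space of \<open>X\<close>,
  so \<open>F\<close> commutes with \<open>M\<^sup>T M\<close> and the right singular vectors of \<open>M\<close> can be chosen within the row
  space and its complement. An exchange argument then shows that the former carry the largest values.\<close>

lemma best_approx_is_svd_trunc:
  fixes M X :: "real^'n^'m"
  assumes r: "r \<le> min CARD('m) CARD('n)" and X: "rank X \<le> r"
    and best: "\<And>Y. rank Y \<le> r \<Longrightarrow> norm (X - M) \<le> norm (Y - M)"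
  shows "is_svd_trunc r M X"
proof -
  obtain E where E: "orth_proj E" "E ** X = X" "rank E = rank X"
    using orth_proj_range_exists by metis
  have "norm (X - M) \<le> norm (E ** M - M)"
    using best[of "E ** M"] rank_mul_le_left[of E M] E X by simp
  then have "(norm (X - M))\<^sup>2 \<le> (norm (E ** M - M))\<^sup>2" by (simp add: power_mono)
  then have "(norm (X - E ** M))\<^sup>2 \<le> 0"
    using norm_proj_split[OF E(1,2), of M] by simp
  then have XE: "X = E ** M" by simp
  obtain F where F: "orth_proj F" "F ** transpose X = transpose X" "rank F = rank (transpose X)"
    "\<And>x. F *v x \<in> range ((*v) (transpose X))"
    using orth_proj_range_exists by metis
  have tnorm: "norm (transpose A) = norm A" for A :: "real^'p^'q"
    by (simp add: norm_eq_sqrt_inner inner_transpose)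
  have FM: "transpose (M ** F) = F ** transpose M"
    using F(1) by (simp add: matrix_transpose_mul orth_proj_def)
  have "norm (X - M) \<le> norm (M ** F - M)"
    using best[of "M ** F"] rank_mul_le_right[of M F] F(3) X by (simp add: rank_transpose)
  then have "norm (transpose X - transpose M) \<le> norm (F ** transpose M - transpose M)"
    by (metis FM tnorm transpose_diff)
  then have "(norm (transpose X - transpose M))\<^sup>2 \<le> (norm (F ** transpose M - transpose M))\<^sup>2"
    by (simp add: power_mono)
  then have "(norm (transpose X - F ** transpose M))\<^sup>2 \<le> 0"
    using norm_proj_split[OF F(1,2), of "transpose M"] by simp
  then have XFt: "transpose X = F ** transpose M" by simp
  then have XF: "X = M ** F" by (metis FM transpose_transpose)
  let ?T = "transpose M ** M"
  have comm: "?T ** F = F ** ?T"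
  proof -
    have "?T ** F = transpose M ** X" by (simp add: XF matrix_mul_assoc)
    also have "\<dots> = transpose M ** transpose E ** M" 
      using E(1) by (subst XE) (simp add: orth_proj_def matrix_mul_assoc)
    also have "\<dots> = transpose X ** M" by (simp add: XE matrix_transpose_mul)
    also have "\<dots> = F ** ?T" by (simp add: XFt matrix_mul_assoc)
    finally show ?thesis .
  qed
  then have comm': "F *v (?T *v x) = ?T *v (F *v x)" for x
    by (simp add: matrix_vector_mul_assoc)
  have FF: "F *v (F *v x) = F *v x" for x
    using F(1) by (simp add: matrix_vector_mul_assoc orth_proj_def)
  have sym: "transpose ?T = ?T" by (simp add: matrix_transpose_mul)
  let ?V = "{x. F *v x = x}" and ?W = "{x. F *v x = 0}"
  have "subspace ?V" "subspace ?W"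
    by (auto simp: subspace_def matrix_vector_right_distrib matrix_vector_mult_scaleR)
  moreover have "(*v) ?T ` ?V \<subseteq> ?V" "(*v) ?T ` ?W \<subseteq> ?W"
    by (auto simp: comm')
  ultimately obtain B1 B2 where B1: "onb ?V B1" "\<forall>b\<in>B1. \<exists>l. ?T *v b = l *\<^sub>R b"
    and B2: "onb ?W B2" "\<forall>b\<in>B2. \<exists>l. ?T *v b = l *\<^sub>R b"
    using spectral_theorem[of "(*v) ?T" ?V] spectral_theorem[of "(*v) ?T" ?W]
      symmetric_matrix_inner[OF sym] by auto
  have V1: "F *v b = b" if "b \<in> B1" for b using onb_subset[OF B1(1)] that by auto
  have W2: "F *v b = 0" if "b \<in> B2" for b using onb_subset[OF B2(1)] that by auto
  have orth12: "b \<bullet> c = 0" if "b \<in> B1" "c \<in> B2" for b c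
    using symmetric_matrix_inner[of F b c] F(1) V1[OF that(1)] W2[OF that(2)]
    by (simp add: orth_proj_def)
  then have orth21: "c \<bullet> b = 0" if "b \<in> B1" "c \<in> B2" for b c
    using that by (simp add: inner_commute)
  have disj: "B1 \<inter> B2 = {}"
    using V1 W2 onb_nonzero[OF B1(1)] by fastforce
  let ?B = "B1 \<union> B2"
  have B: "onb UNIV ?B"
  proof -
    have "x \<in> span ?B" for x
    proof -
      have "F *v x \<in> span B1" "x - F *v x \<in> span B2"
        unfolding onb_span[OF B1(1)] onb_span[OF B2(1)]
        by (auto simp: FF matrix_vector_mult_diff_distrib)
      then have "F *v x + (x - F *v x) \<in> span ?B"
        by (intro span_add) (meson Un_upper1 Un_upper2 span_mono subsetD)+
      then show ?thesis by simp
    qed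
    then show ?thesis
      using B1(1) B2(1) orth12 orth21 disj unfolding onb_def by auto
  qed
  have finB: "finite ?B" by (rule onb_finite[OF B])
  have orthM: "(M *v b) \<bullet> (M *v c) = 0" if "b \<in> ?B" "c \<in> ?B" "b \<noteq> c" for b c
  proof -
    have "\<exists>l. ?T *v b = l *\<^sub>R b"
      using that(1) by (rule UnE) (fact B1(2)[rule_format] B2(2)[rule_format])+
    then obtain l where l: "?T *v b = l *\<^sub>R b" ..
    have "(M *v b) \<bullet> (M *v c) = (?T *v b) \<bullet> c"
      by (simp add: inner_matrix_vector[of "M *v b"] matrix_vector_mul_assoc)
    then show ?thesis using l onb_inner[OF B that(1,2)] that(3) by simp
  qed
  have "X = (\<Sum>b\<in>?B. outer (X *v b) b)" by (rule onb_outer_expand[OF B])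
  also have "\<dots> = (\<Sum>b\<in>B1. outer (X *v b) b)"
    using finB W2 by (intro sum.mono_neutral_right) (auto simp: XF simp flip: matrix_vector_mul_assoc)
  also have "\<dots> = (\<Sum>b\<in>B1. outer (M *v b) b)"
    using V1 by (simp add: XF flip: matrix_vector_mul_assoc)
  finally have XB: "X = (\<Sum>b\<in>B1. outer (M *v b) b)" .
  have card1: "card B1 \<le> r"
  proof -
    have "?V \<subseteq> range ((*v) F)" by (metis (mono_tags, lifting) mem_Collect_eq rangeI subsetI)
    then have "dim ?V \<le> rank F" unfolding rank_dim_range by (rule dim_subset)
    then show ?thesis using onb_card[OF B1(1)] F(3) X by (simp add: rank_transpose)
  qed
  have dist: "(norm ((\<Sum>b\<in>K. outer (M *v b) b) - M))\<^sup>2 = (\<Sum>b\<in>?B - K. (norm (M *v b))\<^sup>2)"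
    if "K \<subseteq> ?B" for K
  proof -
    have "M = (\<Sum>b\<in>?B. outer (M *v b) b)" by (rule onb_outer_expand[OF B])
    also have "\<dots> = (\<Sum>b\<in>?B - K. outer (M *v b) b) + (\<Sum>b\<in>K. outer (M *v b) b)"
      by (rule sum.subset_diff[OF that finB])
    finally have "norm ((\<Sum>b\<in>K. outer (M *v b) b) - M) = norm (\<Sum>b\<in>?B - K. outer (M *v b) b)"
      by (intro norm_minus_sum) (simp only: add.commute)
    then show ?thesis
      by (simp only:) (rule norm_sum_outer, use finB onb_inner[OF B] in auto)
  qed
  \<comment> \<open>Every set of at most \<open>r\<close> basis vectors gives a competitor. The two
    remaining conditions compare \<open>B1\<close> with \<open>B1\<close> enlarged by one vector and
    with \<open>B1\<close> after exchanging one vector.\<close>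
  have swap: "(\<Sum>b\<in>?B - B1. (norm (M *v b))\<^sup>2) \<le> (\<Sum>b\<in>?B - K. (norm (M *v b))\<^sup>2)"
    if "K \<subseteq> ?B" "card K \<le> r" for K
  proof -
    have "rank (\<Sum>b\<in>K. outer (M *v b) b) \<le> r"
      using rank_sum_outer[of K "(*v) M" "\<lambda>b. b"] that finB finite_subset by force
    from best[OF this] have "(norm (X - M))\<^sup>2 \<le> (norm ((\<Sum>b\<in>K. outer (M *v b) b) - M))\<^sup>2"
      by (simp add: power_mono)
    then show ?thesis unfolding XB by (simp only: dist that Un_upper1)
  qed
  have fin: "finite B1" "finite B2" using finB by auto
  show ?thesis
    unfolding XB
  proof (rule is_svd_trunc_of_basis[OF B orthM _ card1 r])
    show "card B1 = r \<or> (\<forall>b\<in>?B - B1. M *v b = 0)"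
    proof (intro disjCI ballI)
      fix c assume "\<not> (\<forall>b\<in>?B - B1. M *v b = 0)"
      then obtain c where c: "c \<in> ?B - B1" "M *v c \<noteq> 0" by blast
      show "card B1 = r"
      proof (rule ccontr)
        assume "card B1 \<noteq> r"
        then have "card (insert c B1) \<le> r" using card1 fin c by simp
        with c have "(\<Sum>b\<in>?B - B1. (norm (M *v b))\<^sup>2) \<le> (\<Sum>b\<in>?B - insert c B1. (norm (M *v b))\<^sup>2)"
          by (intro swap) auto
        also have "?B - insert c B1 = (?B - B1) - {c}" by blast
        finally show False using c finB by (auto simp: sum_diff1 split: if_splits)
      qed
    qed
    fix b c assume b: "b \<in> B1" and c: "c \<in> ?B - B1"
    let ?K = "insert c (B1 - {b})"
    have "card B1 > 0" using b fin by (auto simp: card_gt_0_iff)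
    then have "card ?K = card B1" using b c fin by simp
    then have "(\<Sum>b\<in>?B - B1. (norm (M *v b))\<^sup>2) \<le> (\<Sum>b\<in>?B - ?K. (norm (M *v b))\<^sup>2)"
      using b c card1 by (intro swap) auto
    also have "?B - ?K = insert b ((?B - B1) - {c})" using b c disj by auto
    also have "(\<Sum>b\<in>\<dots>. (norm (M *v b))\<^sup>2) = (norm (M *v b))\<^sup>2 + (\<Sum>b\<in>(?B - B1) - {c}. (norm (M *v b))\<^sup>2)"
      using b fin by (subst sum.insert) auto
    finally have "(norm (M *v c))\<^sup>2 \<le> (norm (M *v b))\<^sup>2" using c finB by (auto simp: sum_diff1 split: if_splits)
    then show "norm (M *v c) \<le> norm (M *v b)" by (rule power2_le_imp_le) simp
  qed (assumption | rule Un_upper1)+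
qed

lemma svd_trunc_is_svd_trunc: "is_svd_trunc r M (svd_trunc r M)"
  unfolding svd_trunc_def by (rule someI_ex[OF is_svd_trunc_exists])

section \<open>Linear change of variables for Lebesgue measure\<close>

lemma nn_integral_shift:
  fixes c :: "'a::euclidean_space"
  assumes [measurable]: "f \<in> borel_measurable borel"
  shows "(\<integral>\<^sup>+x. f (c + x) \<partial>lborel) = (\<integral>\<^sup>+x. f x \<partial>lborel)"
  by (subst (2) lborel_distr_plus[of c, symmetric], subst nn_integral_distr) simp_all

text \<open>The change of variables theorem of the library needs a well-ordered index type. Here
  rotation invariance comes from the uniqueness of Haar measure instead.\<close>

lemma translation_invariant_eq_lborel:
  fixes N :: "'a::euclidean_space measure"
  assumes sets_N[measurable_cong]: "sets N = sets borel" and "sigma_finite_measure N"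
    and trans: "\<And>c. distr N borel ((+) c) = N"
    and ball: "emeasure N (ball 0 1) = emeasure lborel (ball (0::'a) 1)"
  shows "N = lborel"
proof (rule measure_eqI)
  fix B assume "B \<in> sets N"
  then have B[measurable]: "B \<in> sets borel" by (simp add: sets_N)
  interpret N: sigma_finite_measure N by fact
  interpret pair_sigma_finite "lborel :: 'a measure" N ..
  let ?A = "ball (0::'a) 1"
  have A[measurable]: "?A \<in> sets borel" by simp
  have shiftN: "(\<integral>\<^sup>+y. g (c + y) \<partial>N) = (\<integral>\<^sup>+y. g y \<partial>N)" if [measurable]: "g \<in> borel_measurable borel" for g c
    by (subst (2) trans[of c, symmetric], subst nn_integral_distr) simp_all
  have iA: "(\<lambda>x. indicator ?A x :: ennreal) \<in> borel_measurable lborel"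
    by (intro borel_measurable_indicator) simp
  \<comment> \<open>The double integral of the indicators of x in A and x + y in B is computed in
    both orders. Translation invariance of \<open>N\<close> gives the left side; that of Lebesgue
    measure moves the shift onto the ball, whose symmetry gives
    \<open>emeasure N ?A * emeasure lborel B\<close>.\<close>
  have "emeasure lborel ?A * emeasure N B = (\<integral>\<^sup>+x. indicator ?A x \<partial>lborel) * emeasure N B"
    by simp
  also have "\<dots> = (\<integral>\<^sup>+x. indicator ?A x * emeasure N B \<partial>lborel)"
    by (rule nn_integral_multc[symmetric, OF iA])
  also have "\<dots> = (\<integral>\<^sup>+x. indicator ?A x * (\<integral>\<^sup>+y. indicator B (x + y) \<partial>N) \<partial>lborel)"
    by (subst shiftN) (simp_all add: sets_N)
  also have "\<dots> = (\<integral>\<^sup>+x. \<integral>\<^sup>+y. indicator ?A x * indicator B (x + y) \<partial>N \<partial>lborel)"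
    by (simp add: nn_integral_cmult)
  also have "\<dots> = (\<integral>\<^sup>+y. \<integral>\<^sup>+x. indicator ?A x * indicator B (x + y) \<partial>lborel \<partial>N)"
    by (rule Fubini'[symmetric]) measurable
  also have "\<dots> = (\<integral>\<^sup>+y. \<integral>\<^sup>+x. indicator ?A (x - y) * indicator B x \<partial>lborel \<partial>N)"
  proof (rule nn_integral_cong)
    fix y
    show "(\<integral>\<^sup>+x. indicator ?A x * indicator B (x + y) \<partial>lborel) = (\<integral>\<^sup>+x. indicator ?A (x - y) * indicator B x \<partial>lborel)"
      by (subst nn_integral_shift[of "\<lambda>x. indicator ?A (x - y) * indicator B x" y, symmetric])
        (simp_all add: add.commute)
  qed
  also have "\<dots> = (\<integral>\<^sup>+x. \<integral>\<^sup>+y. indicator ?A (x - y) * indicator B x \<partial>N \<partial>lborel)"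
    by (rule Fubini') measurable
  also have "\<dots> = (\<integral>\<^sup>+x. emeasure N ?A * indicator B x \<partial>lborel)"
  proof (rule nn_integral_cong)
    fix x
    have "(\<integral>\<^sup>+y. indicator ?A (x - y) * indicator B x \<partial>N) = (\<integral>\<^sup>+y. indicator ?A (- x + y) \<partial>N) * indicator B x"
      by (subst nn_integral_multc[symmetric])
        (auto intro!: nn_integral_cong simp: indicator_def dist_norm norm_minus_commute)
    moreover have "(\<integral>\<^sup>+y. indicator ?A (- x + y) \<partial>N) = emeasure N ?A"
      by (subst shiftN) (simp_all add: sets_N)
    ultimately show "(\<integral>\<^sup>+y. indicator ?A (x - y) * indicator B x \<partial>N) = emeasure N ?A * indicator B x"
      by (simp only:)
  qed
  also have "\<dots> = emeasure lborel ?A * emeasure lborel B"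
    by (simp add: nn_integral_cmult ball)
  finally have eq: "emeasure lborel ?A * emeasure N B = emeasure lborel ?A * emeasure lborel B" .
  have fin: "emeasure lborel ?A \<noteq> \<infinity>"
    using emeasure_lborel_ball_finite[of "0::'a" 1] by simp
  have "0 < measure lborel ?A" by (rule content_ball_pos) simp
  then have pos: "emeasure lborel ?A \<noteq> 0" by (auto simp: measure_def)
  show "emeasure N B = emeasure lborel B"
    using eq fin pos by (simp add: ennreal_mult_cancel_left)
qed (simp add: sets_N)

lemma measurable_matrix_vector [measurable]: "(\<lambda>x. A *v x) \<in> borel_measurable borel"
  for A :: "real^'n^'m"
  by (intro borel_measurable_continuous_onI matrix_vector_mult_linear_continuous_on)

text \<open>The image measure is translation invariant, since a shift by c after \<open>Q\<close> is
  a shift by Q^T c before it, and balls around 0 keep their mass because \<open>Q\<close> is an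
  isometry.\<close>

lemma distr_lborel_orthogonal:
  fixes Q :: "real^'n^'n"
  assumes Q: "orthogonal_matrix Q"
  shows "distr lborel borel ((*v) Q) = lborel"
proof (rule translation_invariant_eq_lborel)
  let ?N = "distr lborel borel ((*v) Q)"
  have norm: "norm (Q *v x) = norm x" for x
    using Q by (simp add: norm_eq_sqrt_inner inner_matrix_vector[of "Q *v x"] matrix_vector_mul_assoc
        orthogonal_matrix_def)
  have "((*v) Q) -` ball 0 e = ball 0 e" for e
    by (auto simp: norm)
  then have emb: "emeasure ?N (ball 0 e) = emeasure lborel (ball (0::real^'n) e)" for e
    by (subst emeasure_distr) simp_all
  then show "emeasure ?N (ball 0 1) = emeasure lborel (ball (0::real^'n) 1)" .
  show "sigma_finite_measure ?N"
  proof
    show "\<exists>A. countable A \<and> A \<subseteq> sets ?N \<and> \<Union> A = space ?N \<and> (\<forall>a\<in>A. emeasure ?N a \<noteq> \<infinity>)"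
    proof (intro exI conjI)
      show "countable (range (\<lambda>n::nat. ball (0::real^'n) (real n)))" by simp
      show "\<Union> (range (\<lambda>n::nat. ball (0::real^'n) (real n))) = space ?N"
        using reals_Archimedean2 by (auto)
      show "\<forall>a\<in>range (\<lambda>n::nat. ball (0::real^'n) (real n)). emeasure ?N a \<noteq> \<infinity>"
        using emeasure_lborel_ball_finite[of "0::real^'n"] by (auto simp: emb less_top[symmetric])
    qed auto
  qed
  show "distr ?N borel ((+) c) = ?N" for c
  proof -
    have "Q *v (transpose Q *v c) = c"
      unfolding matrix_vector_mul_assoc using Q by (simp add: orthogonal_matrix_def)
    then have "(+) c \<circ> (*v) Q = (*v) Q \<circ> (+) (transpose Q *v c)"
      unfolding fun_eq_iff o_def matrix_vector_right_distrib by simp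
    then have "distr ?N borel ((+) c) = distr (distr lborel borel ((+) (transpose Q *v c))) borel ((*v) Q)"
      by (simp add: distr_distr)
    then show ?thesis by (simp add: lborel_distr_plus)
  qed
qed simp

lemma nn_integral_orthogonal:
  fixes Q :: "real^'n^'n"
  assumes "orthogonal_matrix Q" and [measurable]: "f \<in> borel_measurable borel"
  shows "(\<integral>\<^sup>+x. f (Q *v x) \<partial>lborel) = (\<integral>\<^sup>+x. f x \<partial>lborel)"
  by (subst (2) distr_lborel_orthogonal[OF assms(1), symmetric], subst nn_integral_distr) simp_all

lemma Basis_real_vec: "(Basis :: (real^'n) set) = range (\<lambda>i. axis i 1)"
  by (auto simp: Basis_vec_def)

lemma inj_axis_one: "inj (\<lambda>i. axis i (1::real))"
  by (auto simp: inj_def axis_eq_axis)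

lemma prod_Basis_vec: "(\<Prod>b\<in>Basis. F b) = (\<Prod>i\<in>UNIV. F (axis i 1))" for F :: "real^'n \<Rightarrow> 'b::comm_monoid_mult"
  by (simp add: Basis_real_vec prod.reindex inj_axis_one)

lemma sum_Basis_vec: "(\<Sum>b\<in>Basis. F b) = (\<Sum>i\<in>UNIV. F (axis i 1))" for F :: "real^'n \<Rightarrow> 'b::comm_monoid_add"
  by (simp add: Basis_real_vec sum.reindex inj_axis_one)

lemma diag_mat_mult_vector: "diag_mat d *v x = (\<chi> i. d i * x $ i)"
  by (simp add: diag_mat_def matrix_vector_mult_def vec_eq_iff if_distrib[where f="\<lambda>z. z * _"] cong: if_cong)

lemma nn_integral_diag:
  fixes d :: "'n::finite \<Rightarrow> real"
  assumes d: "\<And>i. d i \<noteq> 0" and [measurable]: "f \<in> borel_measurable borel"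
  shows "ennreal \<bar>det (diag_mat d)\<bar> * (\<integral>\<^sup>+x. f (diag_mat d *v x) \<partial>lborel) = (\<integral>\<^sup>+x. f x \<partial>lborel)"
proof -
  define c where "c b = (\<chi> i. d i) \<bullet> b" for b :: "real^'n"
  have c_axis: "c (axis i 1) = d i" for i by (simp add: c_def inner_axis)
  have T: "(\<lambda>x. 0 + (\<Sum>j\<in>Basis. (c j * (x \<bullet> j)) *\<^sub>R j)) = (*v) (diag_mat d)"
  proof (rule ext)
    fix x :: "real^'n"
    show "0 + (\<Sum>j\<in>Basis. (c j * (x \<bullet> j)) *\<^sub>R j) = diag_mat d *v x"
      by (simp add: sum_Basis_vec c_axis inner_axis diag_mat_mult_vector vec_eq_iff)
        (simp add: axis_def if_distrib cong: if_cong)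
  qed
  have "lborel = density (distr lborel borel ((*v) (diag_mat d))) (\<lambda>_. ennreal (\<Prod>j\<in>Basis. \<bar>c j\<bar>))"
  proof -
    have "c j \<noteq> 0" if "j \<in> Basis" for j using that d by (auto simp: Basis_real_vec c_axis)
    from lborel_affine_euclidean[of c 0, OF this] show ?thesis unfolding T .
  qed
  moreover have "(\<Prod>j\<in>Basis. \<bar>c j\<bar>) = \<bar>det (diag_mat d)\<bar>"
    by (simp add: prod_Basis_vec c_axis det_diag_mat abs_prod)
  ultimately have L: "lborel = density (distr lborel borel ((*v) (diag_mat d))) (\<lambda>_. ennreal \<bar>det (diag_mat d)\<bar>)"
    by simp
  show ?thesis
    by (subst (2) L) (simp add: nn_integral_density nn_integral_distr nn_integral_cmult)
qed

text \<open>In T = Q D Q^T the two rotations preserve Lebesgue measure, and the diagonal factor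
  contributes its determinant.\<close>

lemma nn_integral_pos_def:
  fixes T :: "real^'n^'n"
  assumes T: "pos_def T" and f[measurable]: "f \<in> borel_measurable borel"
  shows "ennreal (det T) * (\<integral>\<^sup>+x. f (T *v x) \<partial>lborel) = (\<integral>\<^sup>+x. f x \<partial>lborel)"
proof -
  obtain B l where B: "onb UNIV B" and l: "\<And>b. b \<in> B \<Longrightarrow> T *v b = l b *\<^sub>R b"
    and pos: "\<And>b. b \<in> B \<Longrightarrow> l b > 0"
    using pos_def_eigenbasis[OF T] by metis
  obtain Q h where Q: "orthogonal_matrix Q" and h: "bij_betw h (UNIV :: 'n set) B"
    and TQ: "T = Q ** diag_mat (\<lambda>i. l (h i)) ** transpose Q"
    using eigenbasis_diagonalize[OF B l] by metis
  let ?D = "diag_mat (\<lambda>i. l (h i))"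
  have "h i \<in> B" for i using h by (auto simp: bij_betw_def)
  then have nz: "l (h i) \<noteq> 0" for i using pos[of "h i"] by simp
  have detT: "det T = \<bar>det ?D\<bar>"
  proof -
    have "det T = det ?D"
      using det_orthogonal_matrix[OF Q] by (auto simp: TQ det_mul)
    then show ?thesis using pos_def_det[OF T] by simp
  qed
  have "(\<integral>\<^sup>+x. f (T *v x) \<partial>lborel) = (\<integral>\<^sup>+x. f (Q *v (?D *v (transpose Q *v x))) \<partial>lborel)"
    by (simp only: TQ matrix_vector_mul_assoc matrix_mul_assoc)
  also have "\<dots> = (\<integral>\<^sup>+x. f (Q *v (?D *v x)) \<partial>lborel)"
    using Q by (intro nn_integral_orthogonal[of "transpose Q" "\<lambda>x. f (Q *v (?D *v x))"]) simp_all
  also have "ennreal (det T) * \<dots> = (\<integral>\<^sup>+x. f (Q *v x) \<partial>lborel)"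
    unfolding detT by (rule nn_integral_diag[OF nz]) simp
  also have "\<dots> = (\<integral>\<^sup>+x. f x \<partial>lborel)" by (rule nn_integral_orthogonal[OF Q f])
  finally show ?thesis .
qed

section \<open>Gaussian integrals\<close>

lemma mat_sqrt_inv:
  fixes S :: "real^'n^'n"
  assumes S: "pos_def S"
  shows "mat_sqrt S ** matrix_inv S ** mat_sqrt S = mat 1" "det (mat_sqrt S) = sqrt (det S)"
proof -
  let ?G = "mat_sqrt S"
  have G: "pos_def ?G" "?G ** ?G = S" by (rule mat_sqrt[OF S])+
  have "(?G ** matrix_inv S ** ?G) ** ?G = ?G ** (matrix_inv S ** S)"
    by (simp only: matrix_mul_assoc[symmetric] G)
  also have "\<dots> = ?G" by (simp add: matrix_inv(2) pos_def_invertible S)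
  finally have "(?G ** matrix_inv S ** ?G) ** (?G ** matrix_inv ?G) = ?G ** matrix_inv ?G"
    by (simp only: matrix_mul_assoc)
  then show "?G ** matrix_inv S ** ?G = mat 1"
    by (simp add: matrix_inv(1) pos_def_invertible G)
  have "det S = (det ?G)\<^sup>2" by (metis G(2) det_mul power2_eq_square)
  then show "det ?G = sqrt (det S)" using pos_def_det[OF G(1)] by simp
qed

lemma mat_sqrt_inv_form: "pos_def S \<Longrightarrow> (mat_sqrt S *v y) \<bullet> (matrix_inv S *v (mat_sqrt S *v y)) = y \<bullet> y"
proof -
  assume S: "pos_def S"
  have "(mat_sqrt S *v y) \<bullet> (matrix_inv S *v (mat_sqrt S *v y))
      = y \<bullet> ((mat_sqrt S ** matrix_inv S ** mat_sqrt S) *v y)"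
    by (simp only: symmetric_matrix_inner[OF pos_def_sym[OF pos_def_mat_sqrt[OF S]]] matrix_vector_mul_assoc matrix_mul_assoc)
  then show ?thesis by (simp add: mat_sqrt_inv(1)[OF S])
qed

section \<open>The standard Gaussian and its moments\<close>

definition std_density :: "real^'n \<Rightarrow> real" where
  "std_density y = exp (- (y \<bullet> y) / 2) / sqrt ((2 * pi) ^ CARD('n))"

lemma measurable_std_density [measurable]: "std_density \<in> borel_measurable borel"
  unfolding std_density_def by measurable

lemma std_density_nonneg: "0 \<le> std_density y"
  by (simp add: std_density_def)

lemma std_density_prod: "std_density y = (\<Prod>i\<in>UNIV. std_normal_density (y $ i))"
  unfolding std_density_def std_normal_density_def prod.distrib real_sqrt_power
  by (simp add: exp_sum[symmetric] inner_vec_def power2_eq_square sum_divide_distrib sum_negf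
      power_one_over)

lemma nn_integral_std_prod:
  fixes g :: "'n::finite \<Rightarrow> real \<Rightarrow> real"
  assumes [measurable]: "\<And>i. g i \<in> borel_measurable borel" and nn: "\<And>i t. 0 \<le> g i t"
  shows "(\<integral>\<^sup>+y. ennreal (std_density y * (\<Prod>i\<in>UNIV. g i (y $ i))) \<partial>lborel)
    = (\<Prod>i\<in>UNIV. \<integral>\<^sup>+t. ennreal (std_normal_density t * g i t) \<partial>lborel)"
proof -
  define F where "F b t = ennreal (std_normal_density t * g (axis_index b) t)" for b :: "real^'n" and t
  have "(\<integral>\<^sup>+y. ennreal (std_density y * (\<Prod>i\<in>UNIV. g i (y $ i))) \<partial>lborel)
      = (\<integral>\<^sup>+y. (\<Prod>b\<in>Basis. F b (y \<bullet> b)) \<partial>lborel)"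
    by (intro nn_integral_cong)
      (simp add: prod_Basis_vec F_def inner_axis axis_index_axis std_density_prod prod_ennreal nn
        flip: prod.distrib)
  also have "\<dots> = (\<Prod>b\<in>Basis. \<integral>\<^sup>+t. F b t \<partial>lborel)"
    by (rule nn_integral_lborel_prod) (simp_all add: F_def[abs_def])
  finally show ?thesis by (simp add: prod_Basis_vec F_def axis_index_axis)
qed

lemma nn_integral_std_density: "(\<integral>\<^sup>+y. ennreal (std_density (y :: real^'n::finite)) \<partial>lborel) = 1"
  using nn_integral_std_prod[of "\<lambda>(_::'n::finite) _. 1"]
  by (simp add: nn_integral_eq_integral)

lemma nn_integral_std_square: "(\<integral>\<^sup>+y. ennreal (std_density y * (y $ k)\<^sup>2) \<partial>lborel) = 1"
proof -
  let ?g = "\<lambda>i t. if i = k then t\<^sup>2 else (1::real)"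
  have 1: "(\<integral>\<^sup>+t. ennreal (std_normal_density t * ?g i t) \<partial>lborel) = 1" for i
  proof (cases "i = k")
    case True
    have "has_bochner_integral lborel (\<lambda>x. std_normal_density x * x\<^sup>2) 1"
      using std_normal_moment_even[of 1] by (simp add: fact_2)
    then have "(\<integral>\<^sup>+t. ennreal (std_normal_density t * t\<^sup>2) \<partial>lborel) = ennreal 1"
      by (subst nn_integral_eq_integral) (auto dest: has_bochner_integral_integral_eq simp: has_bochner_integral_iff)
    then show ?thesis using True by simp
  next
    case False
    then show ?thesis by (simp add: nn_integral_eq_integral)
  qed
  have "(\<integral>\<^sup>+y. ennreal (std_density y * (\<Prod>i\<in>UNIV. ?g i (y $ i))) \<partial>lborel) = 1"
    by (subst nn_integral_std_prod) (simp_all add: 1)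
  then show ?thesis by simp
qed

definition std_gaussian :: "(real^'n) measure" where
  "std_gaussian = density lborel (\<lambda>y. ennreal (std_density y))"

lemma sets_std_gaussian [measurable_cong]: "sets std_gaussian = sets borel"
  by (simp add: std_gaussian_def)

lemma prob_space_std_gaussian: "prob_space (std_gaussian :: (real^'n) measure)"
proof
  show "emeasure std_gaussian (space std_gaussian :: (real^'n) set) = 1"
    by (simp add: std_gaussian_def emeasure_density nn_integral_std_density)
qed

lemma integrable_std_square: "integrable std_gaussian (\<lambda>y. (y $ k)\<^sup>2)"
  and integral_std_square: "(\<integral>y. (y $ k)\<^sup>2 \<partial>std_gaussian) = 1"
proof -
  have nn: "(\<integral>\<^sup>+y. ennreal ((y $ k)\<^sup>2) \<partial>std_gaussian) = ennreal 1"
    using nn_integral_std_square[of k]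
    by (simp add: std_gaussian_def nn_integral_density std_density_nonneg flip: ennreal_mult)
  have "has_bochner_integral std_gaussian (\<lambda>y. (y $ k)\<^sup>2) 1"
    by (rule has_bochner_integral_nn_integral[OF _ _ _ nn]) simp_all
  then show "integrable std_gaussian (\<lambda>y. (y $ k)\<^sup>2)" "(\<integral>y. (y $ k)\<^sup>2 \<partial>std_gaussian) = 1"
    by (simp_all add: has_bochner_integral_iff)
qed

text \<open>Invariance under sign flips of coordinates; this makes the mixed second moments
  vanish.\<close>

lemma distr_std_gaussian_diag:
  fixes d :: "'n::finite \<Rightarrow> real"
  assumes d: "\<And>i. d i = 1 \<or> d i = -1"
  shows "distr std_gaussian borel ((*v) (diag_mat d)) = std_gaussian"
proof (rule measure_eqI)
  fix A :: "(real^'n) set"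
  assume "A \<in> sets (distr std_gaussian borel ((*v) (diag_mat d)))"
  then have A[measurable]: "A \<in> sets borel" by simp
  have "d i * d i = 1" for i using d[of i] by auto
  then have "(diag_mat d *v y) \<bullet> (diag_mat d *v y) = y \<bullet> y" for y
    by (simp add: diag_mat_mult_vector inner_vec_def mult_ac) (simp flip: mult.assoc)
  then have dens: "std_density (diag_mat d *v y) = std_density y" for y by (simp add: std_density_def)
  have "\<bar>d i\<bar> = 1" for i using d[of i] by auto
  then have det: "\<bar>det (diag_mat d)\<bar> = 1" by (simp add: det_diag_mat abs_prod)
  have nz: "d i \<noteq> 0" for i using d[of i] by auto
  have "emeasure (distr std_gaussian borel ((*v) (diag_mat d))) A
      = (\<integral>\<^sup>+y. ennreal (std_density (diag_mat d *v y)) * indicator A (diag_mat d *v y) \<partial>lborel)"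
    using measurable_sets[OF measurable_matrix_vector A, of "diag_mat d"]
    by (simp add: emeasure_distr std_gaussian_def emeasure_density dens indicator_def)
  also have "\<dots> = (\<integral>\<^sup>+y. ennreal (std_density y) * indicator A y \<partial>lborel)"
    using nn_integral_diag[of d "\<lambda>y. ennreal (std_density y) * indicator A y"] nz det by simp
  also have "\<dots> = emeasure std_gaussian A"
    by (simp add: std_gaussian_def emeasure_density)
  finally show "emeasure (distr std_gaussian borel ((*v) (diag_mat d))) A = emeasure std_gaussian A" .
qed (simp add: sets_std_gaussian)

lemma integrable_std_moment: "integrable std_gaussian (\<lambda>y. y $ i * y $ j)"
  and integral_std_moment: "(\<integral>y. y $ i * y $ j \<partial>std_gaussian) = (if i = j then 1 else 0)"
proof -
  show "integrable std_gaussian (\<lambda>y. y $ i * y $ j)"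
  proof (rule Bochner_Integration.integrable_bound)
    show "integrable std_gaussian (\<lambda>y. (y $ i)\<^sup>2 + (y $ j)\<^sup>2)"
      by (intro Bochner_Integration.integrable_add integrable_std_square)
    have "\<bar>a * b\<bar> \<le> a\<^sup>2 + b\<^sup>2" for a b :: real
      using sum_squares_bound[of "\<bar>a\<bar>" "\<bar>b\<bar>"] mult_nonneg_nonneg[of "\<bar>a\<bar>" "\<bar>b\<bar>"]
      unfolding abs_mult power2_abs mult.assoc by linarith
    then show "AE y in std_gaussian. norm (y $ i * y $ j) \<le> norm ((y $ i)\<^sup>2 + (y $ j)\<^sup>2)"
      by simp
  qed simp
  show "(\<integral>y. y $ i * y $ j \<partial>std_gaussian) = (if i = j then 1 else 0)"
  proof (cases "i = j")
    case True
    then show ?thesis using integral_std_square[of j] by (simp add: power2_eq_square)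
  next
    case False
    \<comment> \<open>Reflecting coordinate \<open>i\<close> alone negates the integrand, so the
      integral equals its own negative.\<close>
    let ?d = "\<lambda>k. if k = i then -1 else (1::real)"
    have "(\<integral>y. y $ i * y $ j \<partial>std_gaussian)
        = (\<integral>y. y $ i * y $ j \<partial>distr std_gaussian borel ((*v) (diag_mat ?d)))"
      by (subst distr_std_gaussian_diag) simp_all
    also have "\<dots> = (\<integral>y. - (y $ i * y $ j) \<partial>std_gaussian)"
      using False by (subst integral_distr) (simp_all add: diag_mat_mult_vector)
    finally show ?thesis using False by simp
  qed
qed

text \<open>Substituting x = S^1/2 y turns the exponent into that of the standard density, and the
  determinant of the square root cancels the normalisation. Moments of every Gaussian thus reduce to
  standard ones.\<close>

lemma gaussian_distr:
  fixes S :: "real^'n^'n"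
  assumes S: "pos_def S"
  shows "gaussian S = distr std_gaussian borel ((*v) (mat_sqrt S))"
proof (rule measure_eqI)
  fix A assume "A \<in> sets (gaussian S)"
  then have A[measurable]: "A \<in> sets borel" by (simp add: gaussian_def)
  let ?G = "mat_sqrt S"
  let ?dens = "\<lambda>x. exp (- (x \<bullet> (matrix_inv S *v x)) / 2) / sqrt ((2 * pi) ^ CARD('n) * det S)"
  have dens: "?dens (?G *v y) = std_density y / det ?G" for y
    by (simp add: mat_sqrt_inv_form[OF S] std_density_def mat_sqrt_inv(2)[OF S] real_sqrt_mult)
  have G: "pos_def ?G" by (rule pos_def_mat_sqrt[OF S])
  have detG: "det ?G > 0" by (rule pos_def_det[OF G])
  have "emeasure (gaussian S) A = (\<integral>\<^sup>+x. ennreal (?dens x) * indicator A x \<partial>lborel)"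
    by (simp add: gaussian_def emeasure_density)
  also have "\<dots> = ennreal (det ?G) * (\<integral>\<^sup>+y. ennreal (?dens (?G *v y)) * indicator A (?G *v y) \<partial>lborel)"
    by (subst nn_integral_pos_def[OF G, of "\<lambda>x. ennreal (?dens x) * indicator A x"]) simp_all
  also have "\<dots> = (\<integral>\<^sup>+y. ennreal (det ?G) * (ennreal (std_density y / det ?G) * indicator A (?G *v y)) \<partial>lborel)"
    unfolding dens by (rule nn_integral_cmult[symmetric]) simp
  also have "\<dots> = (\<integral>\<^sup>+y. ennreal (std_density y) * indicator A (?G *v y) \<partial>lborel)"
    using detG by (intro nn_integral_cong)
      (simp flip: mult.assoc ennreal_mult add: std_density_nonneg)
  also have "\<dots> = emeasure (distr std_gaussian borel ((*v) ?G)) A"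
    using measurable_sets[OF measurable_matrix_vector A, of ?G]
    by (simp add: emeasure_distr std_gaussian_def emeasure_density indicator_def)
  finally show "emeasure (gaussian S) A = emeasure (distr std_gaussian borel ((*v) ?G)) A" .
qed (simp add: gaussian_def)

lemma sets_gaussian [measurable_cong]: "sets (gaussian S) = sets borel"
  by (simp add: gaussian_def)

lemma prob_space_gaussian: "pos_def S \<Longrightarrow> prob_space (gaussian S)"
  by (simp add: gaussian_distr prob_space.prob_space_distr[OF prob_space_std_gaussian])

lemma integrable_gaussian_moment: "pos_def S \<Longrightarrow> integrable (gaussian S) (\<lambda>w. w $ i * w $ j)"
  and integral_gaussian_moment: "pos_def S \<Longrightarrow> (\<integral>w. w $ i * w $ j \<partial>gaussian S) = S $ i $ j"
proof -
  assume S: "pos_def S"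
  let ?G = "mat_sqrt S"
  have eq: "(?G *v y) $ i * (?G *v y) $ j = (\<Sum>k\<in>UNIV. \<Sum>l\<in>UNIV. (?G $ i $ k * ?G $ j $ l) * (y $ k * y $ l))" for y
    by (simp add: matrix_vector_mult_def sum_product mult_ac)
  have int: "integrable std_gaussian (\<lambda>y. (?G *v y) $ i * (?G *v y) $ j)"
    unfolding eq by (intro Bochner_Integration.integrable_sum integrable_mult_right integrable_std_moment)
  then show "integrable (gaussian S) (\<lambda>w. w $ i * w $ j)"
    unfolding gaussian_distr[OF S] by (subst integrable_distr_eq) simp_all
  have "(\<integral>w. w $ i * w $ j \<partial>gaussian S) = (\<integral>y. (?G *v y) $ i * (?G *v y) $ j \<partial>std_gaussian)"
    unfolding gaussian_distr[OF S] by (subst integral_distr) simp_all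
  also have "\<dots> = (\<Sum>k\<in>UNIV. ?G $ i $ k * ?G $ j $ k)"
    unfolding eq
    by (simp add: Bochner_Integration.integral_sum integrable_std_moment integral_std_moment
        if_distrib cong: if_cong)
  also have "\<dots> = (?G ** transpose ?G) $ i $ j"
    by (simp add: matrix_matrix_mult_def transpose_def)
  also have "\<dots> = S $ i $ j"
    by (simp add: pos_def_sym[OF pos_def_mat_sqrt[OF S]] mat_sqrt_square[OF S])
  finally show "(\<integral>w. w $ i * w $ j \<partial>gaussian S) = S $ i $ j" .
qed

lemma quadratic_form_sum: "x \<bullet> (A *v y) = (\<Sum>i\<in>UNIV. \<Sum>j\<in>UNIV. A $ i $ j * (x $ i * y $ j))"
  for A :: "real^'n^'m"
  by (simp add: inner_vec_def matrix_vector_mult_def sum_distrib_left mult_ac)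

lemma integrable_gaussian_quadratic: "pos_def S \<Longrightarrow> integrable (gaussian S) (\<lambda>v. v \<bullet> (N *v v))"
  and integral_gaussian_quadratic: "pos_def S \<Longrightarrow> (\<integral>v. v \<bullet> (N *v v) \<partial>gaussian S) = N \<bullet> S"
  unfolding quadratic_form_sum inner_matrix
  by (intro Bochner_Integration.integrable_sum integrable_mult_right integrable_gaussian_moment)
    (simp_all add: Bochner_Integration.integral_sum integrable_gaussian_moment integral_gaussian_moment)

text \<open>Shifting by the mode M^-1 b removes the linear term and leaves the factor exp (b . M^-1
  b / 2). The square root of M^-1 then turns the quadratic form into the standard one.\<close>

lemma nn_integral_exp_quadratic:
  fixes M :: "real^'n^'n"
  assumes M: "pos_def M"
  shows "(\<integral>\<^sup>+x. ennreal (exp (- (x \<bullet> (M *v x)) / 2 + b \<bullet> x)) \<partial>lborel)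
    = ennreal (sqrt ((2 * pi) ^ CARD('n) / det M) * exp ((b \<bullet> (matrix_inv M *v b)) / 2))"
proof -
  let ?c = "matrix_inv M *v b"
  let ?S = "matrix_inv M"
  have inv: "invertible M" by (rule pos_def_invertible[OF M])
  have S: "pos_def ?S" by (rule pos_def_inv[OF M])
  let ?G = "mat_sqrt ?S"
  have G: "pos_def ?G" by (rule pos_def_mat_sqrt[OF S])
  have SM: "matrix_inv ?S = M" by (rule matrix_inv_unique) (rule matrix_inv(2)[OF inv])
  have Mc: "M *v ?c = b" by (simp add: matrix_vector_mul_assoc matrix_inv inv)
  have "det M * det ?S = 1" by (simp add: det_mul[symmetric] matrix_inv inv)
  then have detS: "det ?S = 1 / det M" using pos_def_det[OF M] by (simp add: field_simps)
  define K where "K = exp ((b \<bullet> ?c) / 2)"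
  have K: "K \<ge> 0" by (simp add: K_def)
  have shift: "exp (- ((?c + x) \<bullet> (M *v (?c + x))) / 2 + b \<bullet> (?c + x)) = K * exp (- (x \<bullet> (M *v x)) / 2)" for x
  proof -
    have "(?c + x) \<bullet> (M *v (?c + x)) = ?c \<bullet> b + 2 * (b \<bullet> x) + x \<bullet> (M *v x)"
      using symmetric_matrix_inner[OF pos_def_sym[OF M], of ?c x]
      by (simp add: matrix_vector_right_distrib inner_add_left inner_add_right Mc inner_commute)
    then show ?thesis
      by (simp add: K_def exp_add[symmetric] inner_add_right inner_commute field_simps)
  qed
  have GMG: "(?G *v y) \<bullet> (M *v (?G *v y)) = y \<bullet> y" for y
    using mat_sqrt_inv_form[OF S, of y] by (simp only: SM)
  have "(\<integral>\<^sup>+x. ennreal (exp (- (x \<bullet> (M *v x)) / 2 + b \<bullet> x)) \<partial>lborel)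
     = (\<integral>\<^sup>+x. ennreal (K * exp (- (x \<bullet> (M *v x)) / 2)) \<partial>lborel)"
    unfolding shift[symmetric]
    by (rule nn_integral_shift[of "\<lambda>x. ennreal (exp (- (x \<bullet> (M *v x)) / 2 + b \<bullet> x))" ?c, symmetric]) measurable
  also have "\<dots> = ennreal (det ?G) * (\<integral>\<^sup>+y. ennreal (K * exp (- (y \<bullet> y) / 2)) \<partial>(lborel :: (real^'n) measure))"
    by (subst nn_integral_pos_def[OF G, of "\<lambda>x. ennreal (K * exp (- (x \<bullet> (M *v x)) / 2))", symmetric])
      (simp_all add: GMG)
  also have "\<dots> = ennreal (det ?G) * (\<integral>\<^sup>+y. ennreal (K * sqrt ((2 * pi) ^ CARD('n))) * ennreal (std_density (y :: real^'n)) \<partial>lborel)"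
    using K by (simp add: std_density_def flip: ennreal_mult)
  also have "\<dots> = ennreal (det ?G) * ennreal (K * sqrt ((2 * pi) ^ CARD('n)))"
    by (simp add: nn_integral_cmult nn_integral_std_density)
  also have "\<dots> = ennreal (det ?G * (K * sqrt ((2 * pi) ^ CARD('n))))"
    using K pos_def_det[OF G] by (intro ennreal_mult[symmetric]) simp_all
  also have "det ?G * (K * sqrt ((2 * pi) ^ CARD('n))) = sqrt ((2 * pi) ^ CARD('n) / det M) * K"
    by (simp add: mat_sqrt_inv(2)[OF S] detS real_sqrt_divide)
  finally show ?thesis by (simp add: K_def)
qed

text \<open>Convexity of \<open>exp\<close> and \<open>q (u + t e) + q (u - t e) \<ge> 2 q u\<close> give every pair of unit balls around
  \<open>t e\<close> and \<open>- t e\<close> at least the mass of the ball around 0; there are infinitely many disjoint pairs.\<close>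

lemma nn_integral_exp_quadratic_infinite:
  fixes M :: "real^'n^'n"
  assumes x: "x \<noteq> 0" "x \<bullet> (M *v x) \<le> 0"
  shows "(\<integral>\<^sup>+u. ennreal (exp (- (u \<bullet> (M *v u)) / 2 + b \<bullet> u)) \<partial>lborel) = \<infinity>"
proof -
  define q where "q u = - (u \<bullet> (M *v u)) / 2 + b \<bullet> u" for u
  have q[measurable]: "q \<in> borel_measurable borel" unfolding q_def by measurable
  define e where "e = x /\<^sub>R norm x"
  have ne: "norm e = 1" using x(1) by (simp add: e_def)
  have "e \<bullet> (M *v e) = (x \<bullet> (M *v x)) / (norm x)\<^sup>2"
    by (simp add: e_def matrix_vector_mult_scaleR power2_eq_square divide_inverse)
  then have e: "e \<bullet> (M *v e) \<le> 0" using x by (simp add: divide_le_0_iff)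
  define D where "D t = ball (t *\<^sub>R e) 1" for t
  define N where "N = density lborel (\<lambda>u. ennreal (exp (q u)))"
  have sets_N: "sets N = sets borel" by (simp add: N_def)
  have D[measurable]: "D t \<in> sets borel" for t by (simp add: D_def)
  have ND: "emeasure N (D t) = (\<integral>\<^sup>+u. ennreal (exp (q (t *\<^sub>R e + u))) * indicator (D 0) u \<partial>lborel)" for t
  proof -
    have "emeasure N (D t) = (\<integral>\<^sup>+u. ennreal (exp (q u)) * indicator (D t) u \<partial>lborel)"
      by (simp add: N_def emeasure_density D_def)
    also have "\<dots> = (\<integral>\<^sup>+u. ennreal (exp (q (t *\<^sub>R e + u))) * indicator (D t) (t *\<^sub>R e + u) \<partial>lborel)"
      by (rule nn_integral_shift[symmetric]) measurable
    finally show ?thesis by (simp add: D_def indicator_def dist_norm)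
  qed
  have mid: "2 * exp (q u) \<le> exp (q (t *\<^sub>R e + u)) + exp (q ((- t) *\<^sub>R e + u))" for t u
  proof -
    have amgm: "2 * exp ((a + c) / 2) \<le> exp a + exp c" for a c :: real
    proof -
      have "exp a = (exp (a / 2))\<^sup>2" "exp c = (exp (c / 2))\<^sup>2" "exp ((a + c) / 2) = exp (a / 2) * exp (c / 2)"
        by (simp_all add: exp_double[symmetric] add_divide_distrib exp_add)
      then show ?thesis using sum_squares_bound[of "exp (a / 2)" "exp (c / 2)"] by simp
    qed
    have "(q (t *\<^sub>R e + u) + q ((- t) *\<^sub>R e + u)) / 2 = q u - (t\<^sup>2 * (e \<bullet> (M *v e))) / 2"
      by (simp add: q_def matrix_vector_right_distrib matrix_vector_mult_scaleR
          matrix_vector_mult_diff_distrib inner_add_left inner_add_right inner_diff_left inner_diff_right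
          power2_eq_square field_simps)
    moreover have "t\<^sup>2 * (e \<bullet> (M *v e)) \<le> 0" using e by (simp add: mult_nonneg_nonpos)
    ultimately have "2 * exp (q u) \<le> 2 * exp ((q (t *\<^sub>R e + u) + q ((- t) *\<^sub>R e + u)) / 2)" by simp
    also have "\<dots> \<le> exp (q (t *\<^sub>R e + u)) + exp (q ((- t) *\<^sub>R e + u))" by (rule amgm)
    finally show ?thesis .
  qed
  have pair: "emeasure N (D 0) \<le> emeasure N (D t) + emeasure N (D (- t))" for t
  proof -
    have D0: "D 0 \<in> sets borel" by (simp add: D_def)
    have "exp (q u) \<le> exp (q (t *\<^sub>R e + u)) + exp (q ((- t) *\<^sub>R e + u))" for u
      using mid[of u t] exp_gt_zero[of "q u"] by linarith
    then have "emeasure N (D 0) \<le> (\<integral>\<^sup>+u. (ennreal (exp (q (t *\<^sub>R e + u))) + ennreal (exp (q ((- t) *\<^sub>R e + u)))) * indicator (D 0) u \<partial>lborel)"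
      unfolding ND[of 0]
      by (intro nn_integral_mono mult_right_mono) (simp_all flip: ennreal_plus)
    also have "\<dots> = emeasure N (D t) + emeasure N (D (- t))"
      unfolding ND[of t] ND[of "- t"] distrib_right using D0 by (intro nn_integral_add) simp_all
    finally show ?thesis .
  qed
  have D_disj: "D s \<inter> D t = {}" if "\<bar>s - t\<bar> \<ge> 2" for s t
  proof -
    have "dist (s *\<^sub>R e) (t *\<^sub>R e) = \<bar>s - t\<bar>"
      using ne by (simp add: dist_norm flip: scaleR_diff_left)
    then show ?thesis unfolding D_def using that by (intro disjoint_ballI) (simp only: one_add_one)
  qed
  \<comment> \<open>Centres at distance at least 2 give disjoint unit balls. \<open>Suc\<close>
    excludes the centre 0, where the two balls of a pair would coincide.\<close>
  define P where "P k = D (2 * real (Suc k)) \<union> D (- (2 * real (Suc k)))" for k :: nat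
  have P: "P k \<in> sets N" for k by (simp add: P_def D_def sets_N)
  have disj: "disjoint_family P"
    unfolding disjoint_family_on_def
  proof (intro ballI impI)
    fix m n :: nat assume "m \<noteq> n"
    then have "\<bar>real m - real n\<bar> \<ge> 1" by linarith
    then show "P m \<inter> P n = {}"
      unfolding P_def Int_Un_distrib Int_Un_distrib2 by (simp add: D_disj)
  qed
  have "emeasure N (D 0) \<le> emeasure N (P k)" for k
  proof -
    have "emeasure N (P k) = emeasure N (D (2 * real (Suc k))) + emeasure N (D (- (2 * real (Suc k))))"
      unfolding P_def
    proof (rule plus_emeasure[symmetric])
      show "D (2 * real (Suc k)) \<inter> D (- (2 * real (Suc k))) = {}" by (rule D_disj) simp
    qed (simp_all only: sets_N D)
    then show ?thesis using pair[of "2 * real (Suc k)"] by (simp only:)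
  qed
  then have "(\<Sum>k<n. emeasure N (D 0)) \<le> (\<Sum>k<n. emeasure N (P k))" for n by (rule sum_mono)
  also have "(\<Sum>k<n. emeasure N (P k)) \<le> emeasure N UNIV" for n
  proof -
    have "(\<Sum>k<n. emeasure N (P k)) = emeasure N (\<Union>k<n. P k)"
      using P disj by (intro sum_emeasure) (auto intro: disjoint_family_on_mono)
    also have "\<dots> \<le> emeasure N UNIV" by (rule emeasure_mono) (simp_all add: sets_N)
    finally show ?thesis .
  qed
  finally have le: "of_nat n * emeasure N (D 0) \<le> emeasure N UNIV" for n by simp
  have pos: "emeasure N (D 0) \<noteq> 0"
  proof
    assume "emeasure N (D 0) = 0"
    then have "emeasure lborel (D 0) = 0"
      unfolding ND by (subst (asm) nn_integral_0_iff) (simp_all add: D_def indicator_def Collect_conv_if ball_def)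
    moreover have "0 < measure lborel (D 0)" unfolding D_def by (rule content_ball_pos) simp
    ultimately show False by (simp add: measure_def)
  qed
  have "emeasure N UNIV = \<infinity>"
  proof (rule ccontr)
    assume "emeasure N UNIV \<noteq> \<infinity>"
    then obtain r where r: "emeasure N UNIV = ennreal r" "r \<ge> 0" by (cases "emeasure N UNIV") auto
    then have "emeasure N (D 0) \<le> ennreal r" using le[of 1] by simp
    then obtain a where a: "emeasure N (D 0) = ennreal a" "a \<ge> 0"
      by (cases "emeasure N (D 0)") (auto simp: top_unique)
    with pos have "a > 0" by auto
    then obtain n where n: "r < real n * a" using reals_Archimedean3 by blast
    have "ennreal (real n * a) \<le> ennreal r"
      using le[of n] a r by (simp add: ennreal_mult ennreal_of_nat_eq_real_of_nat)
    then show False using n r a by (simp add: ennreal_le_iff)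
  qed
  then show ?thesis
    by (simp add: N_def emeasure_density q_def)
qed

section \<open>Blocks of the covariance\<close>

lemma matrix_inv_cancel:
  fixes R :: "real^'n^'n" and X :: "real^'n^'m"
  assumes "pos_def R"
  shows "X ** matrix_inv R ** R = X" "X ** R ** matrix_inv R = X"
    "matrix_inv R ** R = mat 1" "R ** matrix_inv R = mat 1"
  using matrix_inv[OF pos_def_invertible[OF assms]] by (simp_all flip: matrix_mul_assoc)

lemma sum_UNIV_sum_type:
  "(\<Sum>k\<in>UNIV. f k) = (\<Sum>i\<in>UNIV. f (Inl i)) + (\<Sum>j\<in>UNIV. f (Inr j))"
  for f :: "'a::finite + 'b::finite \<Rightarrow> 'c::comm_monoid_add"
  by (subst UNIV_Plus_UNIV[symmetric], subst sum.Plus) simp_all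

lemma block_form:
  "w \<bullet> (C *v w) = u_part w \<bullet> (C_uu C *v u_part w) + u_part w \<bullet> (C_uv C *v v_part w)
    + v_part w \<bullet> (C_vu C *v u_part w) + v_part w \<bullet> (C_vv C *v v_part w)"
  by (simp add: quadratic_form_sum sum_UNIV_sum_type u_part_def v_part_def C_uu_def C_uv_def
      C_vu_def C_vv_def sum.distrib)

lemma inner_vector_matrix: "v \<bullet> (u v* S) = u \<bullet> (S *v v)" for S :: "real^'m^'n"
  by (metis dot_lmul_matrix inner_commute)

lemma C_vu_transpose: "pos_def C \<Longrightarrow> C_vu C = transpose (C_uv C)"
  using pos_def_sym[of C] by (simp add: C_vu_def C_uv_def transpose_def vec_eq_iff)

lemma block_pos:
  assumes C: "pos_def C" and "u \<noteq> 0 \<or> v \<noteq> 0"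
  shows "0 < u \<bullet> (C_uu C *v u) + 2 * (u \<bullet> (C_uv C *v v)) + v \<bullet> (C_vv C *v v)"
proof -
  define w where "w = (\<chi> k. case k of Inl i \<Rightarrow> u $ i | Inr j \<Rightarrow> v $ j)"
  have uv: "u_part w = u" "v_part w = v"
    by (simp_all add: w_def u_part_def v_part_def vec_eq_iff)
  have "u_part 0 = 0" "v_part 0 = 0" by (simp_all add: u_part_def v_part_def vec_eq_iff)
  then have "w \<noteq> 0" using assms(2) uv by metis
  from pos_defD[OF C this] show ?thesis
    by (simp add: block_form uv C_vu_transpose[OF C] inner_vector_matrix)
qed

lemma pos_def_C_uu: "pos_def C \<Longrightarrow> pos_def (C_uu C)"
  and pos_def_C_vv: "pos_def C \<Longrightarrow> pos_def (C_vv C)"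
  using block_pos[of C _ 0] block_pos[of C 0] pos_def_sym[of C]
  by (auto simp: pos_def_def C_uu_def C_vv_def transpose_def vec_eq_iff)

text \<open>At fixed x the block form is smallest at v = - K^-1 S^T x, and its value there is the
  Schur complement form. With the hypothesis on the form and not on a block matrix, the lemma covers
  both conditional covariances.\<close>

lemma pos_def_schur:
  fixes P :: "real^'n^'n" and K :: "real^'m^'m" and S :: "real^'m^'n"
  assumes P: "transpose P = P" and K: "pos_def K"
    and pos: "\<And>u v. u \<noteq> 0 \<or> v \<noteq> 0 \<Longrightarrow> 0 < u \<bullet> (P *v u) + 2 * (u \<bullet> (S *v v)) + v \<bullet> (K *v v)"
  shows "pos_def (P - S ** matrix_inv K ** transpose S)"
proof -
  have Ki: "transpose (matrix_inv K) = matrix_inv K"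
    using pos_def_sym[OF pos_def_inv[OF K]] .
  have "0 < x \<bullet> ((P - S ** matrix_inv K ** transpose S) *v x)" if "x \<noteq> 0" for x
  proof -
    let ?z = "matrix_inv K *v (transpose S *v x)"
    have Kz: "K *v ?z = transpose S *v x"
      by (simp add: matrix_vector_mul_assoc matrix_inv_cancel[OF K] matrix_mul_assoc)
    have q: "x \<bullet> (S *v ?z) = ?z \<bullet> (K *v ?z)"
      unfolding Kz by (subst inner_matrix_vector) (rule inner_commute)
    have "x \<bullet> ((P - S ** matrix_inv K ** transpose S) *v x) = x \<bullet> (P *v x) - x \<bullet> (S *v ?z)"
      by (simp only: matrix_vector_mult_diff_rdistrib inner_diff_right matrix_vector_mul_assoc
          matrix_mul_assoc)
    also have "\<dots> = x \<bullet> (P *v x) + 2 * (x \<bullet> (S *v (- ?z))) + (- ?z) \<bullet> (K *v (- ?z))"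
    proof -
      have neg: "A *v (- z) = - (A *v z)" for A :: "real^'m^'p" and z
        using matrix_vector_mult_scaleR[of A "-1" z] by simp
      show ?thesis unfolding neg inner_minus_left inner_minus_right q by simp
    qed
    also have "\<dots> > 0" using pos that by blast
    finally show ?thesis .
  qed
  then show ?thesis
    by (simp add: pos_def_def transpose_diff P matrix_transpose_mul Ki matrix_mul_assoc)
qed

lemma pos_def_C_u_given_v:
  assumes C: "pos_def C"
  shows "pos_def (C_u_given_v C)"
  unfolding C_u_given_v_def C_vu_transpose[OF C]
  by (rule pos_def_schur[OF pos_def_sym[OF pos_def_C_uu[OF C]] pos_def_C_vv[OF C] block_pos[OF C]])

lemma pos_def_C_v_given_u:
  assumes C: "pos_def C"
  shows "pos_def (C_v_given_u C)"
proof -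
  have "pos_def (C_vv C - C_vu C ** matrix_inv (C_uu C) ** transpose (C_vu C))"
  proof (rule pos_def_schur)
    show "0 < v \<bullet> (C_vv C *v v) + 2 * (v \<bullet> (C_vu C *v u)) + u \<bullet> (C_uu C *v u)"
      if "v \<noteq> 0 \<or> u \<noteq> 0" for u v
      using block_pos[OF C, of u v] that
      by (simp add: C_vu_transpose[OF C] inner_vector_matrix add_ac disj_commute)
  qed (auto intro: pos_def_sym pos_def_C_uu pos_def_C_vv C)
  then show ?thesis by (simp add: C_v_given_u_def C_vu_transpose[OF C])
qed

section \<open>Evaluation of the loss\<close>

text \<open>Quadratic forms see only this part of a matrix, so an antisymmetric change of
  \<open>B\<close> leaves the loss unchanged.\<close>

definition symm :: "real^'n^'n \<Rightarrow> real^'n^'n" where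
  "symm M = (1/2) *\<^sub>R (M + transpose M)"

lemma transpose_scaleR: "transpose (c *\<^sub>R M) = c *\<^sub>R transpose M" for M :: "real^'n^'m"
  by (simp add: transpose_def vec_eq_iff)

lemma transpose_symm: "transpose (symm M) = symm M"
  by (simp add: symm_def transpose_scaleR transpose_add add.commute)

lemma symm_form: "x \<bullet> (symm M *v x) = x \<bullet> (M *v x)"
  using inner_matrix_vector[of x "transpose M" x]
  by (simp add: symm_def matrix_vector_mult_add_rdistrib inner_add_right inner_commute
      flip: scaleR_matrix_vector_assoc)

lemma symm_id: "transpose M = M \<Longrightarrow> symm M = M"
  by (simp add: symm_def flip: scaleR_2)

lemma inner_symm: "transpose N = N \<Longrightarrow> symm M \<bullet> N = M \<bullet> N"
  using inner_transpose[of M N] by (simp add: symm_def inner_add_left)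

lemma pos_def_symm_iff: "pos_def (symm M) \<longleftrightarrow> (\<forall>x. x \<noteq> 0 \<longrightarrow> 0 < x \<bullet> (M *v x))"
  by (simp add: pos_def_def transpose_symm symm_form)

lemma integral_linear_term:
  assumes C: "pos_def C"
  shows "(\<integral>w. (1/2) * (u_part w \<bullet> (B *v u_part w)) - u_part w \<bullet> (A *v v_part w) \<partial>gaussian C)
    = (1/2) * (B \<bullet> C_uu C) - A \<bullet> C_uv C"
proof -
  have int: "integrable (gaussian C) (\<lambda>w. u_part w \<bullet> (B *v u_part w))"
    "integrable (gaussian C) (\<lambda>w. u_part w \<bullet> (A *v v_part w))"
    unfolding quadratic_form_sum u_part_def v_part_def vec_lambda_beta
    by (intro Bochner_Integration.integrable_sum integrable_mult_right integrable_gaussian_moment C)+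
  have "(\<integral>w. u_part w \<bullet> (B *v u_part w) \<partial>gaussian C) = B \<bullet> C_uu C"
    "(\<integral>w. u_part w \<bullet> (A *v v_part w) \<partial>gaussian C) = A \<bullet> C_uv C"
    unfolding quadratic_form_sum u_part_def v_part_def vec_lambda_beta inner_matrix C_uu_def C_uv_def
    by (simp_all add: Bochner_Integration.integral_sum integrable_gaussian_moment[OF C]
        integral_gaussian_moment[OF C])
  then show ?thesis using int by simp
qed

text \<open>The exponent of the Gaussian density merges with the quadratic term; this is the origin
  of the shift of \<open>B\<close> by C_uu^-1.\<close>

lemma inner_integral:
  fixes C :: "real^('u::finite + 'v::finite)^('u + 'v)"
  assumes C: "pos_def C"
  shows "(\<integral>\<^sup>+ u. ennreal (exp (- (1/2) * (u \<bullet> (B *v u)) + u \<bullet> (A *v v))) \<partial>gaussian (C_uu C))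
    = ennreal (1 / sqrt ((2 * pi) ^ CARD('u) * det (C_uu C)))
      * (\<integral>\<^sup>+ u. ennreal (exp (- (u \<bullet> (symm (shifted C B) *v u)) / 2 + (A *v v) \<bullet> u)) \<partial>lborel)"
proof -
  let ?c = "1 / sqrt ((2 * pi) ^ CARD('u) * det (C_uu C))"
  have c: "?c \<ge> 0" using pos_def_det[OF pos_def_C_uu[OF C]] by simp
  have eq: "ennreal (exp (- (u \<bullet> (matrix_inv (C_uu C) *v u)) / 2) / sqrt ((2 * pi) ^ CARD('u) * det (C_uu C)))
      * ennreal (exp (- (1/2) * (u \<bullet> (B *v u)) + u \<bullet> (A *v v)))
    = ennreal ?c * ennreal (exp (- (u \<bullet> (symm (shifted C B) *v u)) / 2 + (A *v v) \<bullet> u))" for u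
  proof -
    have "- (u \<bullet> (symm (shifted C B) *v u)) / 2 + (A *v v) \<bullet> u
        = - (u \<bullet> (matrix_inv (C_uu C) *v u)) / 2 + (- (1/2) * (u \<bullet> (B *v u)) + u \<bullet> (A *v v))"
      unfolding symm_form shifted_def
      by (simp add: matrix_vector_mult_add_rdistrib inner_add_right inner_commute add_divide_distrib)
    then show ?thesis using c by (simp only: exp_add) (simp flip: ennreal_mult)
  qed
  show ?thesis
    unfolding gaussian_def by (subst nn_integral_density) (simp_all only: eq, simp_all add: nn_integral_cmult)
qed

lemma ext_ln_ennreal: "0 < x \<Longrightarrow> ext_ln (ennreal x) = ereal (ln x)"
  by (simp add: ext_ln_def)

lemma ext_expectation_ereal:
  assumes f: "integrable M f"
  shows "ext_expectation M (\<lambda>x. ereal (f x)) = ereal (\<integral>x. f x \<partial>M)"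
proof -
  have fin: "(\<integral>\<^sup>+x. ennreal (f x) \<partial>M) \<noteq> \<infinity>" "(\<integral>\<^sup>+x. ennreal (- f x) \<partial>M) \<noteq> \<infinity>"
    using f by (auto simp: real_integrable_def)
  then have "enn2ereal (\<integral>\<^sup>+x. ennreal (f x) \<partial>M) = ereal (enn2real (\<integral>\<^sup>+x. ennreal (f x) \<partial>M))"
    "enn2ereal (\<integral>\<^sup>+x. ennreal (- f x) \<partial>M) = ereal (enn2real (\<integral>\<^sup>+x. ennreal (- f x) \<partial>M))"
    by (metis enn2ereal_ennreal enn2real_nonneg ennreal_enn2real infinity_ennreal_def less_top)+
  then show ?thesis
    using real_lebesgue_integral_def[OF f] by (simp add: ext_expectation_def)
qed

text \<open>\<open>M\<close> stands for the symmetric part of \<open>shifted C B\<close>. The term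
  with \<open>C_vv\<close> is twice the expected exponent left by the inner Gaussian
  integral.\<close>

definition phi :: "real^('u::finite + 'v::finite)^('u + 'v) \<Rightarrow> real^'v^'u \<Rightarrow> real^'u^'u \<Rightarrow> real" where
  "phi C A M = M \<bullet> C_uu C - ln (det M) + (transpose A ** matrix_inv M ** A) \<bullet> C_vv C - 2 * (A \<bullet> C_uv C)"

text \<open>A direction in which the form is not positive makes the inner integral infinite for
  every v, whatever \<open>A\<close> is. The negative part of the logarithm vanishes and the first
  summand is real, so no difference of infinities arises.\<close>

lemma cond_loss_infinite:
  fixes C :: "real^('u::finite + 'v::finite)^('u + 'v)"
  assumes C: "pos_def C" and M: "\<not> pos_def (symm (shifted C B))"
  shows "cond_loss C A B = \<infinity>"
proof -
  obtain x where x: "x \<noteq> 0" "x \<bullet> (symm (shifted C B) *v x) \<le> 0"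
    using M by (auto simp: pos_def_symm_iff symm_form not_less)
  have d: "det (C_uu C) > 0" by (rule pos_def_det[OF pos_def_C_uu[OF C]])
  have inf: "ext_ln (\<integral>\<^sup>+ u. ennreal (exp (- (1/2) * (u \<bullet> (B *v u)) + u \<bullet> (A *v v))) \<partial>gaussian (C_uu C)) = \<infinity>" for v
    unfolding inner_integral[OF C] nn_integral_exp_quadratic_infinite[OF x]
    using d by (auto simp: ext_ln_def ennreal_mult_top)
  have "emeasure (gaussian (C_vv C)) (space (gaussian (C_vv C))) = 1"
    by (rule prob_space.emeasure_space_1[OF prob_space_gaussian[OF pos_def_C_vv[OF C]]])
  then show ?thesis
    unfolding cond_loss_def ext_expectation_def inf by (simp add: e2ennreal_neg)
qed

lemma cond_loss_eq_phi:
  fixes C :: "real^('u::finite + 'v::finite)^('u + 'v)"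
  assumes C: "pos_def C" and M: "pos_def (symm (shifted C B))"
  shows "cond_loss C A B = ereal ((phi C A (symm (shifted C B)) - real CARD('u) - ln (det (C_uu C))) / 2)"
proof -
  let ?M = "symm (shifted C B)"
  let ?n = "(2 * pi) ^ CARD('u)"
  note P = pos_def_C_uu[OF C]
  define N where "N = transpose A ** matrix_inv ?M ** A"
  \<comment> \<open>The powers of 2 pi in the density and in the Gaussian integral cancel; only the
    two log-determinants remain.\<close>
  define k where "k = - (ln (det (C_uu C)) + ln (det ?M)) / 2"
  have dP: "det (C_uu C) > 0" and dM: "det ?M > 0" using pos_def_det P M by auto
  have n: "?n > 0" by simp
  have ln_inner: "ext_ln (\<integral>\<^sup>+ u. ennreal (exp (- (1/2) * (u \<bullet> (B *v u)) + u \<bullet> (A *v v))) \<partial>gaussian (C_uu C))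
    = ereal (k + (1/2) * (v \<bullet> (N *v v)))" for v
  proof -
    let ?I = "1 / sqrt (?n * det (C_uu C)) * (sqrt (?n / det ?M) * exp (((A *v v) \<bullet> (matrix_inv ?M *v (A *v v))) / 2))"
    have I: "?I > 0" using dP dM n by simp
    have I_eq: "(\<integral>\<^sup>+ u. ennreal (exp (- (1/2) * (u \<bullet> (B *v u)) + u \<bullet> (A *v v))) \<partial>gaussian (C_uu C)) = ennreal ?I"
      unfolding inner_integral[OF C] nn_integral_exp_quadratic[OF M]
      using dP dM n by (intro ennreal_mult[symmetric]) simp_all
    have AN: "(A *v v) \<bullet> (matrix_inv ?M *v (A *v v)) = v \<bullet> (N *v v)"
      unfolding N_def matrix_vector_mul_assoc[symmetric]
      using inner_matrix_vector[of v "transpose A" "matrix_inv ?M *v (A *v v)"] by simp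
    have ln_I: "ln ?I = k + (1/2) * (v \<bullet> (N *v v))"
    proof -
      have "ln ?I = - ln (sqrt (?n * det (C_uu C))) + (ln (sqrt (?n / det ?M))
          + ((A *v v) \<bullet> (matrix_inv ?M *v (A *v v))) / 2)"
        using dP dM n by (simp add: ln_mult ln_div)
      also have "\<dots> = k + ((A *v v) \<bullet> (matrix_inv ?M *v (A *v v))) / 2"
        using dP dM n by (simp add: k_def ln_sqrt ln_mult ln_div field_simps)
      also have "\<dots> = k + (v \<bullet> (N *v v)) / 2" by (simp only: AN)
      finally show ?thesis by (simp only: times_divide_eq_left mult_1)
    qed
    show ?thesis unfolding I_eq ext_ln_ennreal[OF I] ln_I ..
  qed
  note K = pos_def_C_vv[OF C]
  interpret V: prob_space "gaussian (C_vv C)" by (rule prob_space_gaussian[OF K])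
  have "ext_expectation (gaussian (C_vv C)) (\<lambda>v. ereal (k + (1/2) * (v \<bullet> (N *v v))))
      = ereal (\<integral>v. k + (1/2) * (v \<bullet> (N *v v)) \<partial>gaussian (C_vv C))"
    by (intro ext_expectation_ereal Bochner_Integration.integrable_add V.integrable_const
        integrable_mult_right integrable_gaussian_quadratic K)
  also have "(\<integral>v. k + (1/2) * (v \<bullet> (N *v v)) \<partial>gaussian (C_vv C)) = k + (1/2) * (N \<bullet> C_vv C)"
    by (subst Bochner_Integration.integral_add)
      (simp_all add: integrable_gaussian_quadratic[OF K] integral_gaussian_quadratic[OF K] V.prob_space)
  finally have E: "ext_expectation (gaussian (C_vv C)) (\<lambda>v. ereal (k + (1/2) * (v \<bullet> (N *v v))))
      = ereal (k + (1/2) * (N \<bullet> C_vv C))" .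
  \<comment> \<open>Passing from \<open>B\<close> to the shifted matrix adds this inner product,
    hence the dimension, to the quadratic term.\<close>
  have "matrix_inv (C_uu C) \<bullet> C_uu C = real CARD('u)"
    by (simp add: inner_eq_trace pos_def_sym[OF pos_def_inv[OF P]] matrix_inv_cancel[OF P] trace_I)
  then have B: "B \<bullet> C_uu C = ?M \<bullet> C_uu C - real CARD('u)"
    by (simp add: inner_symm pos_def_sym[OF P] shifted_def inner_add_left)
  show ?thesis
    unfolding cond_loss_def ln_inner E integral_linear_term[OF C] B
    by (simp add: phi_def N_def[symmetric] k_def field_simps)
qed

section \<open>Completing the square\<close>

text \<open>\<open>C_uv\<close> occurs in \<open>phi\<close> only through its inner product with
  \<open>A\<close>, so any \<open>S\<close> with the same inner product can be used to complete the
  square. \<open>S = C_uv C\<close> leads to the reduced objective, a projected \<open>S\<close> to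
  the bound for low rank.\<close>

lemma phi_square:
  fixes C :: "real^('u::finite + 'v::finite)^('u + 'v)"
  assumes C: "pos_def C" and M: "pos_def M" and A: "A \<bullet> C_uv C = A \<bullet> S"
  shows "phi C A M = M \<bullet> (C_uu C - S ** matrix_inv (C_vv C) ** transpose S) - ln (det M)
    + (norm (matrix_inv (mat_sqrt M) ** A ** mat_sqrt (C_vv C)
        - mat_sqrt M ** S ** matrix_inv (mat_sqrt (C_vv C))))\<^sup>2"
proof -
  let ?K = "C_vv C" let ?R = "mat_sqrt M" let ?L = "mat_sqrt ?K"
  let ?X = "matrix_inv ?R ** A ** ?L" and ?W = "?R ** S ** matrix_inv ?L"
  note K = pos_def_C_vv[OF C]
  note R = mat_sqrt[OF M] and L = mat_sqrt[OF K]
  note sym = pos_def_sym[OF R(1)] pos_def_sym[OF L(1)] pos_def_sym[OF pos_def_inv[OF R(1)]]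
    pos_def_sym[OF pos_def_inv[OF L(1)]] pos_def_sym[OF M] pos_def_sym[OF pos_def_inv[OF M]]
  have RR: "matrix_inv ?R ** matrix_inv ?R = matrix_inv M"
    by (rule matrix_inv_unique[symmetric])
      (subst (1) R(2)[symmetric], simp add: matrix_mul_assoc matrix_inv_cancel[OF R(1)])
  have LL: "matrix_inv ?L ** matrix_inv ?L = matrix_inv ?K"
    by (rule matrix_inv_unique[symmetric])
      (subst (1) L(2)[symmetric], simp add: matrix_mul_assoc matrix_inv_cancel[OF L(1)])
  have XX: "?X \<bullet> ?X = (transpose A ** matrix_inv M ** A) \<bullet> ?K"
  proof -
    have "?X \<bullet> ?X = (matrix_inv ?R ** (A ** ?L)) \<bullet> (matrix_inv ?R ** (A ** ?L))"
      by (simp only: matrix_mul_assoc)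
    also have "\<dots> = (A ** ?L) \<bullet> (matrix_inv ?R ** (matrix_inv ?R ** (A ** ?L)))"
      by (simp only: inner_matrix_mult_left[of "matrix_inv ?R" "A ** ?L"] sym)
    also have "matrix_inv ?R ** (matrix_inv ?R ** (A ** ?L)) = matrix_inv M ** A ** ?L"
      by (simp only: matrix_mul_assoc RR)
    also have "(A ** ?L) \<bullet> (matrix_inv M ** A ** ?L) = A \<bullet> (matrix_inv M ** A ** ?L ** ?L)"
      by (simp only: inner_matrix_mult_right[of A ?L] sym)
    also have "matrix_inv M ** A ** ?L ** ?L = matrix_inv M ** (A ** ?K)"
      by (simp only: L(2) flip: matrix_mul_assoc)
    also have "A \<bullet> (matrix_inv M ** (A ** ?K)) = (matrix_inv M ** A) \<bullet> (A ** ?K)"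
      by (simp only: inner_matrix_mult_left[of "matrix_inv M" A] sym)
    also have "\<dots> = (transpose A ** (matrix_inv M ** A)) \<bullet> ?K"
      by (simp only: inner_matrix_mult_left[of "transpose A"] transpose_transpose)
    finally show ?thesis by (simp only: matrix_mul_assoc)
  qed
  have XW: "?X \<bullet> ?W = A \<bullet> C_uv C"
  proof -
    have "?X \<bullet> ?W = (matrix_inv ?R ** A) \<bullet> (?W ** ?L)"
      by (simp only: inner_matrix_mult_right[of "matrix_inv ?R ** A" ?L] sym)
    also have "?W ** ?L = ?R ** S" by (rule matrix_inv_cancel(1)[OF L(1)])
    also have "(matrix_inv ?R ** A) \<bullet> (?R ** S) = A \<bullet> (matrix_inv ?R ** (?R ** S))"
      by (simp only: inner_matrix_mult_left[of "matrix_inv ?R" A] sym)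
    also have "matrix_inv ?R ** (?R ** S) = S"
      by (simp add: matrix_mul_assoc matrix_inv_cancel[OF R(1)])
    finally show ?thesis using A by simp
  qed
  have WW: "?W \<bullet> ?W = M \<bullet> (S ** matrix_inv ?K ** transpose S)"
  proof -
    have "?W \<bullet> ?W = (?R ** S) \<bullet> (?W ** matrix_inv ?L)"
      by (simp only: inner_matrix_mult_right[of "?R ** S" "matrix_inv ?L"] sym)
    also have "?W ** matrix_inv ?L = ?R ** (S ** matrix_inv ?K)"
      by (simp only: LL flip: matrix_mul_assoc)
    also have "(?R ** S) \<bullet> (?R ** (S ** matrix_inv ?K)) = (?R ** (?R ** S)) \<bullet> (S ** matrix_inv ?K)"
      by (simp only: inner_matrix_mult_left[of ?R "?R ** S"] sym)
    also have "?R ** (?R ** S) = M ** S" by (simp only: R(2) matrix_mul_assoc)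
    also have "(M ** S) \<bullet> (S ** matrix_inv ?K) = M \<bullet> (S ** matrix_inv ?K ** transpose S)"
      by (rule inner_matrix_mult_right)
    finally show ?thesis .
  qed
  have "(norm (?X - ?W))\<^sup>2 = ?X \<bullet> ?X - 2 * (?X \<bullet> ?W) + ?W \<bullet> ?W"
    by (simp add: power2_norm_eq_inner inner_diff_left inner_diff_right inner_commute)
  then show ?thesis unfolding phi_def XX XW WW by (simp add: inner_diff_right)
qed

text \<open>Multiplying by the two invertible square roots clears them, which is why the
  unconstrained optimum for \<open>A\<close> contains none.\<close>

lemma square_zero_iff:
  fixes M :: "real^'n^'n" and K :: "real^'m^'m" and A S :: "real^'m^'n"
  assumes M: "pos_def M" and K: "pos_def K"
  shows "matrix_inv (mat_sqrt M) ** A ** mat_sqrt K = mat_sqrt M ** S ** matrix_inv (mat_sqrt K)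
    \<longleftrightarrow> A = M ** S ** matrix_inv K"
proof -
  let ?R = "mat_sqrt M" let ?L = "mat_sqrt K"
  note R = mat_sqrt[OF M] and L = mat_sqrt[OF K]
  have KL: "X ** matrix_inv K ** ?L = X ** matrix_inv ?L" for X :: "real^'m^'n"
  proof -
    have "matrix_inv ?L = matrix_inv K ** ?L"
      by (rule matrix_inv_unique) (simp add: matrix_mul_assoc mat_sqrt_inv(1)[OF K])
    then show ?thesis by (simp flip: matrix_mul_assoc)
  qed
  have RM: "matrix_inv ?R ** M = ?R"
    by (subst (2) R(2)[symmetric]) (simp add: matrix_mul_assoc matrix_inv_cancel[OF R(1)])
  show ?thesis
  proof
    assume "A = M ** S ** matrix_inv K"
    then show "matrix_inv ?R ** A ** ?L = ?R ** S ** matrix_inv ?L"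
      by (simp add: matrix_mul_assoc KL RM)
  next
    assume eq: "matrix_inv ?R ** A ** ?L = ?R ** S ** matrix_inv ?L"
    have "A = ?R ** (matrix_inv ?R ** A ** ?L) ** matrix_inv ?L"
      by (simp add: matrix_mul_assoc matrix_inv_cancel[OF R(1)] matrix_inv_cancel[OF L(1)])
    also have "\<dots> = (?R ** ?R) ** S ** (matrix_inv ?L ** matrix_inv ?L)"
      unfolding eq by (simp only: matrix_mul_assoc)
    also have "matrix_inv ?L ** matrix_inv ?L = matrix_inv K"
      by (rule matrix_inv_unique[symmetric])
        (subst (1) L(2)[symmetric], simp add: matrix_mul_assoc matrix_inv_cancel[OF L(1)])
    finally show "A = M ** S ** matrix_inv K" by (simp only: R(2))
  qed
qed

text \<open>The Woodbury identity for the inverse of the Schur complement, checked by multiplying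
  the candidate by \<open>C_u_given_v C\<close>.\<close>

lemma shifted_B_opt:
  fixes C :: "real^('u::finite + 'v::finite)^('u + 'v)"
  assumes C: "pos_def C"
  shows "shifted C (matrix_inv (C_uu C) ** C_uv C ** matrix_inv (C_v_given_u C) ** C_vu C ** matrix_inv (C_uu C))
    = matrix_inv (C_u_given_v C)"
proof -
  define P where "P = matrix_inv (C_uu C)"
  define K where "K = C_vv C"
  define S where "S = C_uv C"
  define T where "T = C_vu C"
  define F where "F = C_v_given_u C"
  note U = pos_def_C_uu[OF C] and V = pos_def_C_vv[OF C] and Fpos = pos_def_C_v_given_u[OF C, folded F_def]
  have cancel: "X ** C_uu C ** P = X" "C_uu C ** P = mat 1" for X :: "real^'u^'p"
    using matrix_inv_cancel[OF U] by (simp_all add: P_def)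
  have F: "T ** P ** S = K - F" by (simp add: F_def C_v_given_u_def T_def P_def S_def K_def)
  define Z where "Z = matrix_inv F ** T ** P"
  have FZ: "F ** Z = T ** P"
    by (simp add: Z_def matrix_mul_assoc matrix_inv_cancel[OF Fpos])
  have "T ** P ** S ** Z = K ** Z - T ** P"
    by (simp add: F matrix_diff_rdistrib FZ)
  then have "matrix_inv K ** (T ** P ** S ** Z) = Z - matrix_inv K ** (T ** P)"
    by (simp add: matrix_diff_ldistrib matrix_mul_assoc matrix_inv_cancel[OF V, folded K_def])
  then have KZ: "S ** matrix_inv K ** T ** P ** S ** Z = S ** Z - S ** matrix_inv K ** T ** P"
    by (metis matrix_diff_ldistrib matrix_mul_assoc)
  have "C_u_given_v C ** (P ** S ** Z + P) = mat 1"
    unfolding C_u_given_v_def P_def[symmetric] K_def[symmetric] S_def[symmetric] T_def[symmetric]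
    by (simp add: matrix_add_ldistrib matrix_diff_rdistrib matrix_mul_assoc cancel KZ)
  then have "matrix_inv (C_u_given_v C) = P ** S ** Z + P" by (rule matrix_inv_unique)
  then show ?thesis
    by (simp add: shifted_def Z_def P_def S_def T_def F_def matrix_mul_assoc)
qed

section \<open>Attainment of the rank-constrained minimum\<close>

lemma continuous_on_matrix_mult [continuous_intros]:
  fixes f :: "'a::topological_space \<Rightarrow> real^'n^'m" and g :: "'a \<Rightarrow> real^'p^'n"
  assumes "continuous_on X f" "continuous_on X g"
  shows "continuous_on X (\<lambda>x. f x ** g x)"
  unfolding matrix_matrix_mult_def using assms
  by (intro continuous_on_vec_lambda continuous_intros)

lemma continuous_on_transpose [continuous_intros]:
  fixes f :: "'a::topological_space \<Rightarrow> real^'n^'m"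
  assumes "continuous_on X f"
  shows "continuous_on X (\<lambda>x. transpose (f x))"
  unfolding transpose_def using assms
  by (intro continuous_on_vec_lambda continuous_intros)

lemma continuous_on_det [continuous_intros]:
  fixes f :: "'a::topological_space \<Rightarrow> real^'n^'n"
  assumes "continuous_on X f"
  shows "continuous_on X (\<lambda>x. det (f x))"
  unfolding det_def using assms by (intro continuous_intros)

lemma continuous_on_trace [continuous_intros]:
  fixes f :: "'a::topological_space \<Rightarrow> real^'n^'n"
  assumes "continuous_on X f"
  shows "continuous_on X (\<lambda>x. trace (f x))"
  unfolding trace_def using assms by (intro continuous_intros)

text \<open>The squared norm of a projection is its trace, which gives boundedness; symmetry,
  idempotence and the trace bound are closed conditions.\<close>

lemma compact_orth_proj: "compact {E :: real^'n^'n. orth_proj E \<and> trace E \<le> c}"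
proof -
  let ?G = "{E :: real^'n^'n. orth_proj E \<and> trace E \<le> c}"
  have "norm E \<le> sqrt c" if "E \<in> ?G" for E
  proof -
    have "(norm E)\<^sup>2 = trace E"
      using that by (simp add: orth_proj_def power2_norm_eq_inner inner_eq_trace)
    then show ?thesis using that by (simp add: real_le_rsqrt)
  qed
  then have "bounded ?G" by (intro boundedI)
  have G_eq: "?G = {E. transpose E = E} \<inter> {E. E ** E = E} \<inter> {E. trace E \<le> c}"
    by (auto simp: orth_proj_def)
  have "closed ?G"
    unfolding G_eq by (intro closed_Int closed_Collect_eq closed_Collect_le continuous_intros)
  with \<open>bounded ?G\<close> show ?thesis by (simp add: compact_eq_bounded_closed)
qed

lemma rank_mult_middle: "rank (A ** B ** C) \<le> rank B"
  for A :: "real^'n^'m" and B :: "real^'p^'n" and C :: "real^'q^'p"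
  by (rule order_trans[OF rank_mul_le_left rank_mul_le_right])

lemma phi_rank_minimum:
  fixes C :: "real^('u::finite + 'v::finite)^('u + 'v)"
  assumes C: "pos_def C"
  obtains A0 :: "real^'v^'u" and M0 :: "real^'u^'u" where
    "pos_def M0" "rank A0 \<le> r" "rank (M0 - matrix_inv (C_uu C)) \<le> r"
    "\<And>A M. pos_def M \<Longrightarrow> rank A \<le> r \<Longrightarrow> phi C A0 M0 \<le> phi C A M"
proof -
  let ?n = "real CARD('u)"
  define U where "U = C_uu C"
  define K where "K = C_vv C"
  define S where "S = C_uv C"
  define H where "H = mat_sqrt U"
  define Hi where "Hi = matrix_inv H"
  have U: "pos_def U" and K: "pos_def K" by (simp_all add: U_def K_def pos_def_C_uu pos_def_C_vv C)
  have D: "pos_def (U - S ** matrix_inv K ** transpose S)"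
    using pos_def_C_u_given_v[OF C] by (simp add: C_u_given_v_def U_def K_def S_def C_vu_transpose[OF C])
  have H: "pos_def H" "H ** H = U" using mat_sqrt[OF U] by (simp_all add: H_def)
  have symH: "transpose H = H" "transpose Hi = Hi"
    using pos_def_sym[OF H(1)] pos_def_sym[OF pos_def_inv[OF H(1)]] by (simp_all add: Hi_def)
  have cH: "X ** H ** Hi = X" "X ** Hi ** H = X" "H ** Hi = mat 1" "Hi ** H = mat 1" for X :: "real^'u^'p"
    using matrix_inv_cancel[OF H(1)] by (simp_all add: Hi_def)
  \<comment> \<open>In coordinates that whiten u, this is \<open>E\<close> applied to the whitened
    cross covariance \<open>Hi ** S\<close>.\<close>
  define SE where "SE E = H ** E ** Hi ** S" for E
  define DE where "DE E = U - SE E ** matrix_inv K ** transpose (SE E)" for E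
  define G where "G = {E :: real^'u^'u. orth_proj E \<and> trace E \<le> real r}"
  \<comment> \<open>Projecting only shrinks the explained part. For y = Hi E H x the forms satisfy y
    . U y \<le> x . U x, so strict positivity of the conditional covariance at y carries over to x;
    y = 0 falls back on positivity of \<open>U\<close>.\<close>
  have DE: "pos_def (DE E)" if "E \<in> G" for E
  proof -
    have E: "transpose E = E" "E ** E = E" using that by (simp_all add: G_def orth_proj_def)
    have "0 < x \<bullet> (DE E *v x)" if "x \<noteq> 0" for x
    proof -
      define z where "z = H *v x"
      define y where "y = Hi *v (E *v z)"
      have tSE: "transpose (SE E) = transpose S ** Hi ** E ** H"
        by (simp add: SE_def matrix_transpose_mul symH E matrix_mul_assoc)
      have ty: "transpose (SE E) *v x = transpose S *v y"
        by (simp only: tSE y_def z_def matrix_vector_mul_assoc matrix_mul_assoc)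
      have "x \<bullet> ((SE E ** matrix_inv K ** transpose (SE E)) *v x)
          = (transpose (SE E) *v x) \<bullet> (matrix_inv K *v (transpose (SE E) *v x))"
        unfolding matrix_vector_mul_assoc[symmetric] by (rule inner_matrix_vector)
      also have "\<dots> = y \<bullet> ((S ** matrix_inv K ** transpose S) *v y)"
        unfolding ty matrix_vector_mul_assoc[symmetric] by (rule inner_matrix_vector[symmetric])
      finally have DEx: "x \<bullet> (DE E *v x) = x \<bullet> (U *v x) - y \<bullet> ((S ** matrix_inv K ** transpose S) *v y)"
        by (simp only: DE_def matrix_vector_mult_diff_rdistrib inner_diff_right)
      have form: "v \<bullet> (U *v v) = (H *v v) \<bullet> (H *v v)" for v
        unfolding H(2)[symmetric] matrix_vector_mul_assoc[symmetric]
        by (simp only: symmetric_matrix_inner[OF symH(1)])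
      show ?thesis
      proof (cases "y = 0")
        case True
        then show ?thesis using DEx pos_defD[OF U \<open>x \<noteq> 0\<close>] by simp
      next
        case False
        have "0 < y \<bullet> ((U - S ** matrix_inv K ** transpose S) *v y)" by (rule pos_defD[OF D False])
        then have "y \<bullet> ((S ** matrix_inv K ** transpose S) *v y) < y \<bullet> (U *v y)"
          by (simp add: matrix_vector_mult_diff_rdistrib inner_diff_right)
        also have "y \<bullet> (U *v y) = (E *v z) \<bullet> (E *v z)"
          unfolding form by (simp add: y_def matrix_vector_mul_assoc matrix_mul_assoc cH)
        also have "\<dots> \<le> z \<bullet> z"
        proof -
          have Ez: "(E *v z) \<bullet> (E *v z) = z \<bullet> (E *v z)"
            by (simp add: symmetric_matrix_inner[OF E(1)] matrix_vector_mul_assoc E)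
          have "0 \<le> (z - E *v z) \<bullet> (z - E *v z)" by simp
          also have "\<dots> = z \<bullet> z - (E *v z) \<bullet> (E *v z)"
            by (simp add: inner_diff_left inner_diff_right Ez inner_commute)
          finally show ?thesis by simp
        qed
        also have "z \<bullet> z = x \<bullet> (U *v x)" by (simp add: form z_def)
        finally show ?thesis using DEx by simp
      qed
    qed
    moreover have "transpose (DE E) = DE E"
      by (simp add: DE_def transpose_diff matrix_transpose_mul pos_def_sym[OF U]
          pos_def_sym[OF pos_def_inv[OF K]] matrix_mul_assoc)
    ultimately show ?thesis by (simp add: pos_def_def)
  qed
  \<comment> \<open>\<open>E\<close> projects onto the range of \<open>H ** A\<close> and is chosen
    without reference to \<open>M\<close>, which is then eliminated by the log-det
    inequality.\<close>
  have lower: "\<exists>E\<in>G. ?n + ln (det (DE E)) \<le> phi C A M" if M: "pos_def M" and A: "rank A \<le> r" for A M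
  proof -
    obtain E where E: "orth_proj E" "E ** (H ** A) = H ** A" "rank E = rank (H ** A)"
      using orth_proj_range_exists by metis
    have "rank E \<le> r" using E(3) A rank_mul_le_right[of H A] by simp
    then have EG: "E \<in> G" using E(1) orth_proj_rank[OF E(1)] by (simp add: G_def)
    have "A \<bullet> SE E = (Hi ** E ** H ** A) \<bullet> S"
      using E(1) unfolding inner_matrix_mult_left
      by (simp add: SE_def matrix_transpose_mul symH orth_proj_def matrix_mul_assoc)
    also have "Hi ** E ** H ** A = Hi ** (E ** (H ** A))" by (simp only: matrix_mul_assoc)
    also have "\<dots> = Hi ** (H ** A)" by (simp only: E(2))
    also have "\<dots> = A" by (simp add: matrix_mul_assoc cH)
    finally have "A \<bullet> C_uv C = A \<bullet> SE E" by (simp add: S_def)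
    from phi_square[OF C M this] have "M \<bullet> DE E - ln (det M) \<le> phi C A M"
      by (simp add: DE_def U_def K_def)
    with inner_minus_ln_det(1)[OF M DE[OF EG]] EG show ?thesis by force
  qed
  have "compact G" unfolding G_def by (rule compact_orth_proj)
  moreover have "0 \<in> G" by (simp add: G_def orth_proj_def trace_def transpose_def vec_eq_iff)
  then have "G \<noteq> {}" by blast
  moreover have "continuous_on G (\<lambda>E. det (DE E))"
    unfolding DE_def SE_def by (intro continuous_intros)
  ultimately obtain E where E: "E \<in> G" and min: "\<And>E'. E' \<in> G \<Longrightarrow> det (DE E) \<le> det (DE E')"
    using continuous_attains_inf by metis
  \<comment> \<open>\<open>M0\<close> is the equality case of the log-det inequality, and
    \<open>A0\<close> makes the completed square vanish.\<close>
  define M0 where "M0 = matrix_inv (DE E)"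
  define A0 where "A0 = M0 ** SE E ** matrix_inv K"
  note D0 = DE[OF E]
  have M0: "pos_def M0" unfolding M0_def by (rule pos_def_inv[OF D0])
  have rE: "rank E \<le> r" and EE: "E ** E = E" and Esym: "transpose E = E"
    using E orth_proj_rank[of E] by (auto simp: G_def orth_proj_def)
  have "rank (SE E) \<le> rank E"
    using rank_mult_middle[of H E "Hi ** S"] by (simp add: SE_def matrix_mul_assoc)
  then have rS: "rank (SE E) \<le> r" using rE by simp
  have rA: "rank A0 \<le> r"
    unfolding A0_def by (rule order_trans[OF rank_mult_middle rS])
  have P: "matrix_inv U ** U = mat 1" "DE E ** M0 = mat 1"
    using matrix_inv_cancel[OF U] matrix_inv_cancel[OF D0] by (simp_all add: M0_def)
  \<comment> \<open>Resolvent identity: the difference of the inverses contains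
    \<open>U - DE E\<close>, which factors through \<open>SE E\<close>.\<close>
  have "M0 - matrix_inv U = matrix_inv U ** (U - DE E) ** M0"
    by (simp add: matrix_diff_ldistrib matrix_diff_rdistrib P matrix_mul_assoc[symmetric, of _ "DE E"])
  also have "U - DE E = SE E ** (matrix_inv K ** transpose (SE E))"
    by (simp add: DE_def matrix_mul_assoc)
  also have "rank (matrix_inv U ** (SE E ** (matrix_inv K ** transpose (SE E))) ** M0) \<le> rank (SE E)"
    by (rule order_trans[OF rank_mult_middle rank_mul_le_left])
  finally have rB: "rank (M0 - matrix_inv U) \<le> r" using rS by simp
  \<comment> \<open>The bound is attained only if \<open>E\<close> fixes \<open>H ** A0\<close>.
    Rearranging \<open>DE E ** A0 = SE E ** matrix_inv K\<close> writes \<open>U ** A0\<close> as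
    \<open>H ** E\<close> times a matrix, and cancelling one \<open>H\<close> gives exactly
    this.\<close>
  have A0S: "A0 \<bullet> C_uv C = A0 \<bullet> SE E"
  proof -
    have "DE E ** A0 = SE E ** matrix_inv K"
      by (simp add: A0_def P matrix_mul_assoc)
    then have "U ** A0 = SE E ** matrix_inv K + SE E ** matrix_inv K ** transpose (SE E) ** A0"
      by (simp add: DE_def matrix_diff_rdistrib algebra_simps)
    then have "H ** (H ** A0) = H ** (E ** (Hi ** S ** (matrix_inv K + matrix_inv K ** transpose (SE E) ** A0)))"
      by (simp add: H(2)[symmetric] SE_def matrix_add_ldistrib matrix_mul_assoc)
    then have "Hi ** (H ** (H ** A0)) = Hi ** (H ** (E ** (Hi ** S ** (matrix_inv K + matrix_inv K ** transpose (SE E) ** A0))))"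
      by simp
    then have "H ** A0 = E ** (Hi ** S ** (matrix_inv K + matrix_inv K ** transpose (SE E) ** A0))"
      by (simp add: matrix_mul_assoc cH)
    then have EHA: "E ** (H ** A0) = H ** A0"
      by (simp add: matrix_mul_assoc EE)
    have "A0 \<bullet> SE E = (Hi ** E ** H ** A0) \<bullet> S"
      unfolding inner_matrix_mult_left
      by (simp add: SE_def matrix_transpose_mul symH Esym matrix_mul_assoc)
    also have "Hi ** E ** H ** A0 = Hi ** (E ** (H ** A0))" by (simp only: matrix_mul_assoc)
    also have "\<dots> = Hi ** (H ** A0)" by (simp only: EHA)
    also have "\<dots> = A0" by (simp add: matrix_mul_assoc cH)
    finally show ?thesis by (simp add: S_def)
  qed
  have zero: "matrix_inv (mat_sqrt M0) ** A0 ** mat_sqrt K = mat_sqrt M0 ** SE E ** matrix_inv (mat_sqrt K)"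
    unfolding square_zero_iff[OF M0 K] by (rule A0_def)
  have "M0 \<bullet> DE E = ?n"
    by (simp add: inner_eq_trace pos_def_sym[OF M0] trace_mul_sym[of M0] P trace_I)
  moreover have "det M0 * det (DE E) = 1"
    using P(2) by (metis det_I det_mul mult.commute)
  then have "ln (det M0) = - ln (det (DE E))"
    using pos_def_det[OF M0] pos_def_det[OF D0] by (metis add_eq_0_iff2 ln_mult_pos ln_one)
  ultimately have "phi C A0 M0 = ?n + ln (det (DE E))"
    using phi_square[OF C M0 A0S, folded U_def K_def] zero by (simp add: DE_def)
  moreover have "ln (det (DE E)) \<le> ln (det (DE E'))" if "E' \<in> G" for E'
    using min[OF that] pos_def_det[OF D0] pos_def_det[OF DE[OF that]] by simp
  ultimately have "phi C A0 M0 \<le> phi C A M" if "pos_def M" "rank A \<le> r" for A M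
    using lower[OF that] by force
  with M0 rA rB show ?thesis using that by (simp add: U_def)
qed

section \<open>The minimizers\<close>

text \<open>Moves minimality from the extended-real loss to \<open>phi\<close>. The witness has
  finite loss, so no point with infinite loss can be a minimiser.\<close>

lemma cond_loss_arg_min_iff:
  fixes C :: "real^('u::finite + 'v::finite)^('u + 'v)"
  assumes C: "pos_def C"
    and Q0: "Q (A0, B0)" and pos0: "pos_def (symm (shifted C B0))" and m0: "phi C A0 (symm (shifted C B0)) = m"
    and lower: "\<And>A B. Q (A, B) \<Longrightarrow> pos_def (symm (shifted C B)) \<Longrightarrow> m \<le> phi C A (symm (shifted C B))"
  shows "is_arg_min (\<lambda>(A, B). cond_loss C A B) Q (A, B) \<longleftrightarrow>
    Q (A, B) \<and> pos_def (symm (shifted C B)) \<and> phi C A (symm (shifted C B)) = m"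
proof -
  define c where "c = (m - real CARD('u) - ln (det (C_uu C))) / 2"
  have loss0: "cond_loss C A0 B0 = ereal c"
    using cond_loss_eq_phi[OF C pos0] m0 by (simp add: c_def)
  have ge: "ereal c \<le> cond_loss C A' B'" if "Q (A', B')" for A' B'
  proof (cases "pos_def (symm (shifted C B'))")
    case True
    then show ?thesis using lower[OF that True] cond_loss_eq_phi[OF C True] by (simp add: c_def)
  next
    case False
    then show ?thesis using cond_loss_infinite[OF C] by simp
  qed
  have "is_arg_min (\<lambda>(A, B). cond_loss C A B) Q (A, B) \<longleftrightarrow> Q (A, B) \<and> cond_loss C A B = ereal c"
  proof
    assume min: "is_arg_min (\<lambda>(A, B). cond_loss C A B) Q (A, B)"
    then have Q: "Q (A, B)" and "\<not> cond_loss C A0 B0 < cond_loss C A B"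
      using Q0 by (auto simp: is_arg_min_def)
    then have "cond_loss C A B \<le> ereal c" by (simp add: loss0 not_less)
    with ge[OF Q] Q show "Q (A, B) \<and> cond_loss C A B = ereal c" by simp
  next
    assume "Q (A, B) \<and> cond_loss C A B = ereal c"
    then show "is_arg_min (\<lambda>(A, B). cond_loss C A B) Q (A, B)"
      using ge by (auto simp: is_arg_min_def not_less)
  qed
  also have "\<dots> \<longleftrightarrow> Q (A, B) \<and> pos_def (symm (shifted C B)) \<and> phi C A (symm (shifted C B)) = m"
  proof (cases "pos_def (symm (shifted C B))")
    case True
    then show ?thesis using cond_loss_eq_phi[OF C True] by (simp add: c_def)
  next
    case False
    then show ?thesis using cond_loss_infinite[OF C False] by simp
  qed
  finally show ?thesis .
qed

lemma phi_square_whitened: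
  fixes C :: "real^('u::finite + 'v::finite)^('u + 'v)"
  assumes C: "pos_def C" and M: "pos_def M"
  shows "phi C A M = M \<bullet> C_u_given_v C - ln (det M)
    + (norm (matrix_inv (mat_sqrt M) ** A ** mat_sqrt (C_vv C)
        - mat_sqrt M ** C_uv C ** matrix_inv (mat_sqrt (C_vv C))))\<^sup>2"
  unfolding phi_square[OF C M refl] by (simp add: C_u_given_v_def C_vu_transpose[OF C])

text \<open>The excess over \<open>m\<close> is the sum of the log-det divergence and the completed
  square, both nonnegative; equality makes both vanish.\<close>

lemma phi_global_minimum:
  fixes C :: "real^('u::finite + 'v::finite)^('u + 'v)"
  assumes C: "pos_def C" and M: "pos_def M"
  defines "m \<equiv> real CARD('u) + ln (det (C_u_given_v C))"
  shows "m \<le> phi C A M"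
    and "phi C A M = m \<longleftrightarrow> M = matrix_inv (C_u_given_v C) \<and>
      A = matrix_inv (C_u_given_v C) ** C_uv C ** matrix_inv (C_vv C)"
proof -
  let ?D = "C_u_given_v C"
  note D = pos_def_C_u_given_v[OF C] and K = pos_def_C_vv[OF C]
  let ?q = "norm (matrix_inv (mat_sqrt M) ** A ** mat_sqrt (C_vv C)
        - mat_sqrt M ** C_uv C ** matrix_inv (mat_sqrt (C_vv C)))"
  have phi: "phi C A M = (M \<bullet> ?D - ln (det M)) + ?q\<^sup>2"
    by (rule phi_square_whitened[OF C M])
  have le: "m \<le> M \<bullet> ?D - ln (det M)"
    unfolding m_def by (rule inner_minus_ln_det(1)[OF M D])
  show "m \<le> phi C A M" using le phi zero_le_power2[of ?q] by linarith
  have eq: "M \<bullet> ?D - ln (det M) = m \<longleftrightarrow> M = matrix_inv ?D"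
  proof
    assume "M \<bullet> ?D - ln (det M) = m"
    then have "M ** ?D = mat 1" unfolding m_def by (rule inner_minus_ln_det(2)[OF M D])
    then have "?D ** M = mat 1" by (simp add: matrix_left_right_inverse)
    then show "M = matrix_inv ?D" by (rule matrix_inv_unique[symmetric])
  next
    assume M_eq: "M = matrix_inv ?D"
    then have MD: "M ** ?D = mat 1" by (simp add: matrix_inv_cancel[OF D])
    then have "M \<bullet> ?D = real CARD('u)"
      by (simp add: inner_eq_trace pos_def_sym[OF M] trace_I)
    moreover have "det M * det ?D = 1" using MD by (metis det_I det_mul)
    then have "ln (det M) + ln (det ?D) = 0"
      using pos_def_det[OF M] pos_def_det[OF D] by (metis ln_mult_pos ln_one)
    ultimately show "M \<bullet> ?D - ln (det M) = m" by (simp add: m_def)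
  qed
  have "phi C A M = m \<longleftrightarrow> M \<bullet> ?D - ln (det M) = m \<and> ?q\<^sup>2 = 0"
    using le zero_le_power2[of ?q] unfolding phi by linarith
  also have "?q\<^sup>2 = 0 \<longleftrightarrow> A = M ** C_uv C ** matrix_inv (C_vv C)"
    using square_zero_iff[OF M K, of A "C_uv C"] by simp
  finally show "phi C A M = m \<longleftrightarrow> M = matrix_inv ?D \<and> A = matrix_inv ?D ** C_uv C ** matrix_inv (C_vv C)"
    unfolding eq by blast
qed

lemma symm_shifted:
  assumes "pos_def C" "transpose B = B"
  shows "symm (shifted C B) = shifted C B"
  using assms(2) pos_def_sym[OF pos_def_inv[OF pos_def_C_uu[OF assms(1)]]]
  by (intro symm_id) (simp add: shifted_def transpose_add)

lemma transpose_eq_if_shifted: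
  assumes C: "pos_def C" and "pos_def (shifted C B)"
  shows "transpose B = B"
proof -
  have "transpose B + matrix_inv (C_uu C) = B + matrix_inv (C_uu C)"
    using pos_def_sym[OF assms(2)] pos_def_sym[OF pos_def_inv[OF pos_def_C_uu[OF C]]]
    by (simp add: shifted_def transpose_add)
  then show ?thesis by simp
qed

text \<open>Uniqueness is claimed among symmetric \<open>B\<close>, because the loss cannot
  distinguish matrices with the same symmetric part.\<close>

lemma cond_loss_minimizer:
  fixes C :: "real^('u::finite + 'v::finite)^('u + 'v)"
  assumes C: "pos_def C"
  defines "A_opt \<equiv> matrix_inv (C_u_given_v C) ** C_uv C ** matrix_inv (C_vv C)"
    and "B_opt \<equiv> matrix_inv (C_uu C) ** C_uv C ** matrix_inv (C_v_given_u C) ** C_vu C ** matrix_inv (C_uu C)"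
  shows "is_arg_min (\<lambda>(A, B). cond_loss C A B) (\<lambda>_. True) (A_opt, B_opt)"
    and "is_arg_min (\<lambda>(A, B). cond_loss C A B) (\<lambda>_. True) (A, B) \<Longrightarrow> transpose B = B \<Longrightarrow>
      A = A_opt \<and> B = B_opt"
proof -
  let ?Di = "matrix_inv (C_u_given_v C)"
  have Di: "pos_def ?Di" by (rule pos_def_inv[OF pos_def_C_u_given_v[OF C]])
  have sh: "shifted C B_opt = ?Di" unfolding B_opt_def by (rule shifted_B_opt[OF C])
  then have sy: "symm (shifted C B_opt) = ?Di" by (simp add: symm_id pos_def_sym[OF Di])
  have phi: "phi C A_opt ?Di = real CARD('u) + ln (det (C_u_given_v C))"
    unfolding phi_global_minimum(2)[OF C Di] A_opt_def by simp
  have iff: "is_arg_min (\<lambda>(A, B). cond_loss C A B) (\<lambda>_. True) (A, B) \<longleftrightarrow>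
    True \<and> pos_def (symm (shifted C B)) \<and>
      phi C A (symm (shifted C B)) = real CARD('u) + ln (det (C_u_given_v C))" for A B
    by (rule cond_loss_arg_min_iff[OF C, where Q="\<lambda>_. True" and ?A0.0=A_opt and ?B0.0=B_opt])
      (use Di phi phi_global_minimum(1)[OF C] in \<open>simp_all add: sy\<close>)
  show "is_arg_min (\<lambda>(A, B). cond_loss C A B) (\<lambda>_. True) (A_opt, B_opt)"
    unfolding iff sy using Di phi by simp
  assume min: "is_arg_min (\<lambda>(A, B). cond_loss C A B) (\<lambda>_. True) (A, B)" and sym: "transpose B = B"
  from min have "pos_def (shifted C B)" "phi C A (shifted C B) = real CARD('u) + ln (det (C_u_given_v C))"
    unfolding iff symm_shifted[OF C sym] by auto
  then have "shifted C B = shifted C B_opt" "A = A_opt"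
    using phi_global_minimum(2)[OF C] by (auto simp: A_opt_def sh)
  then show "A = A_opt \<and> B = B_opt" by (simp add: shifted_def)
qed

text \<open>At fixed shifted matrix the choice of \<open>A\<close> is a best-approximation problem
  for the whitened cross covariance. A pair is optimal exactly when its \<open>B\<close> minimises
  what remains and its \<open>A\<close> solves that problem.\<close>

lemma rank_constrained_minimizers:
  fixes C :: "real^('u::finite + 'v::finite)^('u + 'v)"
  assumes C: "pos_def C" and r: "r \<le> min CARD('u) CARD('v)"
  shows "\<exists>B. is_arg_min (reduced_objective r C) (\<lambda>B. rank B \<le> r) B"
    and "is_arg_min (\<lambda>(A, B). cond_loss C A B) (\<lambda>(A, B). rank A \<le> r \<and> rank B \<le> r) (A, B) \<and> transpose B = B
      \<longleftrightarrow> is_arg_min (reduced_objective r C) (\<lambda>B. rank B \<le> r) B \<and>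
        (\<exists>T. is_svd_trunc r (whitened C B) T \<and>
          A = mat_sqrt (shifted C B) ** T ** matrix_inv (mat_sqrt (C_vv C)))"
proof -
  let ?D = "C_u_given_v C" and ?L = "mat_sqrt (C_vv C)"
  note D = pos_def_C_u_given_v[OF C] and L = pos_def_mat_sqrt[OF pos_def_C_vv[OF C]]
  obtain A0 :: "real^'v^'u" and M0 where M0: "pos_def M0" and rA0: "rank A0 \<le> r"
    and rM0: "rank (M0 - matrix_inv (C_uu C)) \<le> r"
    and min0: "\<And>A M. pos_def M \<Longrightarrow> rank A \<le> r \<Longrightarrow> phi C A0 M0 \<le> phi C A M"
    using phi_rank_minimum[OF C] by metis
  define B0 where "B0 = M0 - matrix_inv (C_uu C)"
  have B0: "shifted C B0 = M0" by (simp add: B0_def shifted_def)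
  define m where "m = phi C A0 M0"
  define X where "X A M = matrix_inv (mat_sqrt M) ** A ** ?L" for A :: "real^'v^'u" and M
  define W where "W M = mat_sqrt M ** C_uv C ** matrix_inv ?L" for M :: "real^'u^'u"
  have W: "whitened C B = W (shifted C B)" for B by (simp add: whitened_def W_def)
  \<comment> \<open>The value of \<open>phi\<close> minimised over \<open>A\<close> of rank at most
    \<open>r\<close>: passing from \<open>A\<close> to \<open>X A M\<close> multiplies by invertible
    matrices and so keeps the rank.\<close>
  define psi where "psi M = M \<bullet> ?D - ln (det M) + (norm (svd_trunc r (W M) - W M))\<^sup>2" for M
  have phi: "phi C A M = M \<bullet> ?D - ln (det M) + (norm (X A M - W M))\<^sup>2" if "pos_def M" for A M
    unfolding X_def W_def by (rule phi_square_whitened[OF C that])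
  have rX: "rank (X A M) \<le> rank A" for A M
    unfolding X_def by (rule rank_mult_middle)
  have X_eq: "X A M = T \<longleftrightarrow> A = mat_sqrt M ** T ** matrix_inv ?L" if "pos_def M" for A T M
    by (auto simp: X_def matrix_mul_assoc matrix_inv_cancel[OF pos_def_mat_sqrt[OF that]]
        matrix_inv_cancel[OF L])
  note opt = is_svd_trunc_optimal[OF svd_trunc_is_svd_trunc r]
  have psi_le: "psi M \<le> phi C A M" if "pos_def M" "rank A \<le> r" for A M
    unfolding phi[OF that(1)] psi_def
    using opt(2)[of "X A M" "W M"] rX[of A M] that(2) by (simp add: power_mono)
  \<comment> \<open>\<open>min0\<close> holds for every positive definite \<open>M\<close>, with no
    rank condition on the associated \<open>B\<close>; this is where the bound on \<open>B\<close>
    is seen not to raise the minimum.\<close>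
  have psi_ge: "m \<le> psi M" if M: "pos_def M" for M
  proof -
    define A where "A = mat_sqrt M ** svd_trunc r (W M) ** matrix_inv ?L"
    have "X A M = svd_trunc r (W M)" unfolding X_eq[OF M] by (rule A_def)
    then have "psi M = phi C A M" by (simp add: phi[OF M] psi_def)
    moreover have "rank A \<le> r" unfolding A_def by (rule order_trans[OF rank_mult_middle opt(1)])
    ultimately show ?thesis unfolding m_def using min0[OF M] by simp
  qed
  have psi0: "psi M0 = m"
    using psi_le[OF M0 rA0] psi_ge[OF M0] by (simp add: m_def)
  \<comment> \<open>The determinant of the product splits, so the two objectives differ by a
    constant and have the same minimisers.\<close>
  have red: "reduced_objective r C B = ereal (psi (shifted C B) - ln (det ?D))" if "pos_def (shifted C B)" for B
    using that pos_def_det[OF that] pos_def_det[OF D]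
    by (simp add: reduced_objective_def psi_def W inner_eq_trace pos_def_sym[OF that] det_mul ln_mult_pos)
  have red_inf: "reduced_objective r C B = \<infinity>" if "\<not> pos_def (shifted C B)" for B
    using that by (simp add: reduced_objective_def)
  have red_ge: "ereal (m - ln (det ?D)) \<le> reduced_objective r C B" for B
    using red[of B] red_inf[of B] psi_ge[of "shifted C B"] by (cases "pos_def (shifted C B)") auto
  have red0: "reduced_objective r C B0 = ereal (m - ln (det ?D))"
    using red[of B0] M0 psi0 by (simp add: B0)
  have red_iff: "is_arg_min (reduced_objective r C) (\<lambda>B. rank B \<le> r) B \<longleftrightarrow>
      rank B \<le> r \<and> pos_def (shifted C B) \<and> psi (shifted C B) = m" for B
  proof
    assume "is_arg_min (reduced_objective r C) (\<lambda>B. rank B \<le> r) B"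
    then have rB: "rank B \<le> r" and "reduced_objective r C B \<le> ereal (m - ln (det ?D))"
      using rM0 red0 by (auto simp: is_arg_min_def not_less B0_def)
    with red_ge[of B] have eq: "reduced_objective r C B = ereal (m - ln (det ?D))" by simp
    then have "pos_def (shifted C B)" using red_inf[of B] by auto
    with eq rB red[of B] show "rank B \<le> r \<and> pos_def (shifted C B) \<and> psi (shifted C B) = m" by simp
  next
    assume "rank B \<le> r \<and> pos_def (shifted C B) \<and> psi (shifted C B) = m"
    then show "is_arg_min (reduced_objective r C) (\<lambda>B. rank B \<le> r) B"
      using red[of B] red_ge by (simp add: is_arg_min_def not_less)
  qed
  have "is_arg_min (reduced_objective r C) (\<lambda>B. rank B \<le> r) B0"
    unfolding red_iff B0 using rM0 M0 psi0 by (simp add: B0_def)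
  then show "\<exists>B. is_arg_min (reduced_objective r C) (\<lambda>B. rank B \<le> r) B" ..
  have sy0: "symm (shifted C B0) = M0" by (simp add: B0 symm_id pos_def_sym[OF M0])
  have loss_iff: "is_arg_min (\<lambda>(A, B). cond_loss C A B) (\<lambda>(A, B). rank A \<le> r \<and> rank B \<le> r) (A, B) \<longleftrightarrow>
      (rank A \<le> r \<and> rank B \<le> r) \<and> pos_def (symm (shifted C B)) \<and> phi C A (symm (shifted C B)) = m"
  proof -
    have "(case (A0, B0) of (A, B) \<Rightarrow> rank A \<le> r \<and> rank B \<le> r)"
      using rA0 rM0 by (simp add: B0_def)
    then have "is_arg_min (\<lambda>(A, B). cond_loss C A B) (\<lambda>(A, B). rank A \<le> r \<and> rank B \<le> r) (A, B) \<longleftrightarrow>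
      (case (A, B) of (A, B) \<Rightarrow> rank A \<le> r \<and> rank B \<le> r) \<and> pos_def (symm (shifted C B))
        \<and> phi C A (symm (shifted C B)) = m"
      by (rule cond_loss_arg_min_iff[OF C]) (use M0 min0 in \<open>auto simp: sy0 m_def\<close>)
    then show ?thesis by simp
  qed
  show "is_arg_min (\<lambda>(A, B). cond_loss C A B) (\<lambda>(A, B). rank A \<le> r \<and> rank B \<le> r) (A, B) \<and> transpose B = B
      \<longleftrightarrow> is_arg_min (reduced_objective r C) (\<lambda>B. rank B \<le> r) B \<and>
        (\<exists>T. is_svd_trunc r (whitened C B) T \<and>
          A = mat_sqrt (shifted C B) ** T ** matrix_inv ?L)" (is "?lhs \<longleftrightarrow> ?rhs")
  proof
    assume ?lhs
    then have sym: "transpose B = B" and rA: "rank A \<le> r" and rB: "rank B \<le> r"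
      and M: "pos_def (shifted C B)" and phim: "phi C A (shifted C B) = m"
      using symm_shifted[OF C, of B] unfolding loss_iff by auto
    let ?M = "shifted C B"
    have psim: "psi ?M = m" using psi_le[OF M rA] psi_ge[OF M] phim by simp
    then have "(norm (X A ?M - W ?M))\<^sup>2 = (norm (svd_trunc r (W ?M) - W ?M))\<^sup>2"
      using phi[OF M, of A] phim by (simp add: psi_def)
    then have "norm (X A ?M - W ?M) = norm (svd_trunc r (W ?M) - W ?M)" by simp
    \<comment> \<open>Equal distance does not force equality with \<open>svd_trunc\<close>: tied
      singular values allow several best approximations, hence the relation.\<close>
    then have "is_svd_trunc r (W ?M) (X A ?M)"
      using opt(2)[of _ "W ?M"] rX[of A ?M] rA by (intro best_approx_is_svd_trunc[OF r]) simp_all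
    moreover have "A = mat_sqrt ?M ** X A ?M ** matrix_inv ?L" using X_eq[OF M] by blast
    ultimately show ?rhs unfolding red_iff W using rB M psim by blast
  next
    assume ?rhs
    then obtain T where rB: "rank B \<le> r" and M: "pos_def (shifted C B)" and psim: "psi (shifted C B) = m"
      and T: "is_svd_trunc r (W (shifted C B)) T" and A: "A = mat_sqrt (shifted C B) ** T ** matrix_inv ?L"
      unfolding red_iff W by blast
    let ?M = "shifted C B"
    note optT = is_svd_trunc_optimal[OF T r]
    have "norm (T - W ?M) = norm (svd_trunc r (W ?M) - W ?M)"
      by (intro order_antisym optT opt)
    moreover have "X A ?M = T" unfolding X_eq[OF M] by (rule A)
    ultimately have "phi C A ?M = m" using psim by (simp add: phi[OF M] psi_def)
    moreover have "rank A \<le> r" unfolding A by (rule order_trans[OF rank_mult_middle optT(1)])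
    moreover have sym: "transpose B = B" by (rule transpose_eq_if_shifted[OF C M])
    ultimately show ?lhs unfolding loss_iff symm_shifted[OF C sym] using rB M by simp
  qed
qed

theorem theorem5p3:
  fixes C :: "real^('u::finite + 'v::finite)^('u + 'v)"
  assumes C: "pos_def C"
  shows
    "(let A_opt = matrix_inv (C_u_given_v C) ** C_uv C ** matrix_inv (C_vv C);
          B_opt = matrix_inv (C_uu C) ** C_uv C ** matrix_inv (C_v_given_u C)
                    ** C_vu C ** matrix_inv (C_uu C)
      in is_arg_min (\<lambda>(A, B). cond_loss C A B) (\<lambda>_. True) (A_opt, B_opt) \<and>
         (\<forall>A B. is_arg_min (\<lambda>(A, B). cond_loss C A B) (\<lambda>_. True) (A, B) \<and> transpose B = B
            \<longrightarrow> A = A_opt \<and> B = B_opt))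
     \<and>
     (\<forall>r. 0 < r \<and> r \<le> min CARD('u) CARD('v) \<longrightarrow>
        (\<exists>B. is_arg_min (reduced_objective r C) (\<lambda>B. rank B \<le> r) B) \<and>
        (\<forall>A B. is_arg_min (\<lambda>(A, B). cond_loss C A B) (\<lambda>(A, B). rank A \<le> r \<and> rank B \<le> r) (A, B)
                 \<and> transpose B = B
           \<longleftrightarrow>
           is_arg_min (reduced_objective r C) (\<lambda>B. rank B \<le> r) B \<and>
           (\<exists>T. is_svd_trunc r (whitened C B) T \<and>
                A = mat_sqrt (shifted C B) ** T ** matrix_inv (mat_sqrt (C_vv C)))))"
  unfolding Let_def using cond_loss_minimizer[OF C] rank_constrained_minimizers[OF C] by blast

end
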